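(* Let $\mathbf{k}\in\mathbb{N}^d$ and suppose that the mixed multiplicity $e(M;\mathbf{k})$ of $M$ of the type $\mathbf{k}$ is defined. Let $\mathbf{y}$ be an $S_{++}$-filter-regular sequence with respect to $M$ of the type $\mathbf{h}$ with $\mathbf{h}\le\mathbf{k}$, and let $\mathbf{x}$ be an $S_{++}$-filter-regular sequence with respect to $M$ of the type $\mathbf{k}$. Then the mixed multiplicities $e(M/\mathbf{y}M;\mathbf{k}-\mathbf{h})$ and $e(M/\mathbf{x}M;\mathbf{0})$ are defined, and $$e(M;\mathbf{k})=e(M/\mathbf{y}M;\mathbf{k}-\mathbf{h})=e(M/\mathbf{x}M;\mathbf{0}).$$
   Context: $\mathbb{N}$ denotes the nonnegative integers and $d\ge 1$ is an integer. $(A,\mathfrak{m})$ is an Artinian local ring with infinite residue field; $S=\bigoplus_{\mathbf{n}\in\mathbb{N}^d}S_{\mathbf{n}}$ is a finitely generated standard $\mathbb{N}^d$-graded (commutative) algebra over $A$, i.e. $S$ is generated over $A$ by elements of total degree $1$; $M=\bigoplus_{\mathbf{n}\in\mathbb{N}^d}M_{\mathbf{n}}$ is a finitely generated $\mathbb{N}^d$-graded $S$-module. On $\mathbb{N}^d$, $\le$ is componentwise, $\mathbf{h}>\mathbf{k}$ means $\mathbf{h}\ge\mathbf{k}$ and $\mathbf{h}\ne\mathbf{k}$, and $\mathbf{0}=(0,\ldots,0)$. "For all large $\mathbf{n}$" means for all $\mathbf{n}$ with every component sufficiently large. Let $\mathbf{e}_i$ be the $i$-th unit vector of $\mathbb{N}^d$,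 $S_i=S_{\mathbf{e}_i}$, and $S_{++}=\bigoplus_{\mathbf{n}\ge(1,\ldots,1)}S_{\mathbf{n}}$. Mixed multiplicities: $\ell_A$ denotes length. For every finitely generated $\mathbb{N}^d$-graded $S$-module $M$ and all large $\mathbf{n}$, $\ell_A[M_{\mathbf{n}}]$ equals a polynomial $P_M(\mathbf{n})$ (the Hilbert polynomial), written uniquely as $P_M(\mathbf{n})=\sum_{\mathbf{k}\in\mathbb{N}^d}e(M;\mathbf{k})\binom{\mathbf{n}+\mathbf{k}}{\mathbf{k}}$ with $e(M;\mathbf{k})\in\mathbb{Z}$, where $\binom{\mathbf{n}+\mathbf{k}}{\mathbf{k}}=\prod_{i=1}^d\binom{n_i+k_i}{k_i}$. The mixed multiplicity (of maximal degree) of $M$ of the type $\mathbf{k}$ is defined if $e(M;\mathbf{h})=0$ for all $\mathbf{h}>\mathbf{k}$, and is then the number $e(M;\mathbf{k})$. Filter-regular sequences: a homogeneous element $a\in S$ is $S_{++}$-filter-regular with respect to $M$ if $(0_M:a)_{\mathbf{n}}=0$ for all large $\mathbf{n}$, where $0_M:a=\{m\in M: am=0\}$. A sequence $x_1,\ldots,x_t$ of homogeneous elements of $S$ is an $S_{++}$-filter-regular sequence with respect to $M$ if each $x_i$ is $S_{++}$-filter-regular with respect to $M/(x_1,\ldots,x_{i-1})M$. A sequence of elements of $\bigcup_{j=1}^dS_j$ consisting of $k_1$ elements of $S_1$, ..., $k_d$ elements of $S_d$ (in any order) is said to be of the type $\mathbf{k}=(k_1,\ldots,k_d)$. *)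

theory Defs
  imports "HOL-Algebra.Module" "HOL-Algebra.QuotRing" "HOL-Algebra.Generated_Rings"
    "HOL-Library.Function_Algebras" "HOL-Library.Extended_Nat"
begin

text \<open>
  Multi-degrees are functions \<open>'d \<Rightarrow> nat\<close> on a finite (hence nonempty) index type, with the
  pointwise operations and the pointwise order; \<open>k < h\<close> is then \<open>k \<le> h \<and> k \<noteq> h\<close>.
\<close>

section \<open>Rings and modules\<close>

locale local_ring = cring A + maximalideal \<mm> A for A (structure) and \<mm> +
  assumes maximal_unique: "maximalideal J A \<Longrightarrow> J = \<mm>"

locale artinian_local_ring = local_ring +
  assumes ideal_dcc:
    "\<lbrakk>\<And>i::nat. ideal (I i) A; \<And>i. I (Suc i) \<subseteq> I i\<rbrakk> \<Longrightarrow> \<exists>j. \<forall>i\<ge>j. I i = I j"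

definition module_length :: "('a, 'p) ring_scheme \<Rightarrow> ('a, 'm, 'r) module_scheme \<Rightarrow> enat" where
  "module_length R M =
     (SUP r \<in> {r. \<exists>N :: nat \<Rightarrow> 'm set.
        (\<forall>i\<le>r. submodule (N i) R M) \<and> (\<forall>i<r. N i \<subset> N (Suc i))}. enat r)"

definition submodule_span ::
    "('s, 'q) ring_scheme \<Rightarrow> ('s, 'm, 'r) module_scheme \<Rightarrow> 'm set \<Rightarrow> 'm set" where
  "submodule_span S M F = \<Inter>{N. submodule N S M \<and> F \<subseteq> N}"

definition fg_module :: "('s, 'q) ring_scheme \<Rightarrow> ('s, 'm, 'r) module_scheme \<Rightarrow> bool" where
  "fg_module S M \<longleftrightarrow>
     (\<exists>F. finite F \<and> F \<subseteq> carrier M \<and> submodule_span S M F = carrier M)"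

definition seq_submodule ::
    "('s, 'q) ring_scheme \<Rightarrow> ('s, 'm, 'r) module_scheme \<Rightarrow> 's list \<Rightarrow> 'm set"
  \<comment> \<open>\<open>(x\<^sub>1, \<dots>, x\<^sub>t)M\<close>\<close> where
  "seq_submodule S M xs =
     submodule_span S M {a \<odot>\<^bsub>M\<^esub> m | a m. a \<in> genideal S (set xs) \<and> m \<in> carrier M}"

text \<open>
  The record \<^typ>\<open>('s, 'm) module\<close> extends that of rings, so the fields \<open>mult\<close> and \<open>one\<close> have to be
  filled in; they play no role for a module.
\<close>

definition quot_module ::
    "('s, 'm, 'r) module_scheme \<Rightarrow> 'm set \<Rightarrow> ('s, 'm set) module" where
  "quot_module M N =
     \<lparr>carrier = a_rcosets\<^bsub>M\<^esub> N, monoid.mult = rcoset_mult M N, one = N +>\<^bsub>M\<^esub> \<one>\<^bsub>M\<^esub>,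
      zero = N, add = set_add M, smult = (\<lambda>a Y. \<Union>x\<in>Y. N +>\<^bsub>M\<^esub> (a \<odot>\<^bsub>M\<^esub> x))\<rparr>"

definition algebra_span ::
    "('a, 'p) ring_scheme \<Rightarrow> ('a, 's, 'q) module_scheme \<Rightarrow> 's set \<Rightarrow> 's set"
  \<comment> \<open>the \<open>A\<close>-subalgebra of \<open>S\<close> generated by \<open>F\<close>\<close> where
  "algebra_span A S F = generate_ring S ((\<lambda>a. a \<odot>\<^bsub>S\<^esub> \<one>\<^bsub>S\<^esub>) ` carrier A \<union> F)"


section \<open>Gradings\<close>

definition unit_vec :: "'d \<Rightarrow> 'd \<Rightarrow> nat" where
  "unit_vec i = (\<lambda>j. if j = i then 1 else 0)"

definition for_large :: "(('d \<Rightarrow> nat) \<Rightarrow> bool) \<Rightarrow> bool" where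
  "for_large P \<longleftrightarrow> (\<exists>N::nat. \<forall>n. (\<forall>i. N \<le> n i) \<longrightarrow> P n)"

definition direct_sum_decomposition ::
    "('m, 'r) ring_scheme \<Rightarrow> (('d \<Rightarrow> nat) \<Rightarrow> 'm set) \<Rightarrow> bool" where
  "direct_sum_decomposition M Mg \<longleftrightarrow>
     (\<forall>n. subgroup (Mg n) (add_monoid M)) \<and>
     (\<forall>x \<in> carrier M. \<exists>!c. (\<forall>n. c n \<in> Mg n) \<and> finite {n. c n \<noteq> \<zero>\<^bsub>M\<^esub>} \<and>
        x = finsum M c {n. c n \<noteq> \<zero>\<^bsub>M\<^esub>})"

locale multigraded_algebra = algebra A S
  for A :: "('a, 'p) ring_scheme" (structure) and S :: "('a, 's, 'q) module_scheme" (structure)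
    and Sg :: "('d::finite \<Rightarrow> nat) \<Rightarrow> 's set" +
  assumes S_decomposition: "direct_sum_decomposition S Sg"
    and Sg_submodule: "submodule (Sg n) A S"
    and Sg_mult: "\<lbrakk>a \<in> Sg m; b \<in> Sg n\<rbrakk> \<Longrightarrow> a \<otimes>\<^bsub>S\<^esub> b \<in> Sg (m + n)"

locale fg_standard_multigraded_algebra = multigraded_algebra +
  assumes S_fg: "\<exists>F. finite F \<and> F \<subseteq> carrier S \<and> algebra_span A S F = carrier S"
    and S_standard: "algebra_span A S (\<Union>i. Sg (unit_vec i)) = carrier S"

locale fg_multigraded_module = module S M
  for S :: "('s, 'q) ring_scheme" (structure) and Sg :: "('d::finite \<Rightarrow> nat) \<Rightarrow> 's set"
    and M :: "('s, 'm, 'r) module_scheme" (structure) and Mg :: "('d \<Rightarrow> nat) \<Rightarrow> 'm set" +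
  assumes M_decomposition: "direct_sum_decomposition M Mg"
    and Mg_smult: "\<lbrakk>a \<in> Sg m; x \<in> Mg n\<rbrakk> \<Longrightarrow> a \<odot>\<^bsub>M\<^esub> x \<in> Mg (m + n)"
    and M_fg: "fg_module S M"

text \<open>The \<open>A\<close>-module \<open>M\<^sub>n\<close>, where \<open>A\<close> acts on \<open>M\<close> through \<open>A \<rightarrow> S\<close>, \<open>a \<mapsto> a \<cdot> 1\<close>.\<close>

definition graded_piece ::
    "('a, 's, 'q) module_scheme \<Rightarrow> ('s, 'm, 'r) module_scheme \<Rightarrow> (('d \<Rightarrow> nat) \<Rightarrow> 'm set)
      \<Rightarrow> ('d \<Rightarrow> nat) \<Rightarrow> ('a, 'm) module" where
  "graded_piece S M Mg n =
     \<lparr>carrier = Mg n, monoid.mult = monoid.mult M, one = one M, zero = zero M, add = add M,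
      smult = (\<lambda>a x. (a \<odot>\<^bsub>S\<^esub> \<one>\<^bsub>S\<^esub>) \<odot>\<^bsub>M\<^esub> x)\<rparr>"

definition quot_grading ::
    "('m, 'r) ring_scheme \<Rightarrow> (('d \<Rightarrow> nat) \<Rightarrow> 'm set) \<Rightarrow> 'm set \<Rightarrow> ('d \<Rightarrow> nat) \<Rightarrow> 'm set set"
  \<comment> \<open>the images of the \<open>M\<^sub>n\<close> in \<open>M/N\<close>\<close> where
  "quot_grading M Mg N n = (\<lambda>x. N +>\<^bsub>M\<^esub> x) ` Mg n"


section \<open>Mixed multiplicities\<close>

definition is_hilbert_expansion ::
    "('a, 'p) ring_scheme \<Rightarrow> ('a, 's, 'q) module_scheme \<Rightarrow> ('s, 'm, 'r) module_scheme
      \<Rightarrow> (('d::finite \<Rightarrow> nat) \<Rightarrow> 'm set) \<Rightarrow> (('d \<Rightarrow> nat) \<Rightarrow> int) \<Rightarrow> bool" where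
  "is_hilbert_expansion A S M Mg e \<longleftrightarrow>
     finite {k. e k \<noteq> 0} \<and>
     for_large (\<lambda>n. \<exists>l. module_length A (graded_piece S M Mg n) = enat l \<and>
       int l = (\<Sum>k | e k \<noteq> 0. e k * (\<Prod>i\<in>UNIV. int ((n i + k i) choose k i))))"

definition hilbert_coeff ::
    "('a, 'p) ring_scheme \<Rightarrow> ('a, 's, 'q) module_scheme \<Rightarrow> ('s, 'm, 'r) module_scheme
      \<Rightarrow> (('d::finite \<Rightarrow> nat) \<Rightarrow> 'm set) \<Rightarrow> ('d \<Rightarrow> nat) \<Rightarrow> int"
  \<comment> \<open>\<open>e(M; k)\<close>; the expansion exists and is unique for finitely generated graded \<open>M\<close>
      over a standard algebra over an Artinian local ring\<close> where
  "hilbert_coeff A S M Mg = (THE e. is_hilbert_expansion A S M Mg e)"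

definition mixed_mult_defined ::
    "('a, 'p) ring_scheme \<Rightarrow> ('a, 's, 'q) module_scheme \<Rightarrow> ('s, 'm, 'r) module_scheme
      \<Rightarrow> (('d::finite \<Rightarrow> nat) \<Rightarrow> 'm set) \<Rightarrow> ('d \<Rightarrow> nat) \<Rightarrow> bool" where
  "mixed_mult_defined A S M Mg k \<longleftrightarrow> (\<forall>h>k. hilbert_coeff A S M Mg h = 0)"


section \<open>Filter-regular sequences\<close>

definition filter_regular ::
    "(('d \<Rightarrow> nat) \<Rightarrow> 's set) \<Rightarrow> ('s, 'm, 'r) module_scheme
      \<Rightarrow> (('d \<Rightarrow> nat) \<Rightarrow> 'm set) \<Rightarrow> 's \<Rightarrow> bool" where
  "filter_regular Sg M Mg a \<longleftrightarrow>
     (\<exists>j. a \<in> Sg j) \<and>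
     for_large (\<lambda>n. {x \<in> carrier M. a \<odot>\<^bsub>M\<^esub> x = \<zero>\<^bsub>M\<^esub>} \<inter> Mg n = {\<zero>\<^bsub>M\<^esub>})"

definition filter_regular_seq ::
    "('s, 'q) ring_scheme \<Rightarrow> (('d \<Rightarrow> nat) \<Rightarrow> 's set) \<Rightarrow> ('s, 'm, 'r) module_scheme
      \<Rightarrow> (('d \<Rightarrow> nat) \<Rightarrow> 'm set) \<Rightarrow> 's list \<Rightarrow> bool" where
  "filter_regular_seq S Sg M Mg xs \<longleftrightarrow>
     (\<forall>i<length xs. let N = seq_submodule S M (take i xs)
        in filter_regular Sg (quot_module M N) (quot_grading M Mg N) (xs ! i))"

text \<open>
  The zero element lies in every \<open>S\<^sub>j\<close>, so the type is read off from an assignment of indices to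
  the positions of the sequence rather than by counting the members of each \<open>S\<^sub>j\<close>.
\<close>

definition seq_of_type ::
    "(('d \<Rightarrow> nat) \<Rightarrow> 's set) \<Rightarrow> 's list \<Rightarrow> ('d \<Rightarrow> nat) \<Rightarrow> bool" where
  "seq_of_type Sg xs k \<longleftrightarrow>
     (\<exists>js. list_all2 (\<lambda>x j. x \<in> Sg (unit_vec j)) xs js \<and> (\<forall>j. count_list js j = k j))"

end

theory Submission
  imports Defs "HOL-Algebra.Ring_Divisibility" "HOL-Library.List_Lexorder"
begin

text \<open>
  The length of \<open>M\<^sub>n\<close> is a polynomial in \<open>n\<close> for large \<open>n\<close>, and the proof follows what happens to this polynomial when
  \<open>M\<close> is divided by one filter-regular element at a time. If \<open>N\<close> is a graded submodule and \<open>x \<in> S\<^sub>i\<close> is filter-regular with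
  respect to \<open>M/N\<close>, then multiplication by \<open>x\<close> gives exact sequences
  \<open>0 \<rightarrow> (M/N)\<^sub>n\<^sub>-\<^sub>\<epsilon> \<rightarrow> (M/N)\<^sub>n \<rightarrow> (M/(N + xM))\<^sub>n \<rightarrow> 0\<close> for large \<open>n\<close>, where \<open>\<epsilon>\<close> is the \<open>i\<close>-th unit vector
  (lemma \<open>quot_length_filter_regular\<close>). So the Hilbert polynomial of \<open>M/(N + xM)\<close> is the backward difference of
  that of \<open>M/N\<close> in direction \<open>i\<close>, and by Pascal's rule this shifts the coefficients with respect to the binomial basis by \<open>\<epsilon>\<close>
  (\<open>has_expansion_diff\<close>). For a filter-regular sequence of type \<open>h\<close> the coefficient of the quotient at \<open>k\<close> is therefore
  \<open>e(M; k + h)\<close> (\<open>hilbert_coeff_filter_regular_quotient\<close>), and the claims are read off.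

  The coefficients are defined by a unique description, so the argument rests on the uniqueness
  (\<open>has_expansion_unique\<close>) and the existence (\<open>hilbert_function_expandable\<close>) of the expansion.

  Existence is obtained from an explicit filtration in the style of Macaulay. Over \<open>A\<close> the piece \<open>M\<^sub>n\<close> is spanned by products
  \<open>x\<^sup>u g\<close> of monomials in finitely many elements of degree one with finitely many homogeneous generators. Adjoin these
  in lexicographic order of \<open>u\<close>. The length \<open>f(u)\<close> gained at \<open>x\<^sup>u g\<close> is at most the length of \<open>A\<close>, which is finite
  (\<open>artinian_finite_length\<close>), and it is antitone in \<open>u\<close>, since multiplication by a monomial respects the order. An
  antitone function from \<open>\<nat>\<^sup>r\<close> to \<open>\<nat>\<close> is determined by its values on a finite box (\<open>antitone_truncation\<close>). So the sum of
  \<open>f(u)\<close> over the monomials of degree \<open>n\<close> is a finite combination of coefficients of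
  power series \<open>\<Prod>\<^sub>i t\<^sub>i\<^sup>c / (1 - t\<^sub>i)\<^sup>a\<close>, which are eventually polynomial.
\<close>

section \<open>Lengths of families of sets\<close>

text \<open>The length of a module is the length of its lattice of submodules. Working with arbitrary families of sets
  lets one treat intervals of submodules and families of ideals alike, and compare lengths through maps between
  families.\<close>

definition chain_length :: "'m set set \<Rightarrow> enat" where
  "chain_length L =
     (SUP r \<in> {r. \<exists>N :: nat \<Rightarrow> 'm set. (\<forall>i\<le>r. N i \<in> L) \<and> (\<forall>i<r. N i \<subset> N (Suc i))}. enat r)"

lemma module_length_eq: "module_length R M = chain_length {N. submodule N R M}"
  by (simp add: module_length_def chain_length_def)

lemma chain_length_geI:
  assumes "\<And>i. i \<le> r \<Longrightarrow> N i \<in> L" and "\<And>i. i < r \<Longrightarrow> N i \<subset> N (Suc i)"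
  shows "enat r \<le> chain_length L"
  unfolding chain_length_def by (rule SUP_upper) (use assms in blast)

lemma chain_length_leI:
  assumes "\<And>r N. \<lbrakk>\<And>i. i \<le> r \<Longrightarrow> N i \<in> L; \<And>i. i < r \<Longrightarrow> N i \<subset> N (Suc i)\<rbrakk> \<Longrightarrow> enat r \<le> b"
  shows "chain_length L \<le> b"
  unfolding chain_length_def by (rule SUP_least) (use assms in blast)

lemma chain_length_exists:
  assumes "enat r \<le> chain_length L" "L \<noteq> {}"
  obtains N where "\<And>i. i \<le> r \<Longrightarrow> N i \<in> L" and "\<And>i. i < r \<Longrightarrow> N i \<subset> N (Suc i)"
proof (cases r)
  case 0
  from assms(2) obtain X where "X \<in> L" by blast
  then show ?thesis using that[of "\<lambda>_. X"] 0 by auto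
next
  case (Suc s)
  show ?thesis
  proof (rule ccontr)
    assume no: "\<not> thesis"
    have "chain_length L \<le> enat s"
    proof (rule chain_length_leI)
      fix r' N
      assume N: "\<And>i. i \<le> r' \<Longrightarrow> N i \<in> L" "\<And>i. i < r' \<Longrightarrow> N i \<subset> N (Suc i)"
      have "\<not> r \<le> r'"
        using that[of N] N no by (meson le_trans less_le_trans)
      then show "enat r' \<le> enat s" using Suc by simp
    qed
    then have "enat r \<le> enat s" using assms(1) by (rule order_trans[rotated])
    then show False using Suc by simp
  qed
qed

lemma chain_length_mono:
  assumes "\<And>P. P \<in> L \<Longrightarrow> f P \<in> L'"
    and "\<And>P Q. \<lbrakk>P \<in> L; Q \<in> L; P \<subset> Q\<rbrakk> \<Longrightarrow> f P \<subset> f Q"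
  shows "chain_length L \<le> chain_length L'"
proof (rule chain_length_leI)
  fix r N
  assume N: "\<And>i. i \<le> r \<Longrightarrow> N i \<in> L" "\<And>i. i < r \<Longrightarrow> N i \<subset> N (Suc i)"
  show "enat r \<le> chain_length L'"
    by (rule chain_length_geI[of r "\<lambda>i. f (N i)"]) (simp_all add: assms N)
qed

lemma enat_add_leI:
  fixes a b c :: enat
  assumes "\<And>r s. \<lbrakk>enat r \<le> a; enat s \<le> b\<rbrakk> \<Longrightarrow> enat (r + s) \<le> c"
  shows "a + b \<le> c"
proof -
  have inf: "c = \<infinity>" if "\<And>r. enat r \<le> c"
    using that by (metis Suc_ile_eq enat.exhaust less_irrefl)
  show ?thesis
  proof (cases a)
    case a: (enat r)
    show ?thesis
    proof (cases b)
      case (enat s)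
      then show ?thesis using assms[of r s] a by simp
    next
      case infinity
      then show ?thesis using inf assms[of 0] by (auto simp: zero_enat_def[symmetric])
    qed
  next
    case infinity
    then show ?thesis using inf assms[of _ 0] by (auto simp: zero_enat_def[symmetric])
  qed
qed

lemma chain_length_superadditive:
  assumes "L1 \<subseteq> L" "L2 \<subseteq> L" "L1 \<noteq> {}" "L2 \<noteq> {}"
    and "\<And>P Q. \<lbrakk>P \<in> L1; Q \<in> L2\<rbrakk> \<Longrightarrow> P \<subseteq> Q"
  shows "chain_length L1 + chain_length L2 \<le> chain_length L"
proof (rule enat_add_leI)
  fix r s
  assume r: "enat r \<le> chain_length L1" and s: "enat s \<le> chain_length L2"
  obtain N where N: "\<And>i. i \<le> r \<Longrightarrow> N i \<in> L1" "\<And>i. i < r \<Longrightarrow> N i \<subset> N (Suc i)"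
    using chain_length_exists[OF r assms(3)] by blast
  obtain N' where N': "\<And>i. i \<le> s \<Longrightarrow> N' i \<in> L2" "\<And>i. i < s \<Longrightarrow> N' i \<subset> N' (Suc i)"
    using chain_length_exists[OF s assms(4)] by blast
  define C where "C i = (if i \<le> r then N i else N' (i - r))" for i
  show "enat (r + s) \<le> chain_length L"
  proof (rule chain_length_geI[of _ C])
    fix i assume "i \<le> r + s"
    then show "C i \<in> L" using N(1)[of i] N'(1)[of "i - r"] assms(1,2) by (auto simp: C_def)
  next
    fix i assume i: "i < r + s"
    consider "i < r" | "i = r" | "i > r" by linarith
    then show "C i \<subset> C (Suc i)"
    proof cases
      case 1
      then show ?thesis using N(2)[of i] by (simp add: C_def)
    next
      case 2
      then have "N r \<subseteq> N' 0" "N' 0 \<subset> N' 1" using assms(5) N(1)[of r] N'(1)[of 0] N'(2)[of 0] i by auto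
      then show ?thesis using 2 by (auto simp: C_def)
    next
      case 3
      then show ?thesis using N'(2)[of "i - r"] i by (simp add: C_def Suc_diff_le)
    qed
  qed
qed

lemma chain_length_subset: "L \<subseteq> L' \<Longrightarrow> chain_length L \<le> chain_length L'"
  by (rule chain_length_mono[of _ "\<lambda>x. x"]) auto

lemma chain_length_below_strict:
  assumes "Y \<subset> Y'" "Y \<in> L" "Y' \<in> L"
  shows "chain_length {Z \<in> L. Z \<subseteq> Y} + 1 \<le> chain_length {Z \<in> L. Z \<subseteq> Y'}"
proof -
  have "enat 1 \<le> chain_length {Y, Y'}"
    by (rule chain_length_geI[of _ "\<lambda>i. if i = 0 then Y else Y'"]) (use assms in auto)
  then have "chain_length {Z \<in> L. Z \<subseteq> Y} + 1 \<le> chain_length {Z \<in> L. Z \<subseteq> Y} + chain_length {Y, Y'}"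
    by (intro add_left_mono) (simp add: one_enat_def)
  also have "\<dots> \<le> chain_length {Z \<in> L. Z \<subseteq> Y'}"
    by (rule chain_length_superadditive) (use assms in auto)
  finally show ?thesis .
qed

text \<open>A strict step of a chain is seen by at least one of the two monotone maps, so the ranks of
  the two images together grow at least as fast as the chain.\<close>

lemma chain_length_subadditive:
  assumes f: "\<And>P. P \<in> L \<Longrightarrow> f P \<in> L1" "\<And>P Q. \<lbrakk>P \<in> L; Q \<in> L; P \<subseteq> Q\<rbrakk> \<Longrightarrow> f P \<subseteq> f Q"
    and g: "\<And>P. P \<in> L \<Longrightarrow> g P \<in> L2" "\<And>P Q. \<lbrakk>P \<in> L; Q \<in> L; P \<subseteq> Q\<rbrakk> \<Longrightarrow> g P \<subseteq> g Q"
    and strict: "\<And>P Q. \<lbrakk>P \<in> L; Q \<in> L; P \<subseteq> Q; f P = f Q; g P = g Q\<rbrakk> \<Longrightarrow> P = Q"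
  shows "chain_length L \<le> chain_length L1 + chain_length L2"
proof (rule chain_length_leI)
  fix r N
  assume N: "\<And>i. i \<le> r \<Longrightarrow> N i \<in> L" "\<And>i. i < r \<Longrightarrow> N i \<subset> N (Suc i)"
  have "enat i \<le> chain_length {Z \<in> L1. Z \<subseteq> f (N i)} + chain_length {Z \<in> L2. Z \<subseteq> g (N i)}"
    if "i \<le> r" for i
    using that
  proof (induction i)
    case 0
    then show ?case by (simp add: zero_enat_def[symmetric])
  next
    case (Suc i)
    let ?a = "\<lambda>i. chain_length {Z \<in> L1. Z \<subseteq> f (N i)}"
    let ?b = "\<lambda>i. chain_length {Z \<in> L2. Z \<subseteq> g (N i)}"
    have L: "N i \<in> L" "N (Suc i) \<in> L" "N i \<subset> N (Suc i)" using N Suc by auto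
    have sub: "f (N i) \<subseteq> f (N (Suc i))" "g (N i) \<subseteq> g (N (Suc i))" using f(2) g(2) L by auto
    have IH: "enat i \<le> ?a i + ?b i" using Suc by simp
    have mono: "?a i \<le> ?a (Suc i)" "?b i \<le> ?b (Suc i)"
      using sub by (auto intro!: chain_length_subset)
    have "f (N i) \<subset> f (N (Suc i)) \<or> g (N i) \<subset> g (N (Suc i))" 
      using strict[of "N i" "N (Suc i)"] L sub by auto
    then have "?a i + ?b i + 1 \<le> ?a (Suc i) + ?b (Suc i)"
    proof
      assume "f (N i) \<subset> f (N (Suc i))"
      then have "?a i + 1 \<le> ?a (Suc i)"
        by (rule chain_length_below_strict) (use f(1) L in auto)
      then have "(?a i + 1) + ?b i \<le> ?a (Suc i) + ?b (Suc i)" using mono by (intro add_mono)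
      then show ?thesis by (simp add: ac_simps)
    next
      assume "g (N i) \<subset> g (N (Suc i))"
      then have "?b i + 1 \<le> ?b (Suc i)"
        by (rule chain_length_below_strict) (use g(1) L in auto)
      then have "?a i + (?b i + 1) \<le> ?a (Suc i) + ?b (Suc i)" using mono by (intro add_mono)
      then show ?thesis by (simp add: ac_simps)
    qed
    moreover have "enat (Suc i) \<le> ?a i + ?b i + 1"
      using add_right_mono[OF IH, of 1] by (simp add: one_enat_def)
    ultimately show ?case by (rule order_trans[rotated])
  qed
  then have "enat r \<le> chain_length {Z \<in> L1. Z \<subseteq> f (N r)} + chain_length {Z \<in> L2. Z \<subseteq> g (N r)}" by simp
  also have "\<dots> \<le> chain_length L1 + chain_length L2"
    by (intro add_mono chain_length_subset) auto
  finally show "enat r \<le> chain_length L1 + chain_length L2" .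
qed

section \<open>Submodules and relative lengths\<close>

text \<open>The length of \<open>Q/P\<close>, read off from the submodules between \<open>P\<close> and \<open>Q\<close>; no quotient has to be
  formed, and \<open>Q\<close> and \<open>P\<close> may vary freely inside \<open>M\<close>.\<close>

definition relative_length ::
    "('a, 'p) ring_scheme \<Rightarrow> ('a, 'm, 'r) module_scheme \<Rightarrow> 'm set \<Rightarrow> 'm set \<Rightarrow> enat" where
  "relative_length R M P Q = chain_length {N. submodule N R M \<and> P \<subseteq> N \<and> N \<subseteq> Q}"

context module
begin

lemma submodule_iff:
  "submodule N R M \<longleftrightarrow> N \<subseteq> carrier M \<and> \<zero>\<^bsub>M\<^esub> \<in> N \<and> (\<forall>x\<in>N. \<forall>y\<in>N. x \<oplus>\<^bsub>M\<^esub> y \<in> N) \<and>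
     (\<forall>a\<in>carrier R. \<forall>x\<in>N. a \<odot>\<^bsub>M\<^esub> x \<in> N)" (is "_ \<longleftrightarrow> ?r")
proof
  assume N: "submodule N R M"
  then have "\<zero>\<^bsub>M\<^esub> \<in> N"
    using submodule.axioms(1) subgroup.one_closed by fastforce
  then show ?r using submoduleE[OF N] by blast
next
  assume r: ?r
  show "submodule N R M"
  proof (rule submoduleI)
    fix x assume x: "x \<in> N"
    then have "x \<in> carrier M" using r by blast
    then have "(\<ominus> \<one>) \<odot>\<^bsub>M\<^esub> x = \<ominus>\<^bsub>M\<^esub> x" by (simp add: smult_l_minus)
    then show "\<ominus>\<^bsub>M\<^esub> x \<in> N" using r x by (metis R.add.inv_closed R.one_closed)
  qed (use r in auto)
qed

lemma submoduleD:
  assumes "submodule N R M"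
  shows "x \<in> N \<Longrightarrow> x \<in> carrier M" "\<zero>\<^bsub>M\<^esub> \<in> N" "\<lbrakk>x \<in> N; y \<in> N\<rbrakk> \<Longrightarrow> x \<oplus>\<^bsub>M\<^esub> y \<in> N"
    "\<lbrakk>a \<in> carrier R; x \<in> N\<rbrakk> \<Longrightarrow> a \<odot>\<^bsub>M\<^esub> x \<in> N" "x \<in> N \<Longrightarrow> \<ominus>\<^bsub>M\<^esub> x \<in> N"
    "\<lbrakk>x \<in> N; y \<in> N\<rbrakk> \<Longrightarrow> x \<ominus>\<^bsub>M\<^esub> y \<in> N"
  using assms submoduleE[OF assms] by (auto simp: submodule_iff a_minus_def)

lemma submodule_cancel:
  assumes "submodule N R M" "x \<in> carrier M" "y \<in> N" "x \<oplus>\<^bsub>M\<^esub> y \<in> N"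
  shows "x \<in> N"
proof -
  have y: "y \<in> carrier M" using assms submoduleD(1) by blast
  have "(x \<oplus>\<^bsub>M\<^esub> y) \<oplus>\<^bsub>M\<^esub> \<ominus>\<^bsub>M\<^esub> y = x" using assms(2) y by (simp add: M.a_assoc M.r_neg)
  then show ?thesis using submoduleD(3,5)[OF assms(1)] assms(3,4) by metis
qed

lemma submodule_Int: "\<lbrakk>submodule P R M; submodule Q R M\<rbrakk> \<Longrightarrow> submodule (P \<inter> Q) R M"
  by (auto simp: submodule_iff)

lemma submodule_zero: "submodule {\<zero>\<^bsub>M\<^esub>} R M"
  by (auto simp: submodule_iff)

lemma mem_set_add: "x \<in> P <+>\<^bsub>M\<^esub> Q \<longleftrightarrow> (\<exists>p\<in>P. \<exists>q\<in>Q. x = p \<oplus>\<^bsub>M\<^esub> q)"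
  by (auto simp: set_add_def')

lemma submodule_set_add:
  assumes P: "submodule P R M" and Q: "submodule Q R M"
  shows "submodule (P <+>\<^bsub>M\<^esub> Q) R M"
proof -
  note D = submoduleD[OF P] submoduleD[OF Q]
  show ?thesis
    unfolding submodule_iff
  proof (intro conjI ballI subsetI)
    fix x assume "x \<in> P <+>\<^bsub>M\<^esub> Q"
    then show "x \<in> carrier M" using D(1,7) by (auto simp: mem_set_add)
  next
    show "\<zero>\<^bsub>M\<^esub> \<in> P <+>\<^bsub>M\<^esub> Q" unfolding mem_set_add using D(2,8) M.r_zero M.zero_closed by metis
  next
    fix x y assume "x \<in> P <+>\<^bsub>M\<^esub> Q" "y \<in> P <+>\<^bsub>M\<^esub> Q"
    then obtain p q p' q' where *: "p \<in> P" "q \<in> Q" "p' \<in> P" "q' \<in> Q"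
      "x = p \<oplus>\<^bsub>M\<^esub> q" "y = p' \<oplus>\<^bsub>M\<^esub> q'" by (auto simp: mem_set_add)
    then have "x \<oplus>\<^bsub>M\<^esub> y = (p \<oplus>\<^bsub>M\<^esub> p') \<oplus>\<^bsub>M\<^esub> (q \<oplus>\<^bsub>M\<^esub> q')"
      using D(1,7) by (simp add: M.a_ac)
    moreover have "p \<oplus>\<^bsub>M\<^esub> p' \<in> P" "q \<oplus>\<^bsub>M\<^esub> q' \<in> Q" using * D by auto
    ultimately show "x \<oplus>\<^bsub>M\<^esub> y \<in> P <+>\<^bsub>M\<^esub> Q" unfolding mem_set_add by blast
  next
    fix a x assume "a \<in> carrier R" "x \<in> P <+>\<^bsub>M\<^esub> Q"
    then obtain p q where *: "a \<in> carrier R" "p \<in> P" "q \<in> Q" "x = p \<oplus>\<^bsub>M\<^esub> q"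
      by (auto simp: mem_set_add)
    then have "a \<odot>\<^bsub>M\<^esub> x = a \<odot>\<^bsub>M\<^esub> p \<oplus>\<^bsub>M\<^esub> a \<odot>\<^bsub>M\<^esub> q"
      using D(1,7) by (simp add: smult_r_distr)
    moreover have "a \<odot>\<^bsub>M\<^esub> p \<in> P" "a \<odot>\<^bsub>M\<^esub> q \<in> Q" using * D by auto
    ultimately show "a \<odot>\<^bsub>M\<^esub> x \<in> P <+>\<^bsub>M\<^esub> Q" unfolding mem_set_add by blast
  qed
qed

lemma set_add_upper:
  assumes P: "submodule P R M" and Q: "submodule Q R M"
  shows "P \<subseteq> P <+>\<^bsub>M\<^esub> Q" "Q \<subseteq> P <+>\<^bsub>M\<^esub> Q"
proof -
  show "P \<subseteq> P <+>\<^bsub>M\<^esub> Q"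
    unfolding mem_set_add subset_iff
    using submoduleD[OF P] submoduleD[OF Q] by (metis M.r_zero)
  show "Q \<subseteq> P <+>\<^bsub>M\<^esub> Q"
    unfolding mem_set_add subset_iff
    using submoduleD[OF P] submoduleD[OF Q] by (metis M.l_zero)
qed

lemma set_add_least:
  assumes "submodule N R M" "P \<subseteq> N" "Q \<subseteq> N"
  shows "P <+>\<^bsub>M\<^esub> Q \<subseteq> N"
  using assms submoduleD(3)[OF assms(1)] unfolding mem_set_add subset_iff by blast

lemma submodule_span_props:
  assumes "F \<subseteq> carrier M"
  shows "submodule (submodule_span R M F) R M" "F \<subseteq> submodule_span R M F"
  using assms carrier_is_submodule by (auto simp: submodule_span_def submodule_iff)

lemma submodule_span_least:
  assumes "submodule N R M" "F \<subseteq> N"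
  shows "submodule_span R M F \<subseteq> N"
  using assms by (auto simp: submodule_span_def)

lemma submodule_span_mono:
  "F \<subseteq> F' \<Longrightarrow> submodule_span R M F \<subseteq> submodule_span R M F'"
  by (auto simp: submodule_span_def)

lemma submodule_cyclic:
  assumes "w \<in> carrier M"
  shows "submodule {a \<odot>\<^bsub>M\<^esub> w | a. a \<in> carrier R} R M"
proof -
  let ?C = "{a \<odot>\<^bsub>M\<^esub> w | a. a \<in> carrier R}"
  have 0: "\<zero>\<^bsub>M\<^esub> = \<zero> \<odot>\<^bsub>M\<^esub> w" using assms by simp
  then have "\<zero>\<^bsub>M\<^esub> \<in> ?C" by blast
  moreover have "(a \<odot>\<^bsub>M\<^esub> w) \<oplus>\<^bsub>M\<^esub> (b \<odot>\<^bsub>M\<^esub> w) \<in> ?C" if "a \<in> carrier R" "b \<in> carrier R" for a b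
    using that assms smult_l_distr[of a b w, symmetric] by auto
  moreover have "a \<odot>\<^bsub>M\<^esub> (b \<odot>\<^bsub>M\<^esub> w) \<in> ?C" if "a \<in> carrier R" "b \<in> carrier R" for a b
    using that assms smult_assoc1[of a b w, symmetric] by auto
  ultimately show ?thesis
    unfolding submodule_iff using assms by auto
qed

lemma submodule_span_insert:
  assumes "w \<in> carrier M" "F \<subseteq> carrier M"
  shows "submodule_span R M (insert w F) = submodule_span R M F <+>\<^bsub>M\<^esub> {a \<odot>\<^bsub>M\<^esub> w | a. a \<in> carrier R}"
    (is "?l = ?r")
proof
  note C = submodule_cyclic[OF assms(1)] and F = submodule_span_props[OF assms(2)]
  have "w = \<one> \<odot>\<^bsub>M\<^esub> w" using assms by simp
  then have "w \<in> {a \<odot>\<^bsub>M\<^esub> w | a. a \<in> carrier R}" by blast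
  then have "insert w F \<subseteq> ?r" using set_add_upper[OF F(1) C] F(2) by blast
  then show "?l \<subseteq> ?r" using submodule_span_least submodule_set_add[OF F(1) C] by blast
  have I: "insert w F \<subseteq> carrier M" using assms by auto
  note L = submodule_span_props[OF I]
  show "?r \<subseteq> ?l"
  proof (rule set_add_least[OF L(1)])
    show "submodule_span R M F \<subseteq> ?l" by (rule submodule_span_mono) auto
    show "{a \<odot>\<^bsub>M\<^esub> w | a. a \<in> carrier R} \<subseteq> ?l" using L submoduleD(4)[OF L(1)] by auto
  qed
qed

text \<open>The modular law makes \<open>N \<mapsto> (N \<inter> Q, N + Q)\<close> injective on chains.\<close>

lemma relative_length_add:
  assumes P: "submodule P R M" and Q: "submodule Q R M" and T: "submodule T R M"
    and PQ: "P \<subseteq> Q" and QT: "Q \<subseteq> T"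
  shows "relative_length R M P T = relative_length R M P Q + relative_length R M Q T"
proof (rule antisym)
  show "relative_length R M P Q + relative_length R M Q T \<le> relative_length R M P T"
    unfolding relative_length_def
    by (rule chain_length_superadditive) (use assms in auto)
  show "relative_length R M P T \<le> relative_length R M P Q + relative_length R M Q T"
    unfolding relative_length_def
  proof (rule chain_length_subadditive[where f = "\<lambda>N. N \<inter> Q" and g = "\<lambda>N. N <+>\<^bsub>M\<^esub> Q"], goal_cases)
    case (1 N)
    then show ?case using submodule_Int Q PQ by auto
  next
    case (2 N N')
    then show ?case by auto
  next
    case (3 N)
    then show ?case
      using submodule_set_add[OF _ Q] set_add_upper[OF _ Q] set_add_least[OF T] QT by auto
  next
    case (4 N N')
    then show ?case unfolding mem_set_add subset_iff by blast
  next
    case (5 N N')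
    have "N' \<subseteq> N"
    proof
      fix x assume x: "x \<in> N'"
      then have "x \<in> N' <+>\<^bsub>M\<^esub> Q" using set_add_upper(1)[OF _ Q] 5 by blast
      then have "x \<in> N <+>\<^bsub>M\<^esub> Q" using 5(5) by simp
      then obtain y q where y: "y \<in> N" "q \<in> Q" "x = y \<oplus>\<^bsub>M\<^esub> q" by (auto simp: mem_set_add)
      have N: "submodule N R M" "submodule N' R M" using 5 by auto
      have "q \<oplus>\<^bsub>M\<^esub> y \<in> N'" using x y N Q submoduleD(1) by (metis M.a_comm)
      then have "q \<in> N'" using submodule_cancel[OF N(2)] y 5(3) Q submoduleD(1) by blast
      then have "q \<in> N" using 5(4) y by blast
      then show "x \<in> N" using submoduleD(3)[OF N(1)] y by blast
    qed
    then show ?case using 5 by auto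
  qed
qed

lemma relative_length_self: "relative_length R M P P = 0"
proof -
  have "relative_length R M P P \<le> 0"
    unfolding relative_length_def
  proof (rule chain_length_leI)
    fix r and N :: "nat \<Rightarrow> 'c set"
    assume N: "\<And>i. i \<le> r \<Longrightarrow> N i \<in> {N. submodule N R M \<and> P \<subseteq> N \<and> N \<subseteq> P}"
      "\<And>i. i < r \<Longrightarrow> N i \<subset> N (Suc i)"
    have "r = 0"
    proof (rule ccontr)
      assume "r \<noteq> 0"
      then show False using N(1)[of 0] N(1)[of 1] N(2)[of 0] by auto
    qed
    then show "enat r \<le> 0" by (simp add: zero_enat_def)
  qed
  then show ?thesis by simp
qed

text \<open>The quotient of the two spans is cyclic, isomorphic to \<open>R\<close> modulo the ideal \<open>(span F : w)\<close>. Hence its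
  length is at most that of \<open>R\<close>, and a homomorphism, which can only enlarge the ideal, does not increase it.\<close>

definition length_step :: "'c set \<Rightarrow> 'c \<Rightarrow> enat" where
  "length_step F w = relative_length R M (submodule_span R M F) (submodule_span R M (insert w F))"

lemma span_insert_elem:
  assumes "w \<in> carrier M" "F \<subseteq> carrier M" "submodule J R M" "submodule_span R M F \<subseteq> J"
    "x \<in> submodule_span R M (insert w F)"
  obtains b a where "b \<in> J" "b \<in> submodule_span R M F" "a \<in> carrier R" "x = b \<oplus>\<^bsub>M\<^esub> a \<odot>\<^bsub>M\<^esub> w"
    "x \<in> J \<longleftrightarrow> a \<odot>\<^bsub>M\<^esub> w \<in> J"
proof -
  obtain b a where *: "b \<in> submodule_span R M F" "a \<in> carrier R" "x = b \<oplus>\<^bsub>M\<^esub> a \<odot>\<^bsub>M\<^esub> w"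
    using assms(5) unfolding submodule_span_insert[OF assms(1,2)] by (auto simp: mem_set_add)
  have b: "b \<in> J" using * assms by blast
  have "x \<in> J \<longleftrightarrow> a \<odot>\<^bsub>M\<^esub> w \<in> J"
    using * b submoduleD(1,3)[OF assms(3)] submodule_cancel[OF assms(3), of "a \<odot>\<^bsub>M\<^esub> w" b] assms(1)
    by (metis M.a_comm smult_closed)
  then show thesis using that * b by blast
qed

lemma length_step_antimono:
  assumes F: "F \<subseteq> carrier M" and F': "F' \<subseteq> carrier M" and w: "w \<in> carrier M"
    and phi: "\<And>x. x \<in> carrier M \<Longrightarrow> phi x \<in> carrier M"
      "\<And>x y. \<lbrakk>x \<in> carrier M; y \<in> carrier M\<rbrakk> \<Longrightarrow> phi (x \<oplus>\<^bsub>M\<^esub> y) = phi x \<oplus>\<^bsub>M\<^esub> phi y"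
      "\<And>a x. \<lbrakk>a \<in> carrier R; x \<in> carrier M\<rbrakk> \<Longrightarrow> phi (a \<odot>\<^bsub>M\<^esub> x) = a \<odot>\<^bsub>M\<^esub> phi x"
    and sub: "phi ` F \<subseteq> submodule_span R M F'"
  shows "length_step F' (phi w) \<le> length_step F w"
proof -
  have phi0: "phi \<zero>\<^bsub>M\<^esub> = \<zero>\<^bsub>M\<^esub>"
    using phi(3)[of \<zero> "\<zero>\<^bsub>M\<^esub>"] phi(1)[of "\<zero>\<^bsub>M\<^esub>"] by simp
  have pre: "submodule {m \<in> carrier M. phi m \<in> J} R M" if "submodule J R M" for J
    using submoduleD[OF that] unfolding submodule_iff by (auto simp: phi phi0)
  have I: "insert w F \<subseteq> carrier M" using F w by auto
  note sF = submodule_span_props[OF F] and sI = submodule_span_props[OF I]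
  show ?thesis
    unfolding length_step_def relative_length_def
  proof (rule chain_length_mono[where f = "\<lambda>J. {m \<in> submodule_span R M (insert w F). phi m \<in> J}"], goal_cases)
    case (1 J)
    then have J: "submodule J R M" "submodule_span R M F' \<subseteq> J" by auto
    have "{m \<in> submodule_span R M (insert w F). phi m \<in> J} =
        submodule_span R M (insert w F) \<inter> {m \<in> carrier M. phi m \<in> J}"
      using submoduleD(1)[OF sI(1)] by auto
    then have "submodule {m \<in> submodule_span R M (insert w F). phi m \<in> J} R M"
      using submodule_Int[OF sI(1) pre[OF J(1)]] by simp
    moreover have "submodule_span R M F \<subseteq> {m \<in> carrier M. phi m \<in> J}"
      by (rule submodule_span_least[OF pre[OF J(1)]]) (use sub J(2) F in auto)
    moreover have "submodule_span R M F \<subseteq> submodule_span R M (insert w F)"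
      by (rule submodule_span_mono) auto
    ultimately show ?case by auto
  next
    case (2 J J')
    then have J: "submodule J R M" "submodule_span R M F' \<subseteq> J" "submodule J' R M"
      "J' \<subseteq> submodule_span R M (insert (phi w) F')" by auto
    obtain x where x: "x \<in> J'" "x \<notin> J" using 2 by blast
    then have "x \<in> submodule_span R M (insert (phi w) F')" using J by blast
    then obtain a b where a: "b \<in> J" "a \<in> carrier R" "x = b \<oplus>\<^bsub>M\<^esub> a \<odot>\<^bsub>M\<^esub> phi w" "x \<in> J \<longleftrightarrow> a \<odot>\<^bsub>M\<^esub> phi w \<in> J"
      using span_insert_elem[OF phi(1)[OF w] F' J(1,2)] by metis
    have aw: "a \<odot>\<^bsub>M\<^esub> phi w \<in> carrier M" and b: "b \<in> J'" "b \<in> carrier M"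
      using a phi(1)[OF w] 2(3) submoduleD(1)[OF J(1)] by auto
    then have "a \<odot>\<^bsub>M\<^esub> phi w \<oplus>\<^bsub>M\<^esub> b \<in> J'" using a x by (simp add: M.a_comm)
    then have "a \<odot>\<^bsub>M\<^esub> phi w \<in> J'" using submodule_cancel[OF J(3) aw] b by blast
    then have "phi (a \<odot>\<^bsub>M\<^esub> w) \<in> J'" "phi (a \<odot>\<^bsub>M\<^esub> w) \<notin> J" using a x phi(3) w by auto
    moreover have "a \<odot>\<^bsub>M\<^esub> w \<in> submodule_span R M (insert w F)"
      using submoduleD(4)[OF sI(1)] a sI(2) by blast
    ultimately show ?case using 2(3) by blast
  qed
qed

lemma length_step_le_ring:
  assumes F: "F \<subseteq> carrier M" and w: "w \<in> carrier M"
  shows "length_step F w \<le> chain_length {I. ideal I R}"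
  unfolding length_step_def relative_length_def
proof (rule chain_length_mono[where f = "\<lambda>J. {a \<in> carrier R. a \<odot>\<^bsub>M\<^esub> w \<in> J}"], goal_cases)
  case (1 J)
  then have J: "submodule J R M" by auto
  have sub: "subgroup {a \<in> carrier R. a \<odot>\<^bsub>M\<^esub> w \<in> J} (add_monoid R)"
  proof (rule R.add.subgroupI)
    show "{a \<in> carrier R. a \<odot>\<^bsub>M\<^esub> w \<in> J} \<noteq> {}" using submoduleD(2)[OF J] w by (auto intro!: exI[of _ \<zero>])
    fix a assume a: "a \<in> {a \<in> carrier R. a \<odot>\<^bsub>M\<^esub> w \<in> J}"
    then show "\<ominus> a \<in> {a \<in> carrier R. a \<odot>\<^bsub>M\<^esub> w \<in> J}"
      using w submoduleD(5)[OF J] by (auto simp: smult_l_minus)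
  qed (use w submoduleD[OF J] in \<open>auto simp: smult_l_distr\<close>)
  have cl: "b \<otimes> a \<in> {a \<in> carrier R. a \<odot>\<^bsub>M\<^esub> w \<in> J}"
    if "a \<in> {a \<in> carrier R. a \<odot>\<^bsub>M\<^esub> w \<in> J}" "b \<in> carrier R" for a b
    using that w submoduleD[OF J] by (auto simp: smult_assoc1)
  have "ideal {a \<in> carrier R. a \<odot>\<^bsub>M\<^esub> w \<in> J} R"
    by (rule idealI[OF R.ring_axioms sub]) (use cl R.m_comm in auto)
  then show ?case by simp
next
  case (2 J J')
  then have J: "submodule J R M" "submodule_span R M F \<subseteq> J" "submodule J' R M"
    "J' \<subseteq> submodule_span R M (insert w F)" "submodule_span R M F \<subseteq> J'" by auto
  obtain x where x: "x \<in> J'" "x \<notin> J" using 2 by blast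
  then have "x \<in> submodule_span R M (insert w F)" using J by blast
  then obtain a b where a: "b \<in> submodule_span R M F" "a \<in> carrier R" "x = b \<oplus>\<^bsub>M\<^esub> a \<odot>\<^bsub>M\<^esub> w"
      "x \<in> J \<longleftrightarrow> a \<odot>\<^bsub>M\<^esub> w \<in> J"
    using span_insert_elem[OF w F J(1,2)] by metis
  have aw: "a \<odot>\<^bsub>M\<^esub> w \<in> carrier M" and b: "b \<in> J'" "b \<in> carrier M"
    using a w J(5) submoduleD(1)[OF J(3)] by auto
  then have "a \<odot>\<^bsub>M\<^esub> w \<oplus>\<^bsub>M\<^esub> b \<in> J'" using a x by (simp add: M.a_comm)
  then have "a \<odot>\<^bsub>M\<^esub> w \<in> J'" using submodule_cancel[OF J(3) aw] b by blast
  then show ?case using a x 2(3) by blast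
qed

text \<open>Telescoping: the generators \<open>w u\<close> are adjoined in increasing order of \<open>u\<close>.\<close>

lemma relative_length_filtration:
  fixes w :: "'i::linorder \<Rightarrow> 'c"
  assumes "finite U" and B: "B \<subseteq> carrier M" and w: "\<And>u. u \<in> U \<Longrightarrow> w u \<in> carrier M"
  shows "relative_length R M (submodule_span R M B) (submodule_span R M (B \<union> w ` U)) =
    (\<Sum>u\<in>U. length_step (B \<union> w ` {v \<in> U. v < u}) (w u))"
  using assms(1) w
proof (induction U rule: finite_linorder_max_induct)
  case empty
  then show ?case by (simp add: relative_length_self)
next
  case (insert b U)
  have sub: "B \<union> w ` U \<subseteq> carrier M" "B \<union> w ` insert b U \<subseteq> carrier M" using B insert by auto
  have pre: "{v \<in> insert b U. v < u} = {v \<in> U. v < u}" if "u \<in> U" for u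
    using insert(2) that by force
  have preb: "{v \<in> insert b U. v < b} = U" using insert(2) by auto
  have "relative_length R M (submodule_span R M B) (submodule_span R M (B \<union> w ` insert b U)) =
    relative_length R M (submodule_span R M B) (submodule_span R M (B \<union> w ` U)) +
    relative_length R M (submodule_span R M (B \<union> w ` U)) (submodule_span R M (B \<union> w ` insert b U))"
    using submodule_span_props(1)[OF B] submodule_span_props(1)[OF sub(1)] submodule_span_props(1)[OF sub(2)]
    by (intro relative_length_add submodule_span_mono) auto
  also have "\<dots> = (\<Sum>u\<in>U. length_step (B \<union> w ` {v \<in> U. v < u}) (w u)) + length_step (B \<union> w ` U) (w b)"
    using insert by (simp add: length_step_def)
  also have "\<dots> = (\<Sum>u\<in>insert b U. length_step (B \<union> w ` {v \<in> insert b U. v < u}) (w u))"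
  proof -
    have "b \<notin> U" using insert(2) by auto
    then have "(\<Sum>u\<in>insert b U. length_step (B \<union> w ` {v \<in> insert b U. v < u}) (w u)) =
      length_step (B \<union> w ` U) (w b) + (\<Sum>u\<in>U. length_step (B \<union> w ` {v \<in> insert b U. v < u}) (w u))"
      using insert(1) preb by (subst sum.insert) simp_all
    also have "(\<Sum>u\<in>U. length_step (B \<union> w ` {v \<in> insert b U. v < u}) (w u)) =
      (\<Sum>u\<in>U. length_step (B \<union> w ` {v \<in> U. v < u}) (w u))"
      by (rule sum.cong) (simp_all only: pre)
    finally show ?thesis by (simp only: add.commute)
  qed
  finally show ?case .
qed

text \<open>Correspondence between the submodules of a homomorphic image and those above the kernel.\<close>

lemma module_length_image:
  assumes K: "submodule K R M"
    and img: "phi ` K = carrier V"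
    and zero: "phi \<zero>\<^bsub>M\<^esub> = \<zero>\<^bsub>V\<^esub>"
    and add: "\<And>x y. \<lbrakk>x \<in> K; y \<in> K\<rbrakk> \<Longrightarrow> phi (x \<oplus>\<^bsub>M\<^esub> y) = phi x \<oplus>\<^bsub>V\<^esub> phi y"
    and smult: "\<And>a x. \<lbrakk>a \<in> carrier R; x \<in> K\<rbrakk> \<Longrightarrow> phi (a \<odot>\<^bsub>M\<^esub> x) = a \<odot>\<^bsub>V\<^esub> phi x"
  shows "module_length R V = relative_length R M {x \<in> K. phi x = \<zero>\<^bsub>V\<^esub>} K"
proof -
  note D = submoduleD[OF K]
  have V: "\<exists>x\<in>K. y = phi x" if "y \<in> carrier V" for y using img that by blast
  have cl: "phi x \<in> carrier V" if "x \<in> K" for x using img that by blast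
  have neg: "phi (\<ominus>\<^bsub>M\<^esub> x) \<oplus>\<^bsub>V\<^esub> phi x = \<zero>\<^bsub>V\<^esub>" if "x \<in> K" for x
    using that D(1,5) add[of "\<ominus>\<^bsub>M\<^esub> x" x] by (simp add: M.l_neg zero)
  have modV: "module R V"
  proof (rule moduleI)
    show "cring R" by (rule R.cring_axioms)
    show "abelian_group V"
    proof (rule abelian_groupI, goal_cases)
      case (1 x y)
      then show ?case using V cl add D by metis
    next
      case 2
      then show ?case using cl D(2) zero by metis
    next
      case (3 x y z)
      then obtain x' y' z' where *: "x' \<in> K" "y' \<in> K" "z' \<in> K" "x = phi x'" "y = phi y'" "z = phi z'"
        using V by metis
      have "phi (x' \<oplus>\<^bsub>M\<^esub> y' \<oplus>\<^bsub>M\<^esub> z') = phi (x' \<oplus>\<^bsub>M\<^esub> (y' \<oplus>\<^bsub>M\<^esub> z'))" using * D(1) by (simp add: M.a_assoc)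
      then show ?case using * D(3) by (simp add: add)
    next
      case (4 x y)
      then obtain x' y' where *: "x' \<in> K" "y' \<in> K" "x = phi x'" "y = phi y'"
        using V by metis
      have "phi (x' \<oplus>\<^bsub>M\<^esub> y') = phi (y' \<oplus>\<^bsub>M\<^esub> x')" using * D(1) by (simp add: M.a_comm)
      then show ?case using * by (simp add: add)
    next
      case (5 x)
      then obtain x' where *: "x' \<in> K" "x = phi x'" using V by metis
      have "phi (\<zero>\<^bsub>M\<^esub> \<oplus>\<^bsub>M\<^esub> x') = phi x'" using * D(1) by simp
      then show ?case using * D(2) by (simp add: add zero)
    next
      case (6 x)
      then obtain x' where "x' \<in> K" "x = phi x'" using V by metis
      then show ?case using neg cl D(5) by blast
    qed
  next
    fix a x assume a: "a \<in> carrier R" and x: "x \<in> carrier V"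
    obtain x' where x': "x' \<in> K" "x = phi x'" using V x by metis
    show "a \<odot>\<^bsub>V\<^esub> x \<in> carrier V" using x' a smult cl D by metis
  next
    fix a b x assume a: "a \<in> carrier R" "b \<in> carrier R" and x: "x \<in> carrier V"
    obtain x' where x': "x' \<in> K" "x = phi x'" using V x by metis
    have "phi ((a \<oplus> b) \<odot>\<^bsub>M\<^esub> x') = phi (a \<odot>\<^bsub>M\<^esub> x' \<oplus>\<^bsub>M\<^esub> b \<odot>\<^bsub>M\<^esub> x')"
      using a x' D(1) by (simp add: smult_l_distr)
    then show "(a \<oplus> b) \<odot>\<^bsub>V\<^esub> x = a \<odot>\<^bsub>V\<^esub> x \<oplus>\<^bsub>V\<^esub> b \<odot>\<^bsub>V\<^esub> x"
      using a x' D by (simp add: add smult)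
    have "phi ((a \<otimes> b) \<odot>\<^bsub>M\<^esub> x') = phi (a \<odot>\<^bsub>M\<^esub> (b \<odot>\<^bsub>M\<^esub> x'))"
      using a x' D(1) by (simp add: smult_assoc1)
    then show "(a \<otimes> b) \<odot>\<^bsub>V\<^esub> x = a \<odot>\<^bsub>V\<^esub> (b \<odot>\<^bsub>V\<^esub> x)"
      using a x' D by (simp add: smult)
  next
    fix a x y assume a: "a \<in> carrier R" and xy: "x \<in> carrier V" "y \<in> carrier V"
    obtain x' y' where *: "x' \<in> K" "x = phi x'" "y' \<in> K" "y = phi y'" using V xy by metis
    have "phi (a \<odot>\<^bsub>M\<^esub> (x' \<oplus>\<^bsub>M\<^esub> y')) = phi (a \<odot>\<^bsub>M\<^esub> x' \<oplus>\<^bsub>M\<^esub> a \<odot>\<^bsub>M\<^esub> y')"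
      using a * D(1) by (simp add: smult_r_distr)
    then show "a \<odot>\<^bsub>V\<^esub> (x \<oplus>\<^bsub>V\<^esub> y) = a \<odot>\<^bsub>V\<^esub> x \<oplus>\<^bsub>V\<^esub> a \<odot>\<^bsub>V\<^esub> y"
      using a * D by (simp add: add smult)
  next
    fix x assume "x \<in> carrier V"
    then obtain x' where *: "x' \<in> K" "x = phi x'" using V by metis
    then show "\<one> \<odot>\<^bsub>V\<^esub> x = x" using smult[of \<one> x'] D(1) by simp
  qed
  interpret V: module R V by (rule modV)
  have pre: "submodule {x \<in> K. phi x \<in> J} R M" if "submodule J R V" for J
    using V.submoduleD[OF that] D unfolding submodule_iff by (auto simp: add smult zero)
  have im: "submodule (phi ` J) R V" if J: "submodule J R M" "J \<subseteq> K" for J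
  proof -
    have "\<zero>\<^bsub>V\<^esub> \<in> phi ` J" using zero submoduleD(2)[OF J(1)] by force
    moreover have "phi x \<oplus>\<^bsub>V\<^esub> phi y \<in> phi ` J" if "x \<in> J" "y \<in> J" for x y
      using that J add submoduleD(3)[OF J(1)] by (metis imageI subsetD)
    moreover have "a \<odot>\<^bsub>V\<^esub> phi x \<in> phi ` J" if "x \<in> J" "a \<in> carrier R" for x a
      using that J smult submoduleD(4)[OF J(1)] by (metis imageI subsetD)
    ultimately show ?thesis using J cl unfolding V.submodule_iff by auto
  qed
  have sep: "x \<in> J" if hyp: "submodule J R M" "{x \<in> K. phi x = \<zero>\<^bsub>V\<^esub>} \<subseteq> J" "J \<subseteq> K" "x \<in> K" "phi x \<in> phi ` J" for x J
  proof -
    obtain y where y: "y \<in> J" "phi x = phi y" using hyp by auto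
    then have yK: "y \<in> K" using hyp by auto
    have "phi (x \<ominus>\<^bsub>M\<^esub> y) = phi x \<oplus>\<^bsub>V\<^esub> phi (\<ominus>\<^bsub>M\<^esub> y)"
      using hyp yK D by (simp add: a_minus_def add)
    also have "\<dots> = \<zero>\<^bsub>V\<^esub>" using neg[OF yK] y cl yK D(5) by (metis V.M.a_comm)
    finally have "x \<oplus>\<^bsub>M\<^esub> \<ominus>\<^bsub>M\<^esub> y \<in> J" using hyp yK D by (auto simp: a_minus_def)
    then show ?thesis using submodule_cancel[OF hyp(1), of x "\<ominus>\<^bsub>M\<^esub> y"] y D(1) hyp(4) submoduleD(5)[OF hyp(1)] by blast
  qed
  show ?thesis
    unfolding module_length_eq relative_length_def
  proof (rule antisym)
    show "chain_length {N. submodule N R V}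
        \<le> chain_length {N. submodule N R M \<and> {x \<in> K. phi x = \<zero>\<^bsub>V\<^esub>} \<subseteq> N \<and> N \<subseteq> K}"
    proof (rule chain_length_mono[where f = "\<lambda>J. {x \<in> K. phi x \<in> J}"], goal_cases)
      case (1 P)
      then show ?case using pre V.submoduleD(2) by auto
    next
      case (2 P Q)
      then obtain y where "y \<in> Q" "y \<notin> P" by blast
      moreover then have "y \<in> carrier V" using 2 V.submoduleD(1) by blast
      ultimately show ?case using 2 V by blast
    qed
    show "chain_length {N. submodule N R M \<and> {x \<in> K. phi x = \<zero>\<^bsub>V\<^esub>} \<subseteq> N \<and> N \<subseteq> K}
        \<le> chain_length {N. submodule N R V}"
    proof (rule chain_length_mono[where f = "\<lambda>J. phi ` J"], goal_cases)
      case (1 P)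
      then show ?case using im by auto
    next
      case (2 P Q)
      then obtain y where y: "y \<in> Q" "y \<notin> P" by blast
      then have "phi y \<notin> phi ` P" using sep[of P y] 2 by blast
      then show ?case using y 2 by blast
    qed
  qed
qed

end

section \<open>Artinian rings have finite length\<close>

lemma artinian_minimal_ideal:
  assumes dcc: "\<And>I. \<lbrakk>\<And>i::nat. ideal (I i) A; \<And>i. I (Suc i) \<subseteq> I i\<rbrakk> \<Longrightarrow> \<exists>j. \<forall>i\<ge>j. I i = I j"
    and "ideal J A" "P J"
  obtains I where "ideal I A" "P I" "\<And>J. \<lbrakk>ideal J A; J \<subset> I\<rbrakk> \<Longrightarrow> \<not> P J"
proof -
  let ?r = "{(I, J). ideal I A \<and> ideal J A \<and> I \<subset> J}"
  have "wf ?r"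
    unfolding wf_iff_no_infinite_down_chain
  proof
    assume "\<exists>f. \<forall>i. (f (Suc i), f i) \<in> ?r"
    then obtain f where "\<forall>i. (f (Suc i), f i) \<in> ?r" by (rule exE)
    then have f: "ideal (f i) A" "f (Suc i) \<subset> f i" for i by blast+
    then obtain j where "\<forall>i\<ge>j. f i = f j" using dcc[of f] by blast
    then show False using f(2)[of j] by (metis le_SucI order_refl psubset_eq)
  qed
  moreover have "J \<in> {J. ideal J A \<and> P J}" using assms by simp
  ultimately obtain I where "I \<in> {J. ideal J A \<and> P J}" "\<And>K. (K, I) \<in> ?r \<Longrightarrow> K \<notin> {J. ideal J A \<and> P J}"
    by (rule wfE_min) blast
  then show thesis using that by blast
qed

context cring
begin

lemma ideal_iff: "ideal I R \<longleftrightarrow> I \<subseteq> carrier R \<and> \<zero> \<in> I \<and> (\<forall>x\<in>I. \<forall>y\<in>I. x \<oplus> y \<in> I) \<and>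
    (\<forall>a\<in>carrier R. \<forall>x\<in>I. a \<otimes> x \<in> I)" (is "_ \<longleftrightarrow> ?r")
proof
  assume "ideal I R"
  then interpret ideal I R .
  show ?r using a_subset I_l_closed zero_closed a_closed by auto
next
  assume r: ?r
  have neg: "\<ominus> x \<in> I" if "x \<in> I" for x
  proof -
    have "(\<ominus> \<one>) \<otimes> x = \<ominus> x" using r that by (metis l_minus l_one one_closed subsetD)
    then show ?thesis using r that by (metis add.inv_closed one_closed)
  qed
  have "subgroup I (add_monoid R)"
    by (rule add.subgroupI) (use r neg in auto)
  then show "ideal I R"
  proof (rule idealI[OF ring_axioms])
    fix a x assume a: "a \<in> I" and x: "x \<in> carrier R"
    show "x \<otimes> a \<in> I" using r a x by blast
    moreover have "a \<in> carrier R" using r a by blast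
    ultimately show "a \<otimes> x \<in> I" using m_comm x by simp
  qed
qed

text \<open>In an ideal \<open>I\<close> of infinite length, minimal with that property, multiplication by \<open>a\<close> has kernel
  or image of infinite length, so it is zero or onto.  The chain of the ideals \<open>(a\<^sup>n)\<close> turns the second case
  into invertibility on \<open>I\<close>, so \<open>I\<close> behaves like a vector space.  A hyperplane of \<open>I\<close> (from Zorn's lemma)
  has finite length by minimality, and so then has \<open>I\<close>.\<close>

lemma artinian_finite_length:
  assumes dcc: "\<And>I. \<lbrakk>\<And>i::nat. ideal (I i) R; \<And>i. I (Suc i) \<subseteq> I i\<rbrakk> \<Longrightarrow> \<exists>j. \<forall>i\<ge>j. I i = I j"
  shows "chain_length {I. ideal I R} \<noteq> \<infinity>"
proof
  assume inf: "chain_length {I. ideal I R} = \<infinity>"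
  define len where "len I = chain_length {J. ideal J R \<and> J \<subseteq> I}" for I
  have "{J. ideal J R \<and> J \<subseteq> carrier R} = {J. ideal J R}" by (auto simp: ideal_iff)
  then have "len (carrier R) = \<infinity>" using inf by (simp add: len_def)
  then obtain I where I: "ideal I R" "len I = \<infinity>" and min: "\<And>J. \<lbrakk>ideal J R; J \<subset> I\<rbrakk> \<Longrightarrow> len J \<noteq> \<infinity>"
    using artinian_minimal_ideal[OF dcc oneideal, of "\<lambda>I. len I = \<infinity>"] by blast
  have ID: "I \<subseteq> carrier R" "\<zero> \<in> I" "\<And>x y. \<lbrakk>x \<in> I; y \<in> I\<rbrakk> \<Longrightarrow> x \<oplus> y \<in> I"
    "\<And>a x. \<lbrakk>a \<in> carrier R; x \<in> I\<rbrakk> \<Longrightarrow> a \<otimes> x \<in> I"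
    using I(1) unfolding ideal_iff by auto
  have cancel: "x \<in> J" if "ideal J R" "x \<in> carrier R" "y \<in> J" "x \<oplus> y \<in> J" for x y J
  proof -
    interpret ideal J R by (rule that(1))
    have y: "y \<in> carrier R" using that(3) a_subset by auto
    have "(x \<oplus> y) \<oplus> \<ominus> y = x" using that(2) y by (simp add: a_assoc r_neg)
    then show ?thesis using a_closed that(3,4) a_inv_closed by metis
  qed
  have zero_or_onto: "(\<forall>x\<in>I. a \<otimes> x = \<zero>) \<or> (\<lambda>x. a \<otimes> x) ` I = I" if a: "a \<in> carrier R" for a
  proof (rule ccontr)
    assume contra: "\<not> ?thesis"
    let ?K = "{x \<in> I. a \<otimes> x = \<zero>}"
    have im: "ideal ((\<lambda>x. a \<otimes> x) ` J) R" if "ideal J R" for J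
      unfolding ideal_iff
    proof (intro conjI ballI)
      have J: "J \<subseteq> carrier R" "\<zero> \<in> J" "\<And>x y. \<lbrakk>x \<in> J; y \<in> J\<rbrakk> \<Longrightarrow> x \<oplus> y \<in> J"
        "\<And>a x. \<lbrakk>a \<in> carrier R; x \<in> J\<rbrakk> \<Longrightarrow> a \<otimes> x \<in> J"
        using that unfolding ideal_iff by auto
      show "(\<otimes>) a ` J \<subseteq> carrier R" using J a by auto
      show "\<zero> \<in> (\<otimes>) a ` J" using J a by (metis imageI r_null)
      show "x \<oplus> y \<in> (\<otimes>) a ` J" if "x \<in> (\<otimes>) a ` J" "y \<in> (\<otimes>) a ` J" for x y
        using that J a by (auto simp: r_distr[symmetric] subset_iff)
      show "b \<otimes> x \<in> (\<otimes>) a ` J" if "b \<in> carrier R" "x \<in> (\<otimes>) a ` J" for b x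
        using that J a by (auto simp: m_lcomm subset_iff)
    qed
    have ker: "ideal ?K R"
      unfolding ideal_iff using ID a by (auto simp: r_distr subset_iff m_lcomm)
    have "?K \<subset> I" using contra by auto
    then have 1: "len ?K \<noteq> \<infinity>" using min ker by blast
    have "(\<lambda>x. a \<otimes> x) ` I \<subset> I" using contra ID(4)[OF a] by auto
    then have 2: "len ((\<lambda>x. a \<otimes> x) ` I) \<noteq> \<infinity>" using min im I by blast
    have "len I \<le> len ?K + len ((\<lambda>x. a \<otimes> x) ` I)"
      unfolding len_def
    proof (rule chain_length_subadditive[where f = "\<lambda>J. J \<inter> ?K" and g = "\<lambda>J. (\<lambda>x. a \<otimes> x) ` J"], goal_cases)
      case (1 J)
      then show ?case using i_intersect ker by blast
    next
      case (3 J)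
      then show ?case using im by auto
    next
      case (5 J J')
      have "J' \<subseteq> J"
      proof
        fix x assume x: "x \<in> J'"
        then have "a \<otimes> x \<in> (\<lambda>x. a \<otimes> x) ` J" using 5(5) by blast
        then obtain y where y: "y \<in> J" "a \<otimes> x = a \<otimes> y" by auto
        interpret J: ideal J R using 5 by auto
        interpret J': ideal J' R using 5 by auto
        have xy: "x \<in> carrier R" "y \<in> carrier R" "y \<in> J'" "x \<in> I"
          using 5 x y J.a_subset J'.a_subset by auto
        have z: "\<ominus> y \<in> J" "\<ominus> y \<in> J'" using y xy by (auto simp: J.a_inv_closed J'.a_inv_closed)
        have "a \<otimes> (x \<oplus> \<ominus> y) = \<zero>" using a xy y(2) by (simp add: r_distr r_minus r_neg)
        moreover have "x \<oplus> \<ominus> y \<in> J'" using z x by (simp add: J'.a_closed)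
        ultimately have "x \<oplus> \<ominus> y \<in> J' \<inter> ?K" using 5 by auto
        then have "x \<oplus> \<ominus> y \<in> J" using 5 by auto
        then show "x \<in> J" using cancel[of J x "\<ominus> y"] z xy 5 by auto
      qed
      then show ?case using 5 by auto
    qed auto
    then show False using 1 2 I(2) by auto
  qed
  have zero_or_inv: "(\<forall>x\<in>I. a \<otimes> x = \<zero>) \<or> (\<exists>b\<in>carrier R. \<forall>x\<in>I. b \<otimes> (a \<otimes> x) = x)"
    if a: "a \<in> carrier R" for a
  proof (cases "\<forall>x\<in>I. a \<otimes> x = \<zero>")
    case False
    then have onto: "(\<lambda>x. a \<otimes> x) ` I = I" using zero_or_onto a by blast
    have onto_pow: "\<exists>z\<in>I. x = a [^] n \<otimes> z" if "x \<in> I" for x and n :: nat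
      using that
    proof (induction n arbitrary: x)
      case 0
      then show ?case using ID(1) by (auto intro!: bexI[of _ x])
    next
      case (Suc n)
      then obtain z where z: "z \<in> I" "x = a [^] n \<otimes> z" by blast
      then obtain z' where z': "z' \<in> I" "z = a \<otimes> z'" using onto by blast
      then have "x = a [^] Suc n \<otimes> z'" using z a ID(1) by (auto simp: m_assoc subset_iff)
      then show ?case using z' by blast
    qed
    have "\<exists>j. \<forall>i\<ge>j. PIdl (a [^] (i::nat)) = PIdl (a [^] j)"
    proof (rule dcc)
      show "ideal (PIdl (a [^] i)) R" for i :: nat using a cgenideal_ideal by simp
      fix i :: nat
      have "a [^] Suc i \<in> PIdl (a [^] i)" using a by (auto simp: cgenideal_def m_comm)
      then show "PIdl (a [^] Suc i) \<subseteq> PIdl (a [^] i)"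
        using a cgenideal_ideal cgenideal_minimal by simp
    qed
    then obtain j :: nat where "PIdl (a [^] Suc j) = PIdl (a [^] j)" by (metis le_SucI order_refl)
    \<comment> \<open>a relation \<open>a\<^sup>j = b a\<^sup>j\<^sup>+\<^sup>1\<close> makes \<open>b\<close> inverse to \<open>a\<close> on \<open>a\<^sup>j I = I\<close>\<close>
    then have "a [^] j \<in> PIdl (a [^] Suc j)" using a cgenideal_self by simp
    then obtain b where b: "b \<in> carrier R" "a [^] j = b \<otimes> a [^] Suc j"
      by (auto simp: cgenideal_def)
    have "b \<otimes> (a \<otimes> x) = x" if x: "x \<in> I" for x
    proof -
      obtain z where z: "z \<in> I" "x = a [^] j \<otimes> z" using onto_pow[OF x] by blast
      have zc: "z \<in> carrier R" using z ID by auto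
      have "b \<otimes> (a \<otimes> x) = (b \<otimes> a [^] Suc j) \<otimes> z"
      proof -
        have "a \<otimes> x = (a [^] j \<otimes> a) \<otimes> z" unfolding z(2) using a zc
          by (metis m_assoc m_comm nat_pow_closed)
        then show ?thesis using a b(1) zc by (simp add: m_assoc)
      qed
      then show ?thesis unfolding b(2)[symmetric] using z(2) by simp
    qed
    then show ?thesis using b by blast
  qed auto
  have "I \<noteq> {\<zero>}"
  proof
    assume "I = {\<zero>}"
    then have "{J. ideal J R \<and> J \<subseteq> I} \<subseteq> {I}" by (auto simp: ideal_iff)
    then have "len I \<le> chain_length {I}" unfolding len_def by (rule chain_length_subset)
    also have "\<dots> \<le> 0"
    proof (rule chain_length_leI)
      fix r N assume N: "\<And>i. i \<le> r \<Longrightarrow> N i \<in> {I}" "\<And>i. i < r \<Longrightarrow> N i \<subset> N (Suc i)"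
      then have "r = 0" using N(1)[of 0] N(1)[of 1] N(2)[of 0] by (cases r) auto
      then show "enat r \<le> 0" by (simp add: zero_enat_def)
    qed
    finally show False using I(2) by simp
  qed
  then obtain v where v: "v \<in> I" "v \<noteq> \<zero>" using ID(2) by blast
  let ?F = "{W. ideal W R \<and> W \<subseteq> I \<and> v \<notin> W}"
  have "\<exists>W\<in>?F. \<forall>X\<in>?F. W \<subseteq> X \<longrightarrow> X = W"
  proof (rule subset_Zorn_nonempty)
    show "?F \<noteq> {}" using zeroideal ID(2) v by blast
    fix C assume C: "C \<noteq> {}" "subset.chain ?F C"
    have "ideal (\<Union>C) R"
      using chain_Union_is_ideal[of C] C by (auto simp: pred_on.chain_def)
    moreover have "\<And>X. X \<in> C \<Longrightarrow> X \<subseteq> I \<and> v \<notin> X" using C(2) unfolding pred_on.chain_def by blast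
    ultimately show "\<Union>C \<in> ?F" by blast
  qed
  then obtain W where WF: "W \<in> ?F" and WF': "\<forall>X\<in>?F. W \<subseteq> X \<longrightarrow> X = W" by (rule bexE)
  have W: "ideal W R" "W \<subseteq> I" "v \<notin> W" using WF by simp_all
  have maxW: "X = W" if "ideal X R" "X \<subseteq> I" "v \<notin> X" "W \<subseteq> X" for X
    using WF' that by simp
  have WD: "W \<subseteq> carrier R" "\<zero> \<in> W" "\<And>x y. \<lbrakk>x \<in> W; y \<in> W\<rbrakk> \<Longrightarrow> x \<oplus> y \<in> W"
    "\<And>a x. \<lbrakk>a \<in> carrier R; x \<in> W\<rbrakk> \<Longrightarrow> a \<otimes> x \<in> W"
    using W(1) unfolding ideal_iff by auto
  have span: "\<exists>w\<in>W. \<exists>a\<in>carrier R. x = w \<oplus> a \<otimes> v" if x: "x \<in> I" for x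
  proof (cases "x \<in> W")
    case True
    then have "x = x \<oplus> \<zero> \<otimes> v" using WD(1) v ID(1) by (auto simp: subset_iff)
    then show ?thesis using True zero_closed by blast
  next
    case False
    have xc: "x \<in> carrier R" "v \<in> carrier R" using x v ID by auto
    let ?X = "{w \<oplus> a \<otimes> x | w a. w \<in> W \<and> a \<in> carrier R}"
    have X: "ideal ?X R"
      unfolding ideal_iff
    proof (intro conjI ballI)
      show "?X \<subseteq> carrier R" using WD xc by auto
      have "\<zero> = \<zero> \<oplus> \<zero> \<otimes> x" using xc by simp
      then show "\<zero> \<in> ?X" using WD zero_closed by blast
    next
      fix y z assume "y \<in> ?X" "z \<in> ?X"
      then obtain w a w' a' where *: "w \<in> W" "a \<in> carrier R" "w' \<in> W" "a' \<in> carrier R"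
        "y = w \<oplus> a \<otimes> x" "z = w' \<oplus> a' \<otimes> x" by blast
      then have "y \<oplus> z = (w \<oplus> w') \<oplus> (a \<oplus> a') \<otimes> x"
        using xc WD(1) by (simp add: l_distr a_ac subset_iff)
      moreover have "w \<oplus> w' \<in> W" "a \<oplus> a' \<in> carrier R" using * WD by auto
      ultimately show "y \<oplus> z \<in> ?X" by blast
    next
      fix b y assume b: "b \<in> carrier R" "y \<in> ?X"
      then obtain w a where *: "w \<in> W" "a \<in> carrier R" "y = w \<oplus> a \<otimes> x" by blast
      then have "b \<otimes> y = b \<otimes> w \<oplus> (b \<otimes> a) \<otimes> x"
        using xc WD(1) b by (simp add: r_distr m_assoc subset_iff)
      moreover have "b \<otimes> w \<in> W" "b \<otimes> a \<in> carrier R" using * WD b by auto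
      ultimately show "b \<otimes> y \<in> ?X" by blast
    qed
    have WX: "W \<subseteq> ?X"
    proof
      fix w assume w: "w \<in> W"
      then have "w = w \<oplus> \<zero> \<otimes> x" using xc WD(1) by (auto simp: subset_iff)
      then show "w \<in> ?X" using w zero_closed by blast
    qed
    have "x = \<zero> \<oplus> \<one> \<otimes> x" using xc by simp
    then have "x \<in> ?X" using WD(2) one_closed by blast
    moreover have "?X \<subseteq> I" using W(2) ID x by blast
    ultimately have "v \<in> ?X" using maxW[OF X] WX False by blast
    then obtain w a where wa: "w \<in> W" "a \<in> carrier R" "v = w \<oplus> a \<otimes> x" by blast
    have wc: "w \<in> carrier R" using wa WD by auto
    have "a \<otimes> x \<noteq> \<zero>" using wa W(3) wc by auto
    then have "\<not> (\<forall>x\<in>I. a \<otimes> x = \<zero>)" using x by blast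
    then obtain b where b: "b \<in> carrier R" "\<forall>x\<in>I. b \<otimes> (a \<otimes> x) = x" using zero_or_inv wa by blast
    have "b \<otimes> v = b \<otimes> w \<oplus> x" using wa b x xc wc by (simp add: r_distr)
    then have "x = b \<otimes> v \<oplus> \<ominus> (b \<otimes> w)" using b xc wc by (simp add: a_comm[of "b \<otimes> w"] a_assoc r_neg)
    then have "x = (\<ominus> b) \<otimes> w \<oplus> b \<otimes> v" using b xc wc by (simp add: l_minus a_comm)
    then show ?thesis using WD(4) wa b by blast
  qed
  have lenW: "len W \<noteq> \<infinity>" using min W v by blast
  have "len I \<le> len W + chain_length {W, I}"
    unfolding len_def
  proof (rule chain_length_subadditive[where f = "\<lambda>J. J \<inter> W" and g = "\<lambda>J. if J \<subseteq> W then W else I"], goal_cases)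
    case (1 J)
    then show ?case using i_intersect W by blast
  next
    case (4 J J')
    then show ?case using W by auto
  next
    case (5 J J')
    have J: "ideal J R" "ideal J' R" "J' \<subseteq> I" "J \<subseteq> I" using 5 by auto
    show ?case
    proof (cases "J' \<subseteq> W")
      case True
      then show ?thesis using 5 by auto
    next
      case False
      then have "\<not> J \<subseteq> W" using 5(5) W v by (auto split: if_splits)
      then obtain x where x: "x \<in> J" "x \<notin> W" by blast
      have JD: "J \<subseteq> carrier R" "\<And>x y. \<lbrakk>x \<in> J; y \<in> J\<rbrakk> \<Longrightarrow> x \<oplus> y \<in> J"
        "\<And>a x. \<lbrakk>a \<in> carrier R; x \<in> J\<rbrakk> \<Longrightarrow> a \<otimes> x \<in> J"
        using J(1) unfolding ideal_iff by auto
      have J'D: "J' \<subseteq> carrier R" "\<And>x y. \<lbrakk>x \<in> J'; y \<in> J'\<rbrakk> \<Longrightarrow> x \<oplus> y \<in> J'"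
        "\<And>a x. \<lbrakk>a \<in> carrier R; x \<in> J'\<rbrakk> \<Longrightarrow> a \<otimes> x \<in> J'"
        using J(2) unfolding ideal_iff by auto
      have xI: "x \<in> I" using x J by auto
      obtain w a where wa: "w \<in> W" "a \<in> carrier R" "x = w \<oplus> a \<otimes> v" using span[OF xI] by blast
      have c: "w \<in> carrier R" "v \<in> carrier R" "x \<in> carrier R" using wa WD v ID xI by auto
      have "a \<otimes> v \<noteq> \<zero>" using wa x c by auto
      then have "\<not> (\<forall>x\<in>I. a \<otimes> x = \<zero>)" using v by blast
      then obtain b where b: "b \<in> carrier R" "\<forall>x\<in>I. b \<otimes> (a \<otimes> x) = x" using zero_or_inv wa by blast
      have "J' \<subseteq> J"
      proof
        fix y assume y: "y \<in> J'"
        then have "y \<in> I" using J by auto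
        then obtain w' a' where wa': "w' \<in> W" "a' \<in> carrier R" "y = w' \<oplus> a' \<otimes> v" using span by blast
        have c': "w' \<in> carrier R" "y \<in> carrier R" using wa' WD y J'D by auto
        \<comment> \<open>the multiple of \<open>x\<close> with the same component along \<open>v\<close> as \<open>y\<close>\<close>
        define z where "z = (a' \<otimes> b) \<otimes> x"
        have zJ: "z \<in> J" unfolding z_def using JD x wa' b by auto
        have zc: "z \<in> carrier R" using zJ JD by auto
        have bav: "b \<otimes> (a \<otimes> v) = v" using b v by blast
        have "z = (a' \<otimes> b) \<otimes> w \<oplus> a' \<otimes> (b \<otimes> (a \<otimes> v))"
          unfolding z_def wa(3) using wa(2) wa'(2) b(1) c by (simp add: r_distr m_assoc)
        then have z: "z = (a' \<otimes> b) \<otimes> w \<oplus> a' \<otimes> v" unfolding bav .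
        let ?d = "w' \<oplus> (\<ominus> (a' \<otimes> b)) \<otimes> w"
        have dW: "?d \<in> W" using wa' wa b WD by auto
        have dc: "?d \<in> carrier R" using dW WD by auto
        have wb: "a' \<otimes> b \<otimes> w \<in> carrier R" "a' \<otimes> v \<in> carrier R" using wa' b c by auto
        have yz: "?d \<oplus> z = y"
        proof -
          have "?d \<oplus> z = w' \<oplus> (\<ominus> (a' \<otimes> b \<otimes> w) \<oplus> (a' \<otimes> b \<otimes> w \<oplus> a' \<otimes> v))"
            unfolding z using wa'(2) b(1) c c' wb by (simp add: l_minus a_assoc)
          also have "\<dots> = y" using wb c' wa' by (simp add: a_assoc[symmetric] l_neg)
          finally show ?thesis .
        qed
        have "?d \<in> J'" using cancel[OF J(2) dc, of z] zJ 5(3) yz y by auto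
        then have "?d \<in> J" using dW 5(4) by blast
        then show "y \<in> J" using JD(2)[OF _ zJ] yz by metis
      qed
      then show ?thesis using 5(3) by auto
    qed
  qed auto
  moreover have "chain_length {W, I} \<le> 1"
  proof (rule chain_length_leI)
    fix r N assume N: "\<And>i. i \<le> r \<Longrightarrow> N i \<in> {W, I}" "\<And>i. i < r \<Longrightarrow> N i \<subset> N (Suc i)"
    have "r \<le> 1"
    proof (rule ccontr)
      assume "\<not> r \<le> 1"
      then show False using N(1)[of 0] N(1)[of 1] N(1)[of 2] N(2)[of 0] N(2)[of 1] W(2)
        by (auto simp: numeral_2_eq_2)
    qed
    then show "enat r \<le> 1" by (simp add: one_enat_def)
  qed
  ultimately have "len I \<le> len W + 1" by (meson add_left_mono order_trans)
  then show False using lenW I(2) by (cases "len W") (auto simp: one_enat_def)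
qed

end

section \<open>Numerical polynomials\<close>

definition binom_basis :: "('d::finite \<Rightarrow> nat) \<Rightarrow> ('d \<Rightarrow> nat) \<Rightarrow> int" where
  "binom_basis k n = (\<Prod>i\<in>UNIV. int ((n i + k i) choose k i))"

definition expansion :: "(('d::finite \<Rightarrow> nat) \<Rightarrow> int) \<Rightarrow> ('d \<Rightarrow> nat) \<Rightarrow> int" where
  "expansion e n = (\<Sum>k | e k \<noteq> 0. e k * binom_basis k n)"

definition has_expansion ::
    "(('d::finite \<Rightarrow> nat) \<Rightarrow> int) \<Rightarrow> (('d \<Rightarrow> nat) \<Rightarrow> int) \<Rightarrow> bool" where
  "has_expansion e H \<longleftrightarrow> finite {k. e k \<noteq> 0} \<and> for_large (\<lambda>n. H n = expansion e n)"

lemma for_large_mono: "\<lbrakk>for_large P; \<And>n. P n \<Longrightarrow> Q n\<rbrakk> \<Longrightarrow> for_large Q"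
  unfolding for_large_def by blast

lemma for_large_conj: "\<lbrakk>for_large P; for_large Q\<rbrakk> \<Longrightarrow> for_large (\<lambda>n. P n \<and> Q n)"
  unfolding for_large_def by (metis (no_types, lifting) le_trans max.cobounded1 max.cobounded2)

lemma for_large_ge: "for_large (\<lambda>n::'d::finite \<Rightarrow> nat. \<forall>i. c i \<le> n i)"
proof -
  have "c i \<le> Max (range c)" for i by (rule Max_ge) auto
  then show ?thesis unfolding for_large_def by (meson le_trans)
qed

lemma for_large_diff:
  assumes "for_large P"
  shows "for_large (\<lambda>n. P (n - c :: 'd::finite \<Rightarrow> nat))"
proof -
  obtain N where N: "\<And>n. (\<forall>i. N \<le> n i) \<Longrightarrow> P n" using assms unfolding for_large_def by blast
  have "for_large (\<lambda>n. \<forall>i. N + c i \<le> n i)" using for_large_ge[of "\<lambda>i. N + c i"] .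
  then show ?thesis
  proof (rule for_large_mono)
    fix n assume n: "\<forall>i. N + c i \<le> n i"
    have "N \<le> (n - c) i" for i using n[rule_format, of i] by simp
    then show "P (n - c)" using N by blast
  qed
qed

lemma unit_vec_simps [simp]: "unit_vec i i = 1" "j \<noteq> i \<Longrightarrow> unit_vec i j = 0"
  by (auto simp: unit_vec_def)

lemma expansion_superset:
  assumes "finite K" "{k. e k \<noteq> 0} \<subseteq> K"
  shows "expansion e n = (\<Sum>k\<in>K. e k * binom_basis k n)"
  unfolding expansion_def by (rule sum.mono_neutral_left) (use assms in auto)

lemma binom_basis_diff:
  fixes n k :: "'d::finite \<Rightarrow> nat"
  assumes "n i \<ge> 1"
  shows "binom_basis k n - binom_basis k (n - unit_vec i) =
    (if k i = 0 then 0 else binom_basis (k - unit_vec i) n)"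
proof -
  have split: "binom_basis k n = int ((n i + k i) choose k i) * (\<Prod>j\<in>UNIV - {i}. int ((n j + k j) choose k j))"
    for n k :: "'d \<Rightarrow> nat"
    unfolding binom_basis_def by (rule prod.remove) auto
  have r1: "(\<Prod>j\<in>UNIV - {i}. int (((n - unit_vec i) j + k j) choose k j)) = (\<Prod>j\<in>UNIV - {i}. int ((n j + k j) choose k j))"
    by (rule prod.cong) auto
  have r2: "(\<Prod>j\<in>UNIV - {i}. int ((n j + (k - unit_vec i) j) choose (k - unit_vec i) j)) = (\<Prod>j\<in>UNIV - {i}. int ((n j + k j) choose k j))"
    by (rule prod.cong) auto
  obtain m where m: "n i = Suc m" using assms by (cases "n i") auto
  have *: "int ((n i + k i) choose k i) - int (((n - unit_vec i) i + k i) choose k i) =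
    (if k i = 0 then 0 else int ((n i + (k - unit_vec i) i) choose (k - unit_vec i) i))"
    by (cases "k i") (simp_all add: m)
  show ?thesis
    unfolding split[of k n] split[of k "n - unit_vec i"] split[of "k - unit_vec i" n] r1 r2
    using * by (auto simp: left_diff_distrib[symmetric])
qed

lemma unit_vec_diff_add: "k i \<noteq> 0 \<Longrightarrow> (k - unit_vec i) + unit_vec i = (k :: 'd \<Rightarrow> nat)"
  by (rule ext) (auto simp: unit_vec_def)

text \<open>By Pascal's rule a backward difference in direction \<open>i\<close> turns the basis function of index \<open>k\<close> into that of
  index \<open>k - e\<^sub>i\<close>, so it shifts the coefficients.\<close>

lemma expansion_diff:
  fixes n :: "'d::finite \<Rightarrow> nat"
  assumes fin: "finite {k. e k \<noteq> 0}" and n: "n i \<ge> 1"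
  shows "expansion e n - expansion e (n - unit_vec i) = expansion (\<lambda>k. e (k + unit_vec i)) n"
proof -
  have "expansion e n - expansion e (n - unit_vec i) =
     (\<Sum>k | e k \<noteq> 0. e k * (binom_basis k n - binom_basis k (n - unit_vec i)))"
    by (simp add: expansion_def sum_subtractf right_diff_distrib)
  also have "\<dots> = (\<Sum>k | e k \<noteq> 0 \<and> k i \<noteq> 0. e k * binom_basis (k - unit_vec i) n)"
    by (rule sum.mono_neutral_cong_right) (use fin n in \<open>auto simp: binom_basis_diff\<close>)
  also have "\<dots> = (\<Sum>k | e (k + unit_vec i) \<noteq> 0. e (k + unit_vec i) * binom_basis k n)"
    by (rule sum.reindex_bij_witness[of _ "\<lambda>k. k + unit_vec i" "\<lambda>k. k - unit_vec i"])
      (auto simp: unit_vec_diff_add)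
  finally show ?thesis by (simp add: expansion_def)
qed

lemma finite_support_shift:
  assumes "finite {k. e k \<noteq> (0::int)}"
  shows "finite {k. e (k + c :: 'd \<Rightarrow> nat) \<noteq> 0}"
proof (rule finite_imageD[of "\<lambda>k. k + c"])
  show "finite ((\<lambda>k. k + c) ` {k. e (k + c) \<noteq> 0})" by (rule finite_subset[OF _ assms]) auto
  show "inj_on (\<lambda>k. k + c) {k. e (k + c) \<noteq> 0}" by (auto simp: inj_on_def fun_eq_iff)
qed

lemma has_expansion_diff:
  assumes "has_expansion e H"
  shows "has_expansion (\<lambda>k. e (k + unit_vec i)) (\<lambda>n. H n - H (n - unit_vec i))"
proof -
  have fin: "finite {k. e k \<noteq> 0}" and large: "for_large (\<lambda>n. H n = expansion e n)"
    using assms by (auto simp: has_expansion_def)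
  have "for_large (\<lambda>n. n i \<ge> 1)"
    using for_large_ge[of "\<lambda>_. 1"] by (rule for_large_mono) blast
  from for_large_conj[OF this for_large_conj[OF large for_large_diff[OF large, of "unit_vec i"]]]
  have "for_large (\<lambda>n. H n - H (n - unit_vec i) = expansion (\<lambda>k. e (k + unit_vec i)) n)"
    by (rule for_large_mono) (simp add: expansion_diff[OF fin, symmetric])
  then show ?thesis using finite_support_shift[OF fin] by (simp add: has_expansion_def)
qed

lemma has_expansion_cong:
  assumes "has_expansion e H" "for_large (\<lambda>n. H n = H' n)"
  shows "has_expansion e H'"
  using assms for_large_mono[OF for_large_conj[OF assms(2)], of "\<lambda>n. H n = expansion e n"]
  by (auto simp: has_expansion_def)

lemma has_expansion_lincomb:
  assumes "has_expansion e H" "has_expansion e' H'"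
  shows "has_expansion (\<lambda>k. p * e k + q * e' k) (\<lambda>n. p * H n + q * H' n)"
proof -
  let ?K = "{k. e k \<noteq> 0} \<union> {k. e' k \<noteq> 0}"
  have K: "finite ?K" using assms by (auto simp: has_expansion_def)
  have "expansion (\<lambda>k. p * e k + q * e' k) n = p * expansion e n + q * expansion e' n" for n
    by (subst (1 2 3) expansion_superset[OF K])
      (auto simp: sum_distrib_left sum.distrib[symmetric] algebra_simps)
  moreover have "finite {k. p * e k + q * e' k \<noteq> 0}" by (rule finite_subset[OF _ K]) auto
  moreover have "for_large (\<lambda>n. H n = expansion e n \<and> H' n = expansion e' n)"
    using assms by (intro for_large_conj) (auto simp: has_expansion_def)
  ultimately show ?thesis unfolding has_expansion_def by (auto elim: for_large_mono)
qed

lemma expansion_zero_unique_constant: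
  fixes e :: "('d::finite \<Rightarrow> nat) \<Rightarrow> int"
  assumes "has_expansion e (\<lambda>_. 0)" and "\<And>k. e k \<noteq> 0 \<Longrightarrow> k = (\<lambda>_. 0)"
  shows "e k = 0"
proof -
  have supp: "{k. e k \<noteq> 0} \<subseteq> {\<lambda>_. 0}" using assms(2) by auto
  have "expansion e n = e (\<lambda>_. 0)" for n
    by (subst expansion_superset[OF _ supp]) (auto simp: binom_basis_def)
  then have "for_large (\<lambda>n::'d \<Rightarrow> nat. e (\<lambda>_. 0) = 0)" using assms(1) by (simp add: has_expansion_def)
  then have "e (\<lambda>_. 0) = 0" by (auto simp: for_large_def)
  then show ?thesis using supp by (cases "k = (\<lambda>_. 0)") auto
qed

text \<open>The backward difference in each direction lowers the degree and vanishes as well, so by induction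
  on the degree all coefficients but the constant one vanish, and then that one does too.\<close>

lemma expansion_zero_unique_degree:
  fixes e :: "('d::finite \<Rightarrow> nat) \<Rightarrow> int"
  assumes "has_expansion e (\<lambda>_. 0)" and "\<And>k. e k \<noteq> 0 \<Longrightarrow> sum k UNIV \<le> D"
  shows "e k = 0"
  using assms
proof (induction D arbitrary: e k)
  case D: (0 e)
  then show ?case by (intro expansion_zero_unique_constant[OF D(1)]) (fastforce simp: fun_eq_iff)
next
  case (Suc D e)
  have shift: "e (k + unit_vec i) = 0" for k i
  proof (rule Suc.IH[of "\<lambda>k. e (k + unit_vec i)"])
    show "has_expansion (\<lambda>k. e (k + unit_vec i)) (\<lambda>_. 0)"
      using has_expansion_diff[OF Suc(2), of i] by (simp only: diff_self)
    fix k assume "e (k + unit_vec i) \<noteq> 0"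
    then have "sum (k + unit_vec i) UNIV \<le> Suc D" by (rule Suc(3))
    moreover have "sum (unit_vec i) UNIV = 1" unfolding unit_vec_def by simp
    ultimately show "sum k UNIV \<le> D" by (simp add: sum.distrib)
  qed
  then have "k = (\<lambda>_. 0)" if "e k \<noteq> 0" for k
    using that unit_vec_diff_add by (metis ext)
  then show ?case by (rule expansion_zero_unique_constant[OF Suc(2)])
qed

lemma has_expansion_unique:
  assumes "has_expansion e H" "has_expansion e' H"
  shows "e = e'"
proof -
  have 0: "has_expansion (\<lambda>k. 1 * e k + (-1) * e' k) (\<lambda>_. 0)"
    using has_expansion_lincomb[OF assms, of 1 "-1"] by simp
  then have fin: "finite {k. 1 * e k + (-1) * e' k \<noteq> 0}" by (simp add: has_expansion_def)
  have "1 * e k + (-1) * e' k = 0" for k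
    by (rule expansion_zero_unique_degree[OF 0, of "Max ((\<lambda>k. sum k UNIV) ` {k. 1 * e k + (-1) * e' k \<noteq> 0})"])
      (rule Max_ge, use fin in auto)
  then show ?thesis by (auto simp: fun_eq_iff)
qed

definition expandable :: "(('d::finite \<Rightarrow> nat) \<Rightarrow> int) \<Rightarrow> bool" where
  "expandable H \<longleftrightarrow> (\<exists>e. has_expansion e H)"

lemma expandable_lincomb:
  "\<lbrakk>expandable H; expandable H'\<rbrakk> \<Longrightarrow> expandable (\<lambda>n. p * H n + q * H' n)"
  unfolding expandable_def using has_expansion_lincomb by blast

lemma expandable_add: "\<lbrakk>expandable H; expandable H'\<rbrakk> \<Longrightarrow> expandable (\<lambda>n. H n + H' n)"
  using expandable_lincomb[of H H' 1 1] by simp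

lemma expandable_cong: "\<lbrakk>expandable H; for_large (\<lambda>n. H n = H' n)\<rbrakk> \<Longrightarrow> expandable H'"
  unfolding expandable_def using has_expansion_cong by blast

lemma expandable_zero: "expandable (\<lambda>_. 0)"
  unfolding expandable_def has_expansion_def
  by (rule exI[of _ "\<lambda>_. 0"]) (auto simp: expansion_def for_large_def)

lemma expandable_binom_basis: "expandable (binom_basis a)"
proof -
  let ?e = "\<lambda>k. if k = a then 1 else 0 :: int"
  have supp: "{k. ?e k \<noteq> 0} \<subseteq> {a}" by auto
  have "expansion ?e n = binom_basis a n" for n
    by (subst expansion_superset[OF _ supp]) auto
  then have "has_expansion ?e (binom_basis a)"
    by (auto simp: has_expansion_def for_large_def)
  then show ?thesis by (auto simp: expandable_def)
qed

text \<open>One step is \<open>H(n - e\<^sub>i) = H(n) - (H(n) - H(n - e\<^sub>i))\<close>, where both terms on the right have expansions.\<close>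

lemma expandable_diff:
  assumes "expandable H"
  shows "expandable (\<lambda>n. H (n - c))"
  using assms
proof (induction "sum c UNIV" arbitrary: c H)
  case 0
  then have "c = (\<lambda>_. 0)" by (auto simp: fun_eq_iff)
  then have "n - c = n" for n by (auto simp: fun_eq_iff)
  then show ?case using 0 by simp
next
  case (Suc s)
  then have "\<exists>i. c i \<noteq> 0" by (metis sum.neutral nat.distinct(1))
  then obtain i where i: "c i \<noteq> 0" by blast
  define c' where "c' = c - unit_vec i"
  have c: "c = c' + unit_vec i" using unit_vec_diff_add i c'_def by metis
  have "sum (unit_vec i) UNIV = 1" unfolding unit_vec_def by simp
  then have s: "s = sum c' UNIV" using Suc(2) c by (simp add: sum.distrib)
  obtain e where e: "has_expansion e H" using Suc.prems expandable_def by blast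
  have "expandable (\<lambda>n. 1 * H n + (-1) * (H n - H (n - unit_vec i)))"
    using e has_expansion_diff expandable_def by (intro expandable_lincomb) blast+
  then have "expandable (\<lambda>n. H (n - unit_vec i))" by simp
  then have "expandable (\<lambda>n. H (n - c' - unit_vec i))" using Suc.hyps(1)[OF s] by fastforce
  moreover have "n - c' - unit_vec i = n - c" for n by (auto simp: c fun_eq_iff)
  ultimately show ?case by simp
qed


section \<open>Counting monomials\<close>

text \<open>\<open>power_coeff c a m\<close> is the coefficient of \<open>t\<^sup>m\<close> in \<open>t\<^sup>c / (1 - t)\<^sup>a\<close>.\<close>

definition power_coeff :: "nat \<Rightarrow> nat \<Rightarrow> nat \<Rightarrow> int" where
  "power_coeff c a m =
    (if a = 0 then (if m = c then 1 else 0)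
     else if m < c then 0 else int ((m - c + (a - 1)) choose (a - 1)))"

lemma power_coeff_sum: "(\<Sum>s\<le>m. power_coeff c a s) = power_coeff c (Suc a) m"
proof (induction m)
  case 0
  then show ?case by (cases a) (auto simp: power_coeff_def)
next
  case (Suc m)
  have "power_coeff c (Suc a) m + power_coeff c a (Suc m) = power_coeff c (Suc a) (Suc m)"
  proof (cases a)
    case 0
    then show ?thesis by (auto simp: power_coeff_def)
  next
    case (Suc b)
    consider "Suc m < c" | "Suc m = c" | "c \<le> m" by linarith
    then show ?thesis
      by cases (auto simp: power_coeff_def Suc Suc_diff_le)
  qed
  then show ?case using Suc by simp
qed

lemma power_coeff_shift:
  "power_coeff (c + t) a m = (if m < t then 0 else power_coeff c a (m - t))"
  by (auto simp: power_coeff_def add.commute)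

text \<open>The coefficient of \<open>t\<^sup>n\<close> in \<open>\<Prod>\<^sub>i t\<^sub>i\<^sup>c / (1 - t\<^sub>i)\<^sup>a\<close>, with \<open>c\<close> and \<open>a\<close> depending on \<open>i\<close>. A vanishing exponent
  \<open>a\<^sub>i\<close> confines the support to \<open>n\<^sub>i = c\<^sub>i\<close>, so that the function is eventually zero.\<close>

definition box_coeff :: "('d::finite \<Rightarrow> nat) \<Rightarrow> ('d \<Rightarrow> nat) \<Rightarrow> ('d \<Rightarrow> nat) \<Rightarrow> int" where
  "box_coeff c a n = (\<Prod>i\<in>UNIV. power_coeff (c i) (a i) (n i))"

lemma expandable_box_coeff: "expandable (box_coeff c a)"
proof (cases "\<exists>i. a i = 0")
  case True
  then obtain i where i: "a i = 0" by blast
  have "for_large (\<lambda>n. 0 = box_coeff c a n)"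
    using for_large_ge[of "\<lambda>i. Suc (c i)"]
  proof (rule for_large_mono)
    fix n assume "\<forall>i. Suc (c i) \<le> n i"
    then have "Suc (c i) \<le> n i" by blast
    then have "power_coeff (c i) (a i) (n i) = 0" using i by (auto simp: power_coeff_def)
    then have "\<exists>i\<in>UNIV. power_coeff (c i) (a i) (n i) = 0" by blast
    then show "0 = box_coeff c a n" unfolding box_coeff_def by (intro prod_zero[symmetric] finite)
  qed
  then show ?thesis using expandable_cong[OF expandable_zero] by blast
next
  case False
  have "for_large (\<lambda>n. binom_basis (a - (\<lambda>_. 1)) (n - c) = box_coeff c a n)"
    using for_large_ge[of c]
    by (rule for_large_mono)
      (use False in \<open>auto simp: box_coeff_def binom_basis_def power_coeff_def leD intro!: prod.cong\<close>)
  then show ?thesis using expandable_cong[OF expandable_diff[OF expandable_binom_basis]] by blast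
qed

text \<open>Functions whose generating series is a rational function with denominator
  \<open>\<Prod>\<^sub>i (1 - t\<^sub>i)\<^sup>a\<close>; unlike being eventually polynomial this is stable under partial summation, which
  looks at all values.\<close>

inductive rational_series :: "(('d::finite \<Rightarrow> nat) \<Rightarrow> int) \<Rightarrow> bool" where
  box: "rational_series (box_coeff c a)"
| add: "\<lbrakk>rational_series H; rational_series H'\<rbrakk> \<Longrightarrow> rational_series (\<lambda>n. H n + H' n)"
| scale: "rational_series H \<Longrightarrow> rational_series (\<lambda>n. q * H n)"

lemma rational_series_expandable: "rational_series H \<Longrightarrow> expandable H"
proof (induction rule: rational_series.induct)
  case (scale H q)
  then show ?case using expandable_lincomb[of H H q 0] by simp
qed (auto intro: expandable_box_coeff expandable_add)

lemma box_coeff_upd: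
  "box_coeff c a (n(i := s)) = power_coeff (c i) (a i) s * (\<Prod>j\<in>UNIV - {i}. power_coeff (c j) (a j) (n j))"
  unfolding box_coeff_def by (subst prod.remove[of UNIV i]) (auto intro!: prod.cong)

lemma box_coeff_split:
  "box_coeff c a n = power_coeff (c i) (a i) (n i) * (\<Prod>j\<in>UNIV - {i}. power_coeff (c j) (a j) (n j))"
  unfolding box_coeff_def by (rule prod.remove) auto

lemma rational_series_partial_sum:
  "rational_series H \<Longrightarrow> rational_series (\<lambda>n. \<Sum>s\<le>n i. H (n(i := s)))"
proof (induction rule: rational_series.induct)
  case (box c a)
  have "(\<lambda>n. \<Sum>s\<le>n i. box_coeff c a (n(i := s))) = box_coeff c (a(i := Suc (a i)))"
  proof
    fix n
    show "(\<Sum>s\<le>n i. box_coeff c a (n(i := s))) = box_coeff c (a(i := Suc (a i))) n"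
      unfolding box_coeff_upd box_coeff_split[of _ _ n i] sum_distrib_right[symmetric] power_coeff_sum
      by (auto intro!: prod.cong)
  qed
  then show ?case by (simp only: rational_series.box)
next
  case (add H H')
  then show ?case using rational_series.add by (simp add: sum.distrib)
next
  case (scale H q)
  then show ?case using rational_series.scale by (simp add: sum_distrib_left[symmetric])
qed

lemma rational_series_shift:
  "rational_series H \<Longrightarrow> rational_series (\<lambda>n. if n i < t then 0 else H (n(i := n i - t)))"
proof (induction rule: rational_series.induct)
  case (box c a)
  have "(\<lambda>n. if n i < t then 0 else box_coeff c a (n(i := n i - t))) = box_coeff (c(i := c i + t)) a"
  proof
    fix n
    show "(if n i < t then 0 else box_coeff c a (n(i := n i - t))) = box_coeff (c(i := c i + t)) a n"
      unfolding box_coeff_upd box_coeff_split[of _ _ n i]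
      by (auto simp: power_coeff_shift intro!: prod.cong)
  qed
  then show ?case by (simp only: rational_series.box)
next
  case (add H H')
  have eq: "(\<lambda>n. if n i < t then 0 else H (n(i := n i - t)) + H' (n(i := n i - t))) =
    (\<lambda>n. (if n i < t then 0 else H (n(i := n i - t))) + (if n i < t then 0 else H' (n(i := n i - t))))"
    by auto
  show ?case unfolding eq using add by (intro rational_series.add)
next
  case (scale H q)
  have eq: "(\<lambda>n. if n i < t then 0 else q * H (n(i := n i - t))) =
    (\<lambda>n. q * (if n i < t then 0 else H (n(i := n i - t))))" by auto
  show ?case unfolding eq using scale by (intro rational_series.scale)
qed

lemma rational_series_sum:
  "finite A \<Longrightarrow> (\<And>x. x \<in> A \<Longrightarrow> rational_series (H x)) \<Longrightarrow> rational_series (\<lambda>n. \<Sum>x\<in>A. H x n)"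
proof (induction A rule: finite_induct)
  case empty
  show ?case using rational_series.scale[OF rational_series.box, of 0] by simp
next
  case (insert x A)
  then show ?case by (simp add: rational_series.add)
qed

text \<open>A variable of degree \<open>unit_vec d\<close> is represented by the index \<open>d\<close>, a monomial by the list of its exponents.\<close>

fun exponent_degree :: "'d list \<Rightarrow> nat list \<Rightarrow> 'd \<Rightarrow> nat" where
  "exponent_degree (d # ds) (t # u) = (\<lambda>i. (if i = d then t else 0) + exponent_degree ds u i)"
| "exponent_degree _ _ = (\<lambda>_. 0)"

definition exponents :: "'d list \<Rightarrow> ('d \<Rightarrow> nat) \<Rightarrow> nat list set" where
  "exponents ds n = {u. length u = length ds \<and> exponent_degree ds u = n}"

lemma exponents_Nil: "exponents [] n = (if n = (\<lambda>_. 0) then {[]} else {})"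
  by (auto simp: exponents_def)

lemma exponents_Cons:
  "exponents (d # ds) n = (\<Union>t\<le>n d. (#) t ` exponents ds (n(d := n d - t)))"
proof (intro equalityI subsetI)
  fix u assume "u \<in> exponents (d # ds) n"
  then obtain t v where u: "u = t # v" "length v = length ds" "exponent_degree (d # ds) (t # v) = n"
    by (auto simp: exponents_def length_Suc_conv)
  then have "n = (\<lambda>i. (if i = d then t else 0) + exponent_degree ds v i)" by simp
  then have "t \<le> n d" "exponent_degree ds v = n(d := n d - t)" by (auto simp: fun_eq_iff)
  then show "u \<in> (\<Union>t\<le>n d. (#) t ` exponents ds (n(d := n d - t)))"
    using u by (auto simp: exponents_def)
qed (auto simp: exponents_def fun_eq_iff)

lemma finite_exponents: "finite (exponents ds n)"
  by (induction ds arbitrary: n) (auto simp: exponents_Nil exponents_Cons)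

lemma sum_exponents_Cons:
  "(\<Sum>u\<in>exponents (d # ds) n. f u) =
    (\<Sum>t\<le>n d. \<Sum>u\<in>exponents ds (n(d := n d - t)). f (t # u))"
  unfolding exponents_Cons
  by (subst sum.UNION_disjoint) (auto simp: finite_exponents sum.reindex)

text \<open>Beyond \<open>N\<close> the exponent of the first variable does not influence \<open>f\<close>. So summing over that exponent gives \<open>N\<close>
  shifts of sums over the other variables, and a shifted partial sum of one more such sum.\<close>

lemma rational_series_sum_exponents:
  fixes f :: "nat list \<Rightarrow> int"
  assumes "\<And>u. length u = length ds \<Longrightarrow> f u = f (map (min N) u)"
  shows "rational_series (\<lambda>n :: 'd::finite \<Rightarrow> nat. \<Sum>u\<in>exponents ds n. f u)"
  using assms
proof (induction ds arbitrary: f)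
  case Nil
  have "(\<lambda>n :: 'd \<Rightarrow> nat. \<Sum>u\<in>exponents [] n. f u) = (\<lambda>n. f [] * box_coeff (\<lambda>_. 0) (\<lambda>_. 0) n)"
  proof
    fix n :: "'d \<Rightarrow> nat"
    show "(\<Sum>u\<in>exponents [] n. f u) = f [] * box_coeff (\<lambda>_. 0) (\<lambda>_. 0) n"
      by (auto simp: exponents_Nil box_coeff_def power_coeff_def fun_eq_iff)
  qed
  then show ?case using rational_series.box rational_series.scale by metis
next
  case (Cons d ds)
  let ?G = "\<lambda>t (n :: 'd \<Rightarrow> nat). \<Sum>u\<in>exponents ds n. f (t # u)"
  have trunc: "f (t # u) = f (min N t # map (min N) u)" if "length u = length ds" for t u
    using Cons.prems[of "t # u"] that by simp
  have G: "rational_series (?G t)" for t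
  proof (rule Cons.IH)
    fix u :: "nat list" assume u: "length u = length ds"
    then show "f (t # u) = f (t # map (min N) u)"
      using trunc[OF u] trunc[of "map (min N) u" t] by (simp add: o_def)
  qed
  have GN: "?G t n = ?G N n" if "t \<ge> N" for t n
  proof (rule sum.cong)
    fix u assume "u \<in> exponents ds n"
    then have u: "length u = length ds" by (simp add: exponents_def)
    show "f (t # u) = f (N # u)"
      unfolding trunc[OF u, of t] trunc[OF u, of N] using that by (simp only: min_absorb1 min.idem)
  qed simp
  have eq: "(\<Sum>u\<in>exponents (d # ds) n. f u) =
    (\<Sum>t<N. if n d < t then 0 else ?G t (n(d := n d - t))) +
    (if n d < N then 0 else \<Sum>s\<le>(n(d := n d - N)) d. ?G N ((n(d := n d - N))(d := s)))" for n
  proof -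
    have "(\<Sum>u\<in>exponents (d # ds) n. f u) = (\<Sum>t\<le>n d. ?G t (n(d := n d - t)))"
      by (rule sum_exponents_Cons)
    also have "{..n d} = {t. t < N \<and> t \<le> n d} \<union> {t. N \<le> t \<and> t \<le> n d}" by auto
    also have "(\<Sum>t\<in>\<dots>. ?G t (n(d := n d - t))) =
      (\<Sum>t | t < N \<and> t \<le> n d. ?G t (n(d := n d - t))) + (\<Sum>t | N \<le> t \<and> t \<le> n d. ?G t (n(d := n d - t)))"
      by (rule sum.union_disjoint) auto
    also have "(\<Sum>t | t < N \<and> t \<le> n d. ?G t (n(d := n d - t))) =
      (\<Sum>t<N. if n d < t then 0 else ?G t (n(d := n d - t)))"
      by (rule sum.mono_neutral_cong_left) auto
    also have "(\<Sum>t | N \<le> t \<and> t \<le> n d. ?G t (n(d := n d - t))) =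
      (if n d < N then 0 else \<Sum>s\<le>(n(d := n d - N)) d. ?G N ((n(d := n d - N))(d := s)))"
    proof (cases "n d < N")
      case True
      then have empty: "{t. N \<le> t \<and> t \<le> n d} = {}" by auto
      show ?thesis unfolding empty using True by simp
    next
      case False
      have "(\<Sum>t | N \<le> t \<and> t \<le> n d. ?G t (n(d := n d - t))) = (\<Sum>s\<le>n d - N. ?G N (n(d := s)))"
      proof (rule sum.reindex_bij_witness[of _ "\<lambda>s. n d - s" "\<lambda>t. n d - t"])
        fix t assume "t \<in> {t. N \<le> t \<and> t \<le> n d}"
        then show "?G N (n(d := n d - t)) = ?G t (n(d := n d - t))" using GN[of t] by simp
      qed (use False in auto)
      then show ?thesis using False by simp
    qed
    finally show ?thesis .
  qed
  show ?case
    unfolding eq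
    by (rule rational_series.add[OF rational_series_sum
        rational_series_shift[OF rational_series_partial_sum[OF G]]])
      (auto intro: rational_series_shift[OF G])
qed

text \<open>A form of Dickson's lemma: in one variable an antitone function becomes constant; for several
  variables, apply the induction hypothesis to the limit along the first variable.  The limit is reached
  uniformly because it is reached on a finite box, and antitonicity transports this to everything above.\<close>

lemma antitone_truncation:
  fixes f :: "nat list \<Rightarrow> nat"
  assumes "\<And>u v. \<lbrakk>length u = r; list_all2 (\<le>) u v\<rbrakk> \<Longrightarrow> f v \<le> f u"
  shows "\<exists>N. \<forall>u. length u = r \<longrightarrow> f u = f (map (min N) u)"
  using assms
proof (induction r arbitrary: f)
  case 0
  then show ?case by auto
next
  case (Suc r)
  have larger: "g u = g (map (min N') u)"
    if N: "\<forall>u. length u = r \<longrightarrow> g u = g (map (min N) u)" "N \<le> N'" "length u = r" for g :: "nat list \<Rightarrow> nat" and N N' u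
  proof -
    have "map (min N) (map (min N') u) = map (min N) u" using N(2) by (auto simp: min_def)
    then show ?thesis using N(1,3) by (metis length_map)
  qed
  have slice: "\<exists>N. \<forall>u. length u = r \<longrightarrow> f (t # u) = f (t # map (min N) u)" for t
    by (rule Suc.IH) (use Suc.prems in auto)
  then obtain Nt where Nt: "\<And>t. \<forall>u. length u = r \<longrightarrow> f (t # u) = f (t # map (min (Nt t)) u)" by metis
  \<comment> \<open>the limit along the first variable\<close>
  define g where "g u = (LEAST m. \<exists>t. m = f (t # u))" for u
  have g_attained: "\<exists>t. g u = f (t # u)" for u
    unfolding g_def by (rule LeastI_ex) blast
  have g_le: "g u \<le> f (t # u)" for u t unfolding g_def by (rule Least_le) blast
  have "\<exists>N. \<forall>u. length u = r \<longrightarrow> g u = g (map (min N) u)"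
  proof (rule Suc.IH)
    fix u v :: "nat list" assume uv: "length u = r" "list_all2 (\<le>) u v"
    obtain t where "g u = f (t # u)" using g_attained by blast
    moreover have "f (t # v) \<le> f (t # u)" using Suc.prems uv by auto
    ultimately show "g v \<le> g u" using g_le[of v t] by simp
  qed
  then obtain M where M: "\<And>u. length u = r \<Longrightarrow> g u = g (map (min M) u)" by blast
  define box where "box = {u. set u \<subseteq> {..M} \<and> length u = r}"
  have "finite box" unfolding box_def by (rule finite_lists_length_eq) simp
  obtain tt where tt: "\<And>u. g u = f (tt u # u)" using g_attained by metis
  define T where "T = Max (insert 0 (tt ` box))"
  have T: "tt u \<le> T" if "u \<in> box" for u
    unfolding T_def by (rule Max_ge) (use \<open>finite box\<close> that in auto)
  have limit: "f (t # u) = g u" if "t \<ge> T" "length u = r" for t u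
  proof -
    let ?u = "map (min M) u"
    have b: "?u \<in> box" using that by (auto simp: box_def)
    have "f (t # u) \<le> f (tt ?u # ?u)"
    proof (rule Suc.prems)
      have "list_all2 (\<le>) ?u u" by (simp add: list_all2_conv_all_nth)
      then show "list_all2 (\<le>) (tt ?u # ?u) (t # u)" using T[OF b] that by auto
    qed (use that in auto)
    also have "\<dots> = g u" using tt[of ?u] M[OF that(2)] by simp
    finally show ?thesis using g_le by (simp add: antisym)
  qed
  define N where "N = Max (insert T (Nt ` {..T}))"
  have NT: "T \<le> N" unfolding N_def by (rule Max_ge) auto
  have NNt: "Nt t \<le> N" if "t \<le> T" for t unfolding N_def by (rule Max_ge) (use that in auto)
  have "f u = f (map (min N) u)" if "length u = Suc r" for u
  proof -
    obtain t v where u: "u = t # v" "length v = r" using \<open>length u = Suc r\<close> by (auto simp: length_Suc_conv)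
    have v: "f (t # v) = f (t # map (min N) v)" if "t \<le> T" for t
      using larger[OF Nt NNt[OF that] u(2)] by simp
    show ?thesis
    proof (cases "t \<le> T")
      case True
      then show ?thesis using v[OF True] u NT by (simp add: min_absorb2)
    next
      case False
      then have "f (t # v) = f (T # v)" using limit u by simp
      also have "\<dots> = f (T # map (min N) v)" using v by simp
      also have "\<dots> = f (min N t # map (min N) v)" using limit[of T] limit[of "min N t"] u NT False by simp
      finally show ?thesis using u by simp
    qed
  qed
  then show ?case by blast
qed

theorem expandable_sum_antitone:
  fixes f :: "nat list \<Rightarrow> nat" and ds :: "'d::finite list"
  assumes "\<And>u v. \<lbrakk>length u = length ds; list_all2 (\<le>) u v\<rbrakk> \<Longrightarrow> f v \<le> f u"
  shows "expandable (\<lambda>n. int (\<Sum>u\<in>exponents ds n. f u))"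
proof -
  obtain N where N: "\<forall>u. length u = length ds \<longrightarrow> f u = f (map (min N) u)"
    using antitone_truncation[of "length ds" f] assms by blast
  have "rational_series (\<lambda>n :: 'd \<Rightarrow> nat. \<Sum>u\<in>exponents ds n. int (f u))"
  proof (rule rational_series_sum_exponents)
    fix u :: "nat list" assume "length u = length ds"
    then show "int (f u) = int (f (map (min N) u))" using N by (intro arg_cong[of _ _ int]) blast
  qed
  then show ?thesis by (simp add: rational_series_expandable)
qed

section \<open>Homogeneous components\<close>

definition component :: "('m, 'r) ring_scheme \<Rightarrow> (('d \<Rightarrow> nat) \<Rightarrow> 'm set) \<Rightarrow> 'm \<Rightarrow> ('d \<Rightarrow> nat) \<Rightarrow> 'm" where
  "component M Mg x = (THE c. (\<forall>n. c n \<in> Mg n) \<and> finite {n. c n \<noteq> \<zero>\<^bsub>M\<^esub>} \<and>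
        x = finsum M c {n. c n \<noteq> \<zero>\<^bsub>M\<^esub>})"

locale graded_group = abelian_group M for M :: "('m, 'r) ring_scheme" (structure)
  and Mg :: "('d::finite \<Rightarrow> nat) \<Rightarrow> 'm set" +
  assumes decomposition: "direct_sum_decomposition M Mg"
begin

lemma piece_subgroup: "subgroup (Mg n) (add_monoid M)"
  using decomposition by (simp add: direct_sum_decomposition_def)

lemma piece_carrier: "x \<in> Mg n \<Longrightarrow> x \<in> carrier M"
  using subgroup.subset[OF piece_subgroup[of n]] by auto

lemma piece_zero: "\<zero> \<in> Mg n"
  using subgroup.one_closed[OF piece_subgroup[of n]] by simp

lemma piece_add: "\<lbrakk>x \<in> Mg n; y \<in> Mg n\<rbrakk> \<Longrightarrow> x \<oplus> y \<in> Mg n"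
  using subgroup.m_closed[OF piece_subgroup[of n]] by simp

lemma component_props:
  assumes "x \<in> carrier M"
  shows "component M Mg x n \<in> Mg n" "finite {n. component M Mg x n \<noteq> \<zero>}"
    "x = finsum M (component M Mg x) {n. component M Mg x n \<noteq> \<zero>}"
proof -
  have "\<exists>!c. (\<forall>n. c n \<in> Mg n) \<and> finite {n. c n \<noteq> \<zero>} \<and> x = finsum M c {n. c n \<noteq> \<zero>}"
    using decomposition assms unfolding direct_sum_decomposition_def by blast
  from theI'[OF this] show "component M Mg x n \<in> Mg n" "finite {n. component M Mg x n \<noteq> \<zero>}"
    "x = finsum M (component M Mg x) {n. component M Mg x n \<noteq> \<zero>}"
    unfolding component_def by auto
qed

lemma finsum_superset:
  assumes "\<And>n. c n \<in> Mg n" "finite K" "{n. c n \<noteq> \<zero>} \<subseteq> K"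
  shows "finsum M c {n. c n \<noteq> \<zero>} = finsum M c K"
  by (rule add.finprod_mono_neutral_cong_left) (use assms piece_carrier in auto)

lemma component_unique:
  assumes "\<And>n. c n \<in> Mg n" "finite K" "{n. c n \<noteq> \<zero>} \<subseteq> K" "x = finsum M c K"
  shows "component M Mg x = c"
proof -
  have x: "x \<in> carrier M" using assms(1,4) piece_carrier by (auto intro!: finsum_closed)
  have ex1: "\<exists>!c. (\<forall>n. c n \<in> Mg n) \<and> finite {n. c n \<noteq> \<zero>} \<and> x = finsum M c {n. c n \<noteq> \<zero>}"
    using decomposition x unfolding direct_sum_decomposition_def by blast
  have fin: "finite {n. c n \<noteq> \<zero>}" using assms(2,3) finite_subset by blast
  have "x = finsum M c {n. c n \<noteq> \<zero>}" using finsum_superset[of c K] assms by simp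
  then show ?thesis unfolding component_def using fin assms(1) by (intro the1_equality[OF ex1]) blast
qed

lemma component_homogeneous:
  assumes "x \<in> Mg n"
  shows "component M Mg x = (\<lambda>m. if m = n then x else \<zero>)"
  by (rule component_unique[of _ "{n}"]) (use assms piece_zero piece_carrier in auto)

lemma component_add:
  assumes "x \<in> carrier M" "y \<in> carrier M"
  shows "component M Mg (x \<oplus> y) = (\<lambda>n. component M Mg x n \<oplus> component M Mg y n)"
proof -
  let ?c = "component M Mg x" and ?d = "component M Mg y"
  note X = component_props[OF assms(1)] and Y = component_props[OF assms(2)]
  let ?K = "{n. ?c n \<noteq> \<zero>} \<union> {n. ?d n \<noteq> \<zero>}"
  have c: "?c \<in> ?K \<rightarrow> carrier M" "?d \<in> ?K \<rightarrow> carrier M" using X(1) Y(1) piece_carrier by auto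
  have fK: "finite ?K" using X(2) Y(2) by simp
  have x: "finsum M ?c ?K = x"
    unfolding X(3)[symmetric] finsum_superset[of ?c, OF X(1) fK Un_upper1, symmetric] ..
  have y: "finsum M ?d ?K = y"
    unfolding Y(3)[symmetric] finsum_superset[of ?d, OF Y(1) fK Un_upper2, symmetric] ..
  have "x \<oplus> y = finsum M (\<lambda>n. ?c n \<oplus> ?d n) ?K"
    by (simp only: finsum_addf[OF c] x y)
  then show ?thesis
    by (intro component_unique[of _ ?K]) (use X Y piece_add piece_carrier in auto)
qed

lemma component_zero: "component M Mg \<zero> n = \<zero>"
  using component_homogeneous[OF piece_zero[of n]] by simp

text \<open>Statements additive in \<open>x\<close> need only be checked on homogeneous elements.\<close>

lemma homogeneous_induct [consumes 1, case_names zero homogeneous add]: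
  assumes "x \<in> carrier M" and "P \<zero>" and "\<And>n x. x \<in> Mg n \<Longrightarrow> P x"
    and "\<And>x y. \<lbrakk>x \<in> carrier M; y \<in> carrier M; P x; P y\<rbrakk> \<Longrightarrow> P (x \<oplus> y)"
  shows "P x"
proof -
  have "P (finsum M c K)" if "finite K" "\<And>n. c n \<in> Mg n" for c K
    using that
  proof (induction K rule: finite_induct)
    case (insert k K)
    have "c k \<in> carrier M" "finsum M c K \<in> carrier M"
      using insert piece_carrier by (auto intro!: finsum_closed)
    moreover have "finsum M c (insert k K) = c k \<oplus> finsum M c K"
      using insert piece_carrier by (intro finsum_insert) auto
    ultimately show ?case using insert assms(3,4) by metis
  qed (use assms(2) in simp)
  then show ?thesis using component_props[OF assms(1)] by metis
qed

end


section \<open>Existence of the Hilbert polynomial\<close>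

text \<open>The lengths are lengths of \<open>A\<close>-modules, so the submodules to be counted are those of \<open>M\<close> over \<open>A\<close>. Each graded
  piece is one of them, unlike over \<open>S\<close>.\<close>

definition restrict_scalars ::
    "('a, 's, 'q) module_scheme \<Rightarrow> ('s, 'm, 'r) module_scheme \<Rightarrow> ('a, 'm) module" where
  "restrict_scalars S M =
     \<lparr>carrier = carrier M, monoid.mult = monoid.mult M, one = one M, zero = zero M, add = add M,
      smult = (\<lambda>a x. (a \<odot>\<^bsub>S\<^esub> \<one>\<^bsub>S\<^esub>) \<odot>\<^bsub>M\<^esub> x)\<rparr>"

lemma restrict_scalars_simps [simp]:
  "carrier (restrict_scalars S M) = carrier M"
  "zero (restrict_scalars S M) = zero M"
  "add (restrict_scalars S M) = add M"
  "smult (restrict_scalars S M) = (\<lambda>a x. (a \<odot>\<^bsub>S\<^esub> \<one>\<^bsub>S\<^esub>) \<odot>\<^bsub>M\<^esub> x)"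
  by (simp_all add: restrict_scalars_def)

lemma graded_piece_simps [simp]:
  "carrier (graded_piece S M Mg n) = Mg n"
  "zero (graded_piece S M Mg n) = zero M"
  "add (graded_piece S M Mg n) = add M"
  "smult (graded_piece S M Mg n) = (\<lambda>a x. (a \<odot>\<^bsub>S\<^esub> \<one>\<^bsub>S\<^esub>) \<odot>\<^bsub>M\<^esub> x)"
  by (simp_all add: graded_piece_def)

lemma module_restrict_scalars:
  assumes "algebra A S" "module S M"
  shows "module A (restrict_scalars S M)"
proof -
  interpret S: algebra A S by fact
  interpret M: module S M by fact
  have one: "\<one>\<^bsub>S\<^esub> \<in> carrier S" by simp
  show ?thesis
  proof (rule moduleI)
    show "cring A" by (rule S.R_cring)
    show "abelian_group (restrict_scalars S M)"
    proof (rule abelian_groupI)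
      fix x assume "x \<in> carrier (restrict_scalars S M)"
      then have "x \<in> carrier M" by simp
      then show "\<exists>y\<in>carrier (restrict_scalars S M). y \<oplus>\<^bsub>restrict_scalars S M\<^esub> x = \<zero>\<^bsub>restrict_scalars S M\<^esub>"
        using M.M.l_neg by (auto intro!: bexI[of _ "\<ominus>\<^bsub>M\<^esub> x"])
    qed (auto simp: M.M.a_ac)
  next
    fix a b x assume ab: "a \<in> carrier A" "b \<in> carrier A" and x: "x \<in> carrier (restrict_scalars S M)"
    have x: "x \<in> carrier M" using x by simp
    have "(a \<otimes>\<^bsub>A\<^esub> b) \<odot>\<^bsub>S\<^esub> \<one>\<^bsub>S\<^esub> = (a \<odot>\<^bsub>S\<^esub> \<one>\<^bsub>S\<^esub>) \<otimes>\<^bsub>S\<^esub> (b \<odot>\<^bsub>S\<^esub> \<one>\<^bsub>S\<^esub>)"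
      using ab S.smult_assoc2[OF ab(1) one, of "b \<odot>\<^bsub>S\<^esub> \<one>\<^bsub>S\<^esub>"] by (simp add: S.smult_assoc1)
    then show "(a \<otimes>\<^bsub>A\<^esub> b) \<odot>\<^bsub>restrict_scalars S M\<^esub> x = a \<odot>\<^bsub>restrict_scalars S M\<^esub> (b \<odot>\<^bsub>restrict_scalars S M\<^esub> x)"
      using ab x by (simp add: M.smult_assoc1)
    show "(a \<oplus>\<^bsub>A\<^esub> b) \<odot>\<^bsub>restrict_scalars S M\<^esub> x =
        a \<odot>\<^bsub>restrict_scalars S M\<^esub> x \<oplus>\<^bsub>restrict_scalars S M\<^esub> b \<odot>\<^bsub>restrict_scalars S M\<^esub> x"
      using ab x by (simp add: S.smult_l_distr M.smult_l_distr)
  qed (auto simp: M.smult_r_distr)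
qed

lemma generate_ring_finite_subset:
  assumes "x \<in> generate_ring R H"
  shows "\<exists>K. finite K \<and> K \<subseteq> H \<and> x \<in> generate_ring R K"
proof -
  have mono: "generate_ring R K \<subseteq> generate_ring R K'" if "K \<subseteq> K'" for K K'
  proof
    fix y assume "y \<in> generate_ring R K"
    then show "y \<in> generate_ring R K'"
      by induction (use that in \<open>auto intro: generate_ring.intros\<close>)
  qed
  have two: "\<exists>K. finite K \<and> K \<subseteq> H \<and> x \<in> generate_ring R K \<and> y \<in> generate_ring R K"
    if "\<exists>K. finite K \<and> K \<subseteq> H \<and> x \<in> generate_ring R K" "\<exists>K. finite K \<and> K \<subseteq> H \<and> y \<in> generate_ring R K" for x y
  proof -
    obtain K K' where *: "finite K" "K \<subseteq> H" "x \<in> generate_ring R K"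
      "finite K'" "K' \<subseteq> H" "y \<in> generate_ring R K'" using \<open>\<exists>K. finite K \<and> K \<subseteq> H \<and> x \<in> generate_ring R K\<close>
        \<open>\<exists>K. finite K \<and> K \<subseteq> H \<and> y \<in> generate_ring R K\<close> by auto
    then show ?thesis using mono[of K "K \<union> K'"] mono[of K' "K \<union> K'"]
      by (intro exI[of _ "K \<union> K'"]) auto
  qed
  show ?thesis
    using assms
  proof induction
    case one
    then show ?case by (intro exI[of _ "{}"]) (auto intro: generate_ring.one)
  next
    case (incl h)
    then show ?case by (intro exI[of _ "{h}"]) (auto intro: generate_ring.incl)
  next
    case (a_inv h)
    then obtain K where "finite K" "K \<subseteq> H" "h \<in> generate_ring R K" by blast
    then show ?case using generate_ring.a_inv[of h R K] by (intro exI[of _ K]) simp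
  next
    case (eng_add h1 h2)
    from two[OF this(3,4)] obtain K where "finite K" "K \<subseteq> H" "h1 \<in> generate_ring R K" "h2 \<in> generate_ring R K"
      by blast
    then show ?case using generate_ring.eng_add[of h1 R K h2] by (intro exI[of _ K]) simp
  next
    case (eng_mult h1 h2)
    from two[OF this(3,4)] obtain K where "finite K" "K \<subseteq> H" "h1 \<in> generate_ring R K" "h2 \<in> generate_ring R K"
      by blast
    then show ?case using generate_ring.eng_mult[of h1 R K h2] by (intro exI[of _ K]) simp
  qed
qed

lemma lex_add_strict_mono:
  fixes u v s :: "nat list"
  assumes "length u = length v" "length v = length s" "u < v"
  shows "map2 (+) u s < map2 (+) v s"
  using assms by (induction u v s rule: list_induct3) auto

lemma exponent_degree_add:
  assumes "length u = length ds" "length v = length ds"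
  shows "exponent_degree ds (map2 (+) u v) = exponent_degree ds u + exponent_degree ds v"
proof -
  have "length ds = length u \<Longrightarrow> length u = length v \<Longrightarrow> ?thesis"
    by (induction ds u v rule: list_induct3) (auto simp: fun_eq_iff)
  then show ?thesis using assms by simp
qed

fun monomial :: "('s, 'q) ring_scheme \<Rightarrow> ('s \<times> 'd) list \<Rightarrow> nat list \<Rightarrow> 's" where
  "monomial S ((x, i) # X) (t # u) = x [^]\<^bsub>S\<^esub> t \<otimes>\<^bsub>S\<^esub> monomial S X u"
| "monomial S _ _ = \<one>\<^bsub>S\<^esub>"

locale graded_module_over_artinian =
  Art: artinian_local_ring A \<mm> + Alg: fg_standard_multigraded_algebra A S Sg +
  Mod: fg_multigraded_module S Sg M Mg
  for A :: "('a, 'p) ring_scheme" and \<mm> :: "'a set"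
    and S :: "('a, 's, 'q) module_scheme" and Sg :: "('d::finite \<Rightarrow> nat) \<Rightarrow> 's set"
    and M :: "('s, 'm, 'r) module_scheme" and Mg :: "('d \<Rightarrow> nat) \<Rightarrow> 'm set"
begin

sublocale Sgr: graded_group S Sg
  by unfold_locales (rule Alg.S_decomposition)

sublocale Mgr: graded_group M Mg
  by unfold_locales (rule Mod.M_decomposition)

abbreviation "W \<equiv> restrict_scalars S M"

sublocale W: module A W
  by (rule module_restrict_scalars[OF Alg.algebra_axioms Mod.module_axioms])

abbreviation "len \<equiv> relative_length A W"

lemmas W_submodule_iff = W.submodule_iff[unfolded restrict_scalars_simps]

lemma finite_length_ring: "chain_length {I. ideal I A} \<noteq> \<infinity>"
  by (rule Art.artinian_finite_length) (rule Art.ideal_dcc)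

text \<open>Write \<open>1\<close> as a sum of homogeneous elements. Its degree zero component acts as the identity on
  every homogeneous element, so it is \<open>1\<close>.\<close>

lemma one_degree_zero: "\<one>\<^bsub>S\<^esub> \<in> Sg (\<lambda>_. 0)"
proof -
  let ?e = "component S Sg \<one>\<^bsub>S\<^esub> (\<lambda>_. 0)"
  have comp: "component S Sg (s \<otimes>\<^bsub>S\<^esub> x) m = component S Sg s (\<lambda>_. 0) \<otimes>\<^bsub>S\<^esub> x"
    if x: "x \<in> Sg m" and s: "s \<in> carrier S" for s x m
    using s
  proof (induction s rule: Sgr.homogeneous_induct)
    case zero
    then show ?case using x Sgr.piece_carrier by (simp add: Sgr.component_zero)
  next
    case (homogeneous n s)
    have "s \<otimes>\<^bsub>S\<^esub> x \<in> Sg (n + m)" by (rule Alg.Sg_mult[OF homogeneous x])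
    moreover have "m = n + m \<longleftrightarrow> n = (\<lambda>_. 0)" "(\<lambda>_. 0) = n \<longleftrightarrow> n = (\<lambda>_. 0)" by (auto simp: fun_eq_iff)
    ultimately show ?case
      using Sgr.piece_carrier[OF x] by (simp add: Sgr.component_homogeneous[OF homogeneous] Sgr.component_homogeneous)
  next
    case (add s t)
    have xc: "x \<in> carrier S" using x Sgr.piece_carrier by blast
    have "component S Sg s (\<lambda>_. 0) \<in> carrier S" "component S Sg t (\<lambda>_. 0) \<in> carrier S"
      using add Sgr.component_props(1) Sgr.piece_carrier by blast+
    then show ?case using add xc by (simp add: Alg.l_distr Sgr.component_add)
  qed
  have ec: "?e \<in> Sg (\<lambda>_. 0)" "?e \<in> carrier S" using Sgr.component_props(1) Sgr.piece_carrier by auto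
  have "?e \<otimes>\<^bsub>S\<^esub> x = x" if "x \<in> carrier S" for x
    using that
  proof (induction x rule: Sgr.homogeneous_induct)
    case (homogeneous n x)
    then show ?case
      using comp[OF homogeneous, of "\<one>\<^bsub>S\<^esub>"] Sgr.piece_carrier[OF homogeneous]
      by (simp add: Sgr.component_homogeneous)
  qed (use ec in \<open>auto simp: Alg.r_distr\<close>)
  then have "?e = \<one>\<^bsub>S\<^esub>" using ec by (metis Alg.r_one Alg.one_closed)
  then show ?thesis using ec by simp
qed

lemma scalar_degree_zero:
  assumes "a \<in> carrier A"
  shows "a \<odot>\<^bsub>S\<^esub> \<one>\<^bsub>S\<^esub> \<in> Sg (\<lambda>_. 0)"
  using submodule.smult_closed[OF Alg.Sg_submodule assms one_degree_zero] .

lemma piece_submodule: "submodule (Mg n) A W"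
  unfolding W_submodule_iff
proof (intro conjI ballI)
  fix a x assume a: "a \<in> carrier A" and x: "x \<in> Mg n"
  have "(a \<odot>\<^bsub>S\<^esub> \<one>\<^bsub>S\<^esub>) \<odot>\<^bsub>M\<^esub> x \<in> Mg ((\<lambda>_. 0) + n)"
    by (rule Mod.Mg_smult[OF scalar_degree_zero[OF a] x])
  moreover have "(\<lambda>_. 0) + n = n" by (auto simp: fun_eq_iff)
  ultimately show "(a \<odot>\<^bsub>S\<^esub> \<one>\<^bsub>S\<^esub>) \<odot>\<^bsub>M\<^esub> x \<in> Mg n" by simp
qed (use Mgr.piece_carrier Mgr.piece_zero Mgr.piece_add in auto)

text \<open>Both sides are additive in \<open>m\<close>, so \<open>m\<close> may be taken homogeneous.\<close>

lemma component_smult: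
  assumes s: "s \<in> Sg e" and m: "m \<in> carrier M"
  shows "component M Mg (s \<odot>\<^bsub>M\<^esub> m) n =
    (if e \<le> n then s \<odot>\<^bsub>M\<^esub> component M Mg m (n - e) else \<zero>\<^bsub>M\<^esub>)"
  using m
proof (induction m rule: Mgr.homogeneous_induct)
  case zero
  then show ?case using Sgr.piece_carrier[OF s] by (simp add: Mgr.component_zero)
next
  case (homogeneous k x)
  have "s \<odot>\<^bsub>M\<^esub> x \<in> Mg (e + k)" by (rule Mod.Mg_smult[OF s homogeneous])
  moreover have "n = e + k \<longleftrightarrow> e \<le> n \<and> n - e = k"
    by (auto simp: fun_eq_iff le_fun_def) (metis le_add_diff_inverse)
  ultimately show ?case
    using Sgr.piece_carrier[OF s] by (simp add: Mgr.component_homogeneous[OF homogeneous] Mgr.component_homogeneous del: minus_apply)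
next
  case (add x y)
  have "component M Mg x (n - e) \<in> carrier M" "component M Mg y (n - e) \<in> carrier M"
    using add Mgr.component_props(1) Mgr.piece_carrier by blast+
  then show ?case using add Sgr.piece_carrier[OF s]
    by (simp add: Mod.smult_r_distr Mgr.component_add del: minus_apply)
qed

lemma smult_W_linear:
  assumes "s \<in> carrier S" "a \<in> carrier A" "x \<in> carrier M"
  shows "s \<odot>\<^bsub>M\<^esub> ((a \<odot>\<^bsub>S\<^esub> \<one>\<^bsub>S\<^esub>) \<odot>\<^bsub>M\<^esub> x) = (a \<odot>\<^bsub>S\<^esub> \<one>\<^bsub>S\<^esub>) \<odot>\<^bsub>M\<^esub> (s \<odot>\<^bsub>M\<^esub> x)"
  using assms by (simp add: Mod.smult_assoc1[symmetric] Alg.m_comm)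

text \<open>Each of finitely many algebra generators is a polynomial expression in the elements of degree one, and it involves only
  finitely many of them.\<close>

lemma finite_linear_generators:
  obtains X where "\<And>x i. (x, i) \<in> set X \<Longrightarrow> x \<in> Sg (unit_vec i)"
    and "carrier S \<subseteq> generate_ring S ((\<lambda>a. a \<odot>\<^bsub>S\<^esub> \<one>\<^bsub>S\<^esub>) ` carrier A \<union> fst ` set X)"
proof -
  let ?A = "(\<lambda>a. a \<odot>\<^bsub>S\<^esub> \<one>\<^bsub>S\<^esub>) ` carrier A"
  let ?H = "?A \<union> (\<Union>i. Sg (unit_vec i))"
  obtain F where F: "finite F" "F \<subseteq> carrier S" "generate_ring S (?A \<union> F) = carrier S"
    using Alg.S_fg unfolding algebra_span_def by blast
  have H: "generate_ring S ?H = carrier S" using Alg.S_standard unfolding algebra_span_def .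
  have "\<exists>K. finite K \<and> K \<subseteq> ?H \<and> f \<in> generate_ring S K" if "f \<in> F" for f
    by (rule generate_ring_finite_subset) (use F(2) that in \<open>unfold H, blast\<close>)
  then have "\<forall>f\<in>F. \<exists>K. finite K \<and> K \<subseteq> ?H \<and> f \<in> generate_ring S K" by (rule ballI)
  from bchoice[OF this] obtain K
    where K: "\<forall>f\<in>F. finite (K f) \<and> K f \<subseteq> ?H \<and> f \<in> generate_ring S (K f)" by (rule exE)
  define U where "U = (\<Union>f\<in>F. K f) - ?A"
  have U: "finite U" "\<And>x. x \<in> U \<Longrightarrow> \<exists>i. x \<in> Sg (unit_vec i)"
    unfolding U_def using F(1) K by auto blast
  then obtain i where i: "\<And>x. x \<in> U \<Longrightarrow> x \<in> Sg (unit_vec (i x))" by metis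
  obtain us where us: "set us = U" using finite_list U(1) by blast
  define X where "X = map (\<lambda>x. (x, i x)) us"
  have fst: "fst ` set X = U" unfolding X_def us[symmetric] by force
  have UC: "?A \<union> U \<subseteq> carrier S" using i Sgr.piece_carrier by (auto intro: Alg.smult_closed)
  have "?A \<union> F \<subseteq> generate_ring S (?A \<union> U)"
  proof
    fix f assume "f \<in> ?A \<union> F"
    then show "f \<in> generate_ring S (?A \<union> U)"
    proof
      assume "f \<in> F"
      then have "f \<in> generate_ring S (K f)" "K f \<subseteq> ?A \<union> U" using K unfolding U_def by auto
      then show ?thesis using Alg.mono_generate_ring[OF _ UC] by blast
    qed (auto intro: generate_ring.incl)
  qed
  then have "carrier S \<subseteq> generate_ring S (?A \<union> U)"
    using F(3) Alg.generate_ring_min_subring1[OF _ Alg.generate_ring_is_subring[OF UC], of "?A \<union> F"] F(2) UC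
    by auto
  then show thesis using that[of X] i fst X_def us by auto
qed

context
  fixes X :: "('s \<times> 'd) list"
  assumes X: "\<And>x i. (x, i) \<in> set X \<Longrightarrow> x \<in> Sg (unit_vec i)"
    and X_gen: "carrier S \<subseteq> generate_ring S ((\<lambda>a. a \<odot>\<^bsub>S\<^esub> \<one>\<^bsub>S\<^esub>) ` carrier A \<union> fst ` set X)"
begin

abbreviation "ds \<equiv> map snd X"

lemma X_carrier: "(x, i) \<in> set X \<Longrightarrow> x \<in> carrier S"
  using X Sgr.piece_carrier by blast

lemma monomial_carrier: "set Y \<subseteq> set X \<Longrightarrow> monomial S Y u \<in> carrier S"
proof (induction Y arbitrary: u)
  case (Cons y Y)
  obtain x i where "y = (x, i)" by force
  then show ?case using Cons X_carrier[of x i] by (cases u) auto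
qed simp

lemma monomial_add:
  assumes "set Y \<subseteq> set X" "length u = length Y" "length v = length Y"
  shows "monomial S Y (map2 (+) u v) = monomial S Y u \<otimes>\<^bsub>S\<^esub> monomial S Y v"
  using assms
proof (induction Y arbitrary: u v)
  case (Cons y Y)
  obtain x i where y: "y = (x, i)" by force
  obtain t u' s v' where uv: "u = t # u'" "v = s # v'" using Cons.prems by (auto simp: length_Suc_conv)
  have x: "x \<in> carrier S" "monomial S Y u' \<in> carrier S" "monomial S Y v' \<in> carrier S"
    using Cons.prems X_carrier[of x i] monomial_carrier y by auto
  then show ?case using Cons by (simp add: y uv Alg.nat_pow_mult[symmetric] Alg.m_ac)
qed simp

lemma monomial_smult_degree:
  assumes "set Y \<subseteq> set X" "length u = length Y" "g \<in> Mg b"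
  shows "monomial S Y u \<odot>\<^bsub>M\<^esub> g \<in> Mg (b + exponent_degree (map snd Y) u)"
  using assms
proof (induction Y arbitrary: u)
  case Nil
  have "b + (\<lambda>_. 0) = b" by (auto simp: fun_eq_iff)
  then show ?case using Nil Mgr.piece_carrier by simp
next
  case (Cons y Y)
  obtain x i where y: "y = (x, i)" by force
  obtain t u' where u: "u = t # u'" using Cons.prems by (auto simp: length_Suc_conv)
  have x: "x \<in> carrier S" "x \<in> Sg (unit_vec i)" using Cons.prems X X_carrier[of x i] y by auto
  have c: "monomial S Y u' \<in> carrier S" "g \<in> carrier M"
    using Cons.prems monomial_carrier Mgr.piece_carrier by auto
  have pow: "x [^]\<^bsub>S\<^esub> t \<odot>\<^bsub>M\<^esub> m \<in> Mg (k + (\<lambda>j. if j = i then t else 0))" if "m \<in> Mg k" for m k t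
  proof (induction t)
    case 0
    have "k + (\<lambda>j. if j = i then 0 else 0) = k" by (auto simp: fun_eq_iff)
    then show ?case using that Mgr.piece_carrier[OF that] by simp
  next
    case (Suc t)
    have "x [^]\<^bsub>S\<^esub> Suc t \<odot>\<^bsub>M\<^esub> m = x \<odot>\<^bsub>M\<^esub> (x [^]\<^bsub>S\<^esub> t \<odot>\<^bsub>M\<^esub> m)"
      using x Mgr.piece_carrier[OF that] by (simp add: Mod.smult_assoc1[symmetric] Alg.m_comm)
    moreover have "unit_vec i + (k + (\<lambda>j. if j = i then t else 0)) = k + (\<lambda>j. if j = i then Suc t else 0)"
      by (auto simp: fun_eq_iff unit_vec_def)
    ultimately show ?case using Mod.Mg_smult[OF x(2) Suc] by (simp only:)
  qed
  have "monomial S (y # Y) u \<odot>\<^bsub>M\<^esub> g = x [^]\<^bsub>S\<^esub> t \<odot>\<^bsub>M\<^esub> (monomial S Y u' \<odot>\<^bsub>M\<^esub> g)"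
    using x c by (simp add: y u Mod.smult_assoc1)
  moreover have "monomial S Y u' \<odot>\<^bsub>M\<^esub> g \<in> Mg (b + exponent_degree (map snd Y) u')"
    using Cons.IH[of u'] Cons.prems u by (simp del: plus_fun_apply)
  moreover have "b + exponent_degree (map snd Y) u' + (\<lambda>j. if j = i then t else 0) =
    b + exponent_degree (map snd (y # Y)) u"
    by (auto simp: fun_eq_iff y u)
  ultimately show ?case using pow by metis
qed

lemma monomial_step:
  assumes "(x, i) \<in> set Y" "set Y \<subseteq> set X" "length u = length Y"
  shows "\<exists>u'. length u' = length Y \<and> monomial S Y u' = x \<otimes>\<^bsub>S\<^esub> monomial S Y u \<and>
    exponent_degree (map snd Y) u' = exponent_degree (map snd Y) u + unit_vec i"
  using assms
proof (induction Y arbitrary: u)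
  case (Cons y Y)
  obtain z j where y: "y = (z, j)" by force
  obtain t v where u: "u = t # v" "length v = length Y" using Cons.prems by (auto simp: length_Suc_conv)
  have c: "x \<in> carrier S" "z \<in> carrier S" "monomial S Y v \<in> carrier S"
    using Cons.prems X_carrier[of x i] X_carrier[of z j] monomial_carrier y by auto
  show ?case
  proof (cases "(x, i) = y")
    case True
    then show ?thesis using c u y
      by (intro exI[of _ "Suc t # v"]) (auto simp: Alg.m_ac fun_eq_iff unit_vec_def)
  next
    case False
    then have "(x, i) \<in> set Y" "set Y \<subseteq> set X" using Cons.prems by auto
    from Cons.IH[OF this u(2)] obtain v' where v': "length v' = length Y" "monomial S Y v' = x \<otimes>\<^bsub>S\<^esub> monomial S Y v"
      "exponent_degree (map snd Y) v' = exponent_degree (map snd Y) v + unit_vec i"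
      by blast
    then show ?thesis using c u y
      by (intro exI[of _ "t # v'"]) (auto simp: Alg.m_ac fun_eq_iff)
  qed
qed simp

definition monomial_multiples :: "('m \<times> ('d \<Rightarrow> nat)) list \<Rightarrow> ('d \<Rightarrow> nat) \<Rightarrow> 'm set" where
  "monomial_multiples G n =
     {monomial S X u \<odot>\<^bsub>M\<^esub> g | g b u. (g, b) \<in> set G \<and> length u = length X \<and> b + exponent_degree ds u = n}"

lemma monomial_multiples_carrier:
  "(\<And>g b. (g, b) \<in> set G \<Longrightarrow> g \<in> Mg b) \<Longrightarrow> monomial_multiples G n \<subseteq> carrier M"
  unfolding monomial_multiples_def using monomial_carrier Mgr.piece_carrier by blast

lemma monomial_multiples_mult:
  assumes G: "\<And>g b. (g, b) \<in> set G \<Longrightarrow> g \<in> Mg b" and s: "length s = length X" and m: "m \<in> monomial_multiples G n"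
  shows "monomial S X s \<odot>\<^bsub>M\<^esub> m \<in> monomial_multiples G (n + exponent_degree ds s)"
proof -
  obtain g b u where m: "m = monomial S X u \<odot>\<^bsub>M\<^esub> g" "(g, b) \<in> set G" "length u = length X"
    "b + exponent_degree ds u = n" using m unfolding monomial_multiples_def by blast
  have "monomial S X s \<odot>\<^bsub>M\<^esub> m = monomial S X (map2 (+) u s) \<odot>\<^bsub>M\<^esub> g"
    using monomial_carrier[of X] Mgr.piece_carrier[OF G[OF m(2)]] m s
    by (simp add: monomial_add Mod.smult_assoc1[symmetric] Alg.m_comm)
  moreover have "b + exponent_degree ds (map2 (+) u s) = n + exponent_degree ds s"
    using m s by (auto simp: exponent_degree_add fun_eq_iff)
  ultimately show ?thesis unfolding monomial_multiples_def using m s by (auto 4 4)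
qed

text \<open>Adjoin the multiples \<open>x\<^sup>u g\<close> of a further generator in lexicographic order of \<open>u\<close>. Since the order is
  compatible with multiplication, multiplication by a monomial carries each step of the filtration
  to a later one, so the length of the step is antitone in \<open>u\<close>.\<close>

lemma monomial_span_expandable:
  assumes "\<And>g b. (g, b) \<in> set G \<Longrightarrow> g \<in> Mg b"
  shows "(\<forall>n. len {\<zero>\<^bsub>M\<^esub>} (submodule_span A W (monomial_multiples G n)) \<noteq> \<infinity>) \<and>
    expandable (\<lambda>n. int (the_enat (len {\<zero>\<^bsub>M\<^esub>} (submodule_span A W (monomial_multiples G n)))))"
  using assms
proof (induction G)
  case Nil
  have "submodule_span A W {} = {\<zero>\<^bsub>M\<^esub>}"
    using W.submodule_span_least[OF W.submodule_zero] W.submodule_span_props(1)[of "{}"]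
      W.submoduleD(2) by fastforce
  then show ?case
    by (simp add: monomial_multiples_def W.relative_length_self expandable_zero zero_enat_def)
next
  case (Cons p G)
  obtain g b where p: "p = (g, b)" by force
  have G: "\<And>g b. (g, b) \<in> set G \<Longrightarrow> g \<in> Mg b" and g: "g \<in> Mg b" using Cons.prems p by auto
  have gc: "g \<in> carrier M" using g Mgr.piece_carrier by blast
  let ?B = "monomial_multiples G"
  let ?w = "\<lambda>u. monomial S X u \<odot>\<^bsub>M\<^esub> g"
  have w: "?w u \<in> carrier M" for u using gc monomial_carrier by simp
  have B: "?B n \<subseteq> carrier M" for n using G by (rule monomial_multiples_carrier)
  \<comment> \<open>all generators adjoined before \<open>x\<^sup>u g\<close> in its degree\<close>
  define F where "F u = ?B (exponent_degree ds u + b) \<union> ?w ` {v \<in> exponents ds (exponent_degree ds u). v < u}" for u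
  have F: "F u \<subseteq> carrier M" for u unfolding F_def using B w by auto
  define f where "f u = the_enat (W.length_step (F u) (?w u))" for u
  have fin: "W.length_step (F u) (?w u) \<noteq> \<infinity>" for u
  proof -
    have "W.length_step (F u) (?w u) \<le> chain_length {I. ideal I A}"
      by (rule W.length_step_le_ring) (use F w in simp_all)
    then show ?thesis using finite_length_ring by (metis enat_ord_simps(5))
  qed
  have f: "W.length_step (F u) (?w u) = enat (f u)" for u
    unfolding f_def using fin[of u] by auto
  have anti: "f v \<le> f u" if u: "length u = length ds" and uv: "list_all2 (\<le>) u v" for u v
  proof -
    define s where "s = map2 (-) v u"
    have len: "length v = length u" "length s = length u"
      using list_all2_lengthD[OF uv] by (simp_all add: s_def)
    have v: "v = map2 (+) u s"
      by (rule nth_equalityI) (use uv len in \<open>auto simp: s_def list_all2_conv_all_nth\<close>)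
    have ws: "monomial S X s \<odot>\<^bsub>M\<^esub> ?w u' = ?w (map2 (+) u' s)" if "length u' = length X" for u'
      using monomial_carrier[of X] gc that len u
      by (simp add: monomial_add Mod.smult_assoc1[symmetric] Alg.m_comm)
    have deg: "exponent_degree ds v = exponent_degree ds u + exponent_degree ds s"
      using v u len by (simp add: exponent_degree_add)
    have "W.length_step (F v) (monomial S X s \<odot>\<^bsub>M\<^esub> ?w u) \<le> W.length_step (F u) (?w u)"
    proof (rule W.length_step_antimono)
      show "(\<lambda>x. monomial S X s \<odot>\<^bsub>M\<^esub> x) ` F u \<subseteq> submodule_span A W (F v)"
      proof (rule order_trans)
        show "F v \<subseteq> submodule_span A W (F v)" using F by (intro W.submodule_span_props(2)) simp
        show "(\<lambda>x. monomial S X s \<odot>\<^bsub>M\<^esub> x) ` F u \<subseteq> F v"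
        proof
          fix y assume "y \<in> (\<lambda>x. monomial S X s \<odot>\<^bsub>M\<^esub> x) ` F u"
          then obtain x where x: "x \<in> F u" "y = monomial S X s \<odot>\<^bsub>M\<^esub> x" by blast
          then consider "x \<in> ?B (exponent_degree ds u + b)" |
            u' where "x = ?w u'" "u' \<in> exponents ds (exponent_degree ds u)" "u' < u"
            unfolding F_def by blast
          then show "y \<in> F v"
          proof cases
            case 1
            have "y \<in> ?B (exponent_degree ds u + b + exponent_degree ds s)"
              unfolding x(2) using len u by (intro monomial_multiples_mult[OF G] 1) auto
            moreover have "exponent_degree ds u + b + exponent_degree ds s = exponent_degree ds v + b"
              unfolding deg by (auto simp: fun_eq_iff)
            ultimately show ?thesis unfolding F_def by simp
          next
            case 2
            then have u': "length u' = length ds" "exponent_degree ds u' = exponent_degree ds u"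
              by (auto simp: exponents_def)
            have "y = ?w (map2 (+) u' s)" using ws u' x 2 by simp
            moreover have "map2 (+) u' s < v" unfolding v using lex_add_strict_mono[of u' u s] u' u len 2 by simp
            moreover have "map2 (+) u' s \<in> exponents ds (exponent_degree ds v)"
              using u' u len by (simp add: exponents_def deg exponent_degree_add)
            ultimately show ?thesis unfolding F_def by blast
          qed
        qed
      qed
    qed (use F w gc monomial_carrier[of X] in \<open>auto simp: Mod.smult_r_distr smult_W_linear\<close>)
    then show ?thesis using ws u v by (simp add: f)
  qed
  have sum_exp: "expandable (\<lambda>n. int (\<Sum>u\<in>exponents ds n. f u))"
    by (rule expandable_sum_antitone) (use anti in auto)
  have span: "monomial_multiples (p # G) n = ?B n \<union> ?w ` {u. length u = length X \<and> exponent_degree ds u + b = n}" for n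
    unfolding monomial_multiples_def p by (auto simp: add.commute)
  have Bz: "submodule {\<zero>\<^bsub>M\<^esub>} A W" using W.submodule_zero by simp
  have len_eq: "len {\<zero>\<^bsub>M\<^esub>} (submodule_span A W (monomial_multiples (p # G) n)) =
      len {\<zero>\<^bsub>M\<^esub>} (submodule_span A W (?B n)) +
      (\<Sum>u | length u = length X \<and> exponent_degree ds u + b = n. enat (f u))" for n
  proof -
    let ?U = "{u. length u = length X \<and> exponent_degree ds u + b = n}"
    have "?U \<subseteq> exponents ds (n - b)" by (force simp: exponents_def fun_eq_iff)
    then have finU: "finite ?U" using finite_exponents finite_subset by blast
    have Bn: "?B n \<subseteq> carrier W" and BU: "?B n \<union> ?w ` ?U \<subseteq> carrier W" using B w by auto
    have "len {\<zero>\<^bsub>M\<^esub>} (submodule_span A W (?B n \<union> ?w ` ?U)) =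
      len {\<zero>\<^bsub>M\<^esub>} (submodule_span A W (?B n)) +
      len (submodule_span A W (?B n)) (submodule_span A W (?B n \<union> ?w ` ?U))"
    proof (rule W.relative_length_add[OF Bz])
      show "{\<zero>\<^bsub>M\<^esub>} \<subseteq> submodule_span A W (?B n)"
        using W.submoduleD(2)[OF W.submodule_span_props(1)[OF Bn]] by simp
    qed (auto intro!: W.submodule_span_props(1) Bn BU W.submodule_span_mono)
    also have "len (submodule_span A W (?B n)) (submodule_span A W (?B n \<union> ?w ` ?U)) =
      (\<Sum>u\<in>?U. W.length_step (?B n \<union> ?w ` {v \<in> ?U. v < u}) (?w u))"
      by (rule W.relative_length_filtration[OF finU Bn]) (use w in simp)
    also have "\<dots> = (\<Sum>u\<in>?U. enat (f u))"
    proof (rule sum.cong)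
      fix u assume u: "u \<in> ?U"
      have "{v \<in> ?U. v < u} = {v \<in> exponents ds (exponent_degree ds u). v < u}"
      proof -
        have n: "n = exponent_degree ds u + b" using u by simp
        show ?thesis unfolding n using u by (auto simp: exponents_def)
      qed
      then have "?B n \<union> ?w ` {v \<in> ?U. v < u} = F u" using u unfolding F_def by auto
      then show "W.length_step (?B n \<union> ?w ` {v \<in> ?U. v < u}) (?w u) = enat (f u)" by (simp only: f)
    qed simp
    finally show ?thesis unfolding span .
  qed
  have IH: "\<And>n. len {\<zero>\<^bsub>M\<^esub>} (submodule_span A W (?B n)) \<noteq> \<infinity>"
    "expandable (\<lambda>n. int (the_enat (len {\<zero>\<^bsub>M\<^esub>} (submodule_span A W (?B n)))))"
    using Cons.IH G by auto
  have enat_sum: "(\<Sum>u\<in>U. enat (f u)) = enat (\<Sum>u\<in>U. f u)" for U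
    by (induction U rule: infinite_finite_induct) (auto simp: zero_enat_def)
  have total: "len {\<zero>\<^bsub>M\<^esub>} (submodule_span A W (monomial_multiples (p # G) n)) =
    enat (the_enat (len {\<zero>\<^bsub>M\<^esub>} (submodule_span A W (?B n))) +
      (\<Sum>u | length u = length X \<and> exponent_degree ds u + b = n. f u))" for n
    unfolding len_eq enat_sum using IH(1)[of n] by auto
  have "expandable (\<lambda>n. int (the_enat (len {\<zero>\<^bsub>M\<^esub>} (submodule_span A W (?B n)))) +
      int (\<Sum>u\<in>exponents ds (n - b). f u))"
    by (rule expandable_add[OF IH(2) expandable_diff[OF sum_exp]])
  moreover have "for_large (\<lambda>n. int (the_enat (len {\<zero>\<^bsub>M\<^esub>} (submodule_span A W (?B n)))) +
      int (\<Sum>u\<in>exponents ds (n - b). f u) =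
      int (the_enat (len {\<zero>\<^bsub>M\<^esub>} (submodule_span A W (monomial_multiples (p # G) n)))))"
    using for_large_ge[of b]
  proof (rule for_large_mono)
    fix n assume n: "\<forall>i. b i \<le> n i"
    have "x + b = n \<longleftrightarrow> x = n - b" for x
    proof
      show "x = n - b" if "x + b = n" using that by auto
      show "x + b = n" if "x = n - b" unfolding that using n by (simp add: fun_eq_iff)
    qed
    then have "exponents ds (n - b) = {u. length u = length X \<and> exponent_degree ds u + b = n}"
      by (auto simp: exponents_def)
    then show "int (the_enat (len {\<zero>\<^bsub>M\<^esub>} (submodule_span A W (?B n)))) +
      int (\<Sum>u\<in>exponents ds (n - b). f u) =
      int (the_enat (len {\<zero>\<^bsub>M\<^esub>} (submodule_span A W (monomial_multiples (p # G) n))))"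
      unfolding total by simp
  qed
  ultimately have "expandable (\<lambda>n. int (the_enat (len {\<zero>\<^bsub>M\<^esub>} (submodule_span A W (monomial_multiples (p # G) n)))))"
    by (rule expandable_cong)
  moreover have "len {\<zero>\<^bsub>M\<^esub>} (submodule_span A W (monomial_multiples (p # G) n)) \<noteq> \<infinity>" for n
    unfolding total by simp
  ultimately show ?case by blast
qed

text \<open>The elements whose components all lie in the spans of the monomial multiples of the homogeneous
  components of the generators form an \<open>S\<close>-submodule, because the algebra generators map these spans into one another.
  It contains the generators, so it is \<open>M\<close>.\<close>

lemma piece_eq_monomial_span:
  obtains G where "\<And>g b. (g, b) \<in> set G \<Longrightarrow> g \<in> Mg b"
    and "\<And>n. Mg n = submodule_span A W (monomial_multiples G n)"
proof -
  obtain F where F: "finite F" "F \<subseteq> carrier M" "submodule_span S M F = carrier M"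
    using Mod.M_fg unfolding fg_module_def by blast
  let ?G = "\<Union>f\<in>F. (\<lambda>n. (component M Mg f n, n)) ` {n. component M Mg f n \<noteq> \<zero>\<^bsub>M\<^esub>}"
  have "finite ?G" using F Mgr.component_props(2) by auto
  from finite_list[OF this] obtain G where setG: "set G = ?G" by (rule exE)
  have G: "g \<in> Mg b" if "(g, b) \<in> set G" for g b
    using that F Mgr.component_props(1) unfolding setG by auto
  define L where "L n = submodule_span A W (monomial_multiples G n)" for n
  have mc: "monomial_multiples G n \<subseteq> carrier W" for n
    using monomial_multiples_carrier[of G] G by simp
  have L: "submodule (L n) A W" "monomial_multiples G n \<subseteq> L n" for n
    unfolding L_def by (rule W.submodule_span_props[OF mc])+
  note LD = L(1)[unfolded W_submodule_iff]
  have Lx: "x \<odot>\<^bsub>M\<^esub> m \<in> L (n + unit_vec i)" if x: "(x, i) \<in> set X" and m: "m \<in> L n" for x i m n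
  proof -
    have xc: "x \<in> carrier S" using x X_carrier by blast
    have "submodule {m \<in> carrier M. x \<odot>\<^bsub>M\<^esub> m \<in> L (n + unit_vec i)} A W"
      unfolding W_submodule_iff using LD[of "n + unit_vec i"] xc
      by (auto simp: Mod.smult_r_distr smult_W_linear)
    moreover have "monomial_multiples G n \<subseteq> {m \<in> carrier M. x \<odot>\<^bsub>M\<^esub> m \<in> L (n + unit_vec i)}"
    proof
      fix m assume "m \<in> monomial_multiples G n"
      then obtain g b u where m: "m = monomial S X u \<odot>\<^bsub>M\<^esub> g" "(g, b) \<in> set G" "length u = length X"
        "b + exponent_degree ds u = n" unfolding monomial_multiples_def by blast
      have gc: "g \<in> carrier M" using G m Mgr.piece_carrier by blast
      obtain u' where u': "length u' = length X" "monomial S X u' = x \<otimes>\<^bsub>S\<^esub> monomial S X u"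
        "exponent_degree ds u' = exponent_degree ds u + unit_vec i"
        using monomial_step[OF x order_refl m(3)] by blast
      have "x \<odot>\<^bsub>M\<^esub> m = monomial S X u' \<odot>\<^bsub>M\<^esub> g"
        using m u' xc gc monomial_carrier[of X u] by (simp add: Mod.smult_assoc1)
      moreover have "b + exponent_degree ds u' = n + unit_vec i"
        using u' m(4) by (auto simp: fun_eq_iff)
      ultimately have "x \<odot>\<^bsub>M\<^esub> m \<in> monomial_multiples G (n + unit_vec i)"
        unfolding monomial_multiples_def using u' m by blast
      then show "m \<in> {m \<in> carrier M. x \<odot>\<^bsub>M\<^esub> m \<in> L (n + unit_vec i)}"
        using L(2) m gc monomial_carrier[of X u] by auto
    qed
    ultimately show ?thesis using W.submodule_span_least m unfolding L_def by blast
  qed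
  define D where "D = {m \<in> carrier M. \<forall>n. component M Mg m n \<in> L n}"
  have D0: "\<zero>\<^bsub>M\<^esub> \<in> D" unfolding D_def using LD by (simp add: Mgr.component_zero)
  have Dadd: "x \<oplus>\<^bsub>M\<^esub> y \<in> D" if "x \<in> D" "y \<in> D" for x y
    using that LD unfolding D_def by (simp add: Mgr.component_add)
  have Dscal: "(a \<odot>\<^bsub>S\<^esub> \<one>\<^bsub>S\<^esub>) \<odot>\<^bsub>M\<^esub> m \<in> D" if a: "a \<in> carrier A" and m: "m \<in> D" for a m
  proof -
    note h = scalar_degree_zero[OF a]
    have "n - (\<lambda>_. 0) = n" "(\<lambda>_. 0) \<le> n" for n :: "'d \<Rightarrow> nat" by (auto simp: fun_eq_iff le_fun_def)
    then have "component M Mg ((a \<odot>\<^bsub>S\<^esub> \<one>\<^bsub>S\<^esub>) \<odot>\<^bsub>M\<^esub> m) n = (a \<odot>\<^bsub>S\<^esub> \<one>\<^bsub>S\<^esub>) \<odot>\<^bsub>M\<^esub> component M Mg m n" for n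
      using m by (simp add: component_smult[OF h] D_def)
    then show ?thesis using m a LD Sgr.piece_carrier[OF h] unfolding D_def by simp
  qed
  have Ds: "s \<odot>\<^bsub>M\<^esub> m \<in> D" if s: "s \<in> carrier S" and m: "m \<in> D" for s m
  proof -
    have "s \<in> generate_ring S ((\<lambda>a. a \<odot>\<^bsub>S\<^esub> \<one>\<^bsub>S\<^esub>) ` carrier A \<union> fst ` set X)" using s X_gen by blast
    then have "s \<in> carrier S \<and> (\<forall>m\<in>D. s \<odot>\<^bsub>M\<^esub> m \<in> D)"
    proof induction
      case one
      then show ?case by (simp add: D_def)
    next
      case (incl h)
      then consider a where "a \<in> carrier A" "h = a \<odot>\<^bsub>S\<^esub> \<one>\<^bsub>S\<^esub>" | i where "(h, i) \<in> set X" by force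
      then show ?case
      proof cases
        case 1
        then show ?thesis using Dscal by simp
      next
        case 2
        then have h: "h \<in> Sg (unit_vec i)" "h \<in> carrier S" using X X_carrier by auto
        have "component M Mg (h \<odot>\<^bsub>M\<^esub> m) n \<in> L n" if m: "m \<in> D" for m n
        proof (cases "unit_vec i \<le> n")
          case True
          then have "(n - unit_vec i) + unit_vec i = n" by (auto simp: fun_eq_iff le_fun_def)
          moreover have "component M Mg m (n - unit_vec i) \<in> L (n - unit_vec i)" using m by (simp add: D_def)
          ultimately have "h \<odot>\<^bsub>M\<^esub> component M Mg m (n - unit_vec i) \<in> L n" using Lx[OF 2] by metis
          then show ?thesis using True m by (simp add: component_smult[OF h(1)] D_def)
        next
          case False
          then show ?thesis using m LD by (simp add: component_smult[OF h(1)] D_def)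
        qed
        then show ?thesis using h by (auto simp: D_def)
      qed
    next
      case (a_inv h)
      have "\<ominus>\<^bsub>M\<^esub> m = ((\<ominus>\<^bsub>A\<^esub> \<one>\<^bsub>A\<^esub>) \<odot>\<^bsub>S\<^esub> \<one>\<^bsub>S\<^esub>) \<odot>\<^bsub>M\<^esub> m" if "m \<in> carrier M" for m
        using that by (simp add: Alg.smult_l_minus Mod.smult_l_minus)
      then have "\<ominus>\<^bsub>M\<^esub> m \<in> D" if "m \<in> D" for m
        using that Dscal[of "\<ominus>\<^bsub>A\<^esub> \<one>\<^bsub>A\<^esub>" m] by (simp add: D_def)
      then show ?case using a_inv by (auto simp: Mod.smult_l_minus D_def)
    next
      case (eng_add h1 h2)
      then show ?case using Dadd by (auto simp: Mod.smult_l_distr D_def)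
    next
      case (eng_mult h1 h2)
      then show ?case by (auto simp: Mod.smult_assoc1 D_def)
    qed
    then show ?thesis using m by blast
  qed
  have "submodule D S M"
    unfolding Mod.submodule_iff using D0 Dadd Ds by (auto simp: D_def)
  moreover have "F \<subseteq> D"
  proof
    fix f assume f: "f \<in> F"
    have "component M Mg f n \<in> L n" for n
    proof (cases "component M Mg f n = \<zero>\<^bsub>M\<^esub>")
      case True
      then show ?thesis using LD by simp
    next
      case False
      then have g: "(component M Mg f n, n) \<in> set G" using f unfolding setG by blast
      let ?u = "replicate (length X) 0"
      have mono1: "monomial S Y (replicate (length Y) 0) = \<one>\<^bsub>S\<^esub>" if "set Y \<subseteq> set X" for Y
        using that
      proof (induction Y)
        case (Cons y Y)
        then show ?case using X_carrier by (cases y) auto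
      qed simp
      have deg0: "exponent_degree es (replicate k 0) = (\<lambda>_. 0)" for es :: "'d list" and k
        by (induction es arbitrary: k) (case_tac k; auto)+
      have "component M Mg f n = monomial S X ?u \<odot>\<^bsub>M\<^esub> component M Mg f n"
        using mono1[of X] Mgr.piece_carrier[OF G[OF g]] by simp
      moreover have "n + exponent_degree ds ?u = n" by (auto simp: deg0 fun_eq_iff)
      moreover have "length ?u = length X" by simp
      ultimately have "component M Mg f n \<in> monomial_multiples G n"
        unfolding monomial_multiples_def using g by blast
      then show ?thesis using L(2) by blast
    qed
    then show "f \<in> D" using f F(2) by (auto simp: D_def)
  qed
  ultimately have D: "carrier M \<subseteq> D" using F(3) Mod.submodule_span_least by metis
  have "Mg n = L n" for n
  proof
    show "Mg n \<subseteq> L n"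
    proof
      fix m assume m: "m \<in> Mg n"
      then have "component M Mg m n \<in> L n" using D Mgr.piece_carrier[OF m] by (auto simp: D_def)
      then show "m \<in> L n" using Mgr.component_homogeneous[OF m] by simp
    qed
    show "L n \<subseteq> Mg n" unfolding L_def
    proof (rule W.submodule_span_least[OF piece_submodule])
      show "monomial_multiples G n \<subseteq> Mg n"
        unfolding monomial_multiples_def using monomial_smult_degree[OF order_refl _ G] by blast
    qed
  qed
  then show thesis using that[of G] G unfolding L_def by blast
qed

end

theorem hilbert_function_expandable:
  "len {\<zero>\<^bsub>M\<^esub>} (Mg n) \<noteq> \<infinity>" "expandable (\<lambda>n. int (the_enat (len {\<zero>\<^bsub>M\<^esub>} (Mg n))))"
proof -
  obtain X where X: "\<And>x i. (x, i) \<in> set X \<Longrightarrow> x \<in> Sg (unit_vec i)"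
    "carrier S \<subseteq> generate_ring S ((\<lambda>a. a \<odot>\<^bsub>S\<^esub> \<one>\<^bsub>S\<^esub>) ` carrier A \<union> fst ` set X)"
    using finite_linear_generators by blast
  obtain G where G: "\<And>g b. (g, b) \<in> set G \<Longrightarrow> g \<in> Mg b"
    "\<And>n. Mg n = submodule_span A W (monomial_multiples X G n)"
    using piece_eq_monomial_span[OF X] by blast
  show "len {\<zero>\<^bsub>M\<^esub>} (Mg n) \<noteq> \<infinity>" "expandable (\<lambda>n. int (the_enat (len {\<zero>\<^bsub>M\<^esub>} (Mg n))))"
    using monomial_span_expandable[OF X G(1)] unfolding G(2) by auto
qed

end

section \<open>Filter-regular elements and differences of Hilbert functions\<close>

context module
begin

text \<open>If \<open>P\<close> is the full preimage of \<open>P'\<close> in \<open>Q\<close>, then \<open>Q / P\<close> is isomorphic to the image of \<open>Q\<close> in \<open>M / P'\<close>.\<close>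

lemma relative_length_image:
  assumes P: "submodule P R M" and Q: "submodule Q R M" and P': "submodule P' R M"
    and phi: "\<And>x. x \<in> carrier M \<Longrightarrow> phi x \<in> carrier M"
      "\<And>x y. \<lbrakk>x \<in> carrier M; y \<in> carrier M\<rbrakk> \<Longrightarrow> phi (x \<oplus>\<^bsub>M\<^esub> y) = phi x \<oplus>\<^bsub>M\<^esub> phi y"
      "\<And>a x. \<lbrakk>a \<in> carrier R; x \<in> carrier M\<rbrakk> \<Longrightarrow> phi (a \<odot>\<^bsub>M\<^esub> x) = a \<odot>\<^bsub>M\<^esub> phi x"
    and pre: "\<And>x. x \<in> Q \<Longrightarrow> phi x \<in> P' \<longleftrightarrow> x \<in> P" and PQ: "P \<subseteq> Q"
  shows "relative_length R M P Q = relative_length R M P' (P' <+>\<^bsub>M\<^esub> phi ` Q)"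
proof -
  have phi0: "phi \<zero>\<^bsub>M\<^esub> = \<zero>\<^bsub>M\<^esub>"
    using phi(3)[of \<zero> "\<zero>\<^bsub>M\<^esub>"] phi(1)[of "\<zero>\<^bsub>M\<^esub>"] by simp
  have im: "submodule (phi ` J) R M" if J: "submodule J R M" for J
  proof -
    have "\<zero>\<^bsub>M\<^esub> \<in> phi ` J" using phi0 submoduleD(2)[OF J] by force
    moreover have "phi x \<oplus>\<^bsub>M\<^esub> phi y \<in> phi ` J" if "x \<in> J" "y \<in> J" for x y
      using that phi(2)[of x y] submoduleD(1,3)[OF J] by (metis imageI)
    moreover have "a \<odot>\<^bsub>M\<^esub> phi x \<in> phi ` J" if "x \<in> J" "a \<in> carrier R" for x a
      using that phi(3)[of a x] submoduleD(1,4)[OF J] by (metis imageI)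
    ultimately show ?thesis using phi(1) submoduleD(1)[OF J] unfolding submodule_iff by auto
  qed
  have preimage: "submodule {q \<in> Q. phi q \<in> J} R M" if "submodule J R M" for J
    using submoduleD[OF that] submoduleD[OF Q] unfolding submodule_iff by (auto simp: phi phi0)
  show ?thesis
  proof (rule antisym)
    show "relative_length R M P Q \<le> relative_length R M P' (P' <+>\<^bsub>M\<^esub> phi ` Q)"
      unfolding relative_length_def
    proof (rule chain_length_mono[where f = "\<lambda>J. P' <+>\<^bsub>M\<^esub> phi ` J"], goal_cases)
      case (1 J)
      then have J: "submodule J R M" "J \<subseteq> Q" by auto
      have "P' <+>\<^bsub>M\<^esub> phi ` J \<subseteq> P' <+>\<^bsub>M\<^esub> phi ` Q" using J(2) unfolding subset_iff mem_set_add by blast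
      then show ?case using submodule_set_add[OF P' im[OF J(1)]] set_add_upper(1)[OF P' im[OF J(1)]] by blast
    next
      case (2 J J')
      then have J: "submodule J R M" "J \<subseteq> Q" "P \<subseteq> J" "submodule J' R M" "J' \<subseteq> Q" by auto
      obtain x where x: "x \<in> J'" "x \<notin> J" using 2 by blast
      have "phi x \<in> P' <+>\<^bsub>M\<^esub> phi ` J'" using set_add_upper(2)[OF P' im[OF J(4)]] x by blast
      moreover have "phi x \<notin> P' <+>\<^bsub>M\<^esub> phi ` J"
      proof
        assume "phi x \<in> P' <+>\<^bsub>M\<^esub> phi ` J"
        then obtain p y where py: "p \<in> P'" "y \<in> J" "phi x = p \<oplus>\<^bsub>M\<^esub> phi y" by (auto simp: mem_set_add)
        have c: "x \<in> carrier M" "y \<in> carrier M" "\<ominus>\<^bsub>M\<^esub> y \<in> carrier M" "p \<in> carrier M"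
          using x py submoduleD(1)[OF J(4)] submoduleD(1)[OF J(1)] submoduleD(1)[OF P'] by auto
        have "phi (y \<oplus>\<^bsub>M\<^esub> \<ominus>\<^bsub>M\<^esub> y) = \<zero>\<^bsub>M\<^esub>" using c phi0 by (simp add: M.r_neg)
        then have neg: "phi y \<oplus>\<^bsub>M\<^esub> phi (\<ominus>\<^bsub>M\<^esub> y) = \<zero>\<^bsub>M\<^esub>" using c phi(2) by simp
        have "phi (x \<oplus>\<^bsub>M\<^esub> \<ominus>\<^bsub>M\<^esub> y) = p" using c neg phi by (simp add: py(3) M.a_assoc)
        moreover have "\<ominus>\<^bsub>M\<^esub> y \<in> J" using submoduleD(5)[OF J(1)] py by blast
        moreover have "x \<oplus>\<^bsub>M\<^esub> \<ominus>\<^bsub>M\<^esub> y \<in> Q" using submoduleD(3)[OF Q] x J calculation(2) by blast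
        ultimately have "x \<oplus>\<^bsub>M\<^esub> \<ominus>\<^bsub>M\<^esub> y \<in> J" "\<ominus>\<^bsub>M\<^esub> y \<in> J" using pre py J by auto
        then have "x \<in> J" using submodule_cancel[OF J(1) c(1)] by blast
        then show False using x by blast
      qed
      moreover have "P' <+>\<^bsub>M\<^esub> phi ` J \<subseteq> P' <+>\<^bsub>M\<^esub> phi ` J'" using 2(3) unfolding subset_iff mem_set_add by blast
      ultimately show ?case by blast
    qed
    show "relative_length R M P' (P' <+>\<^bsub>M\<^esub> phi ` Q) \<le> relative_length R M P Q"
      unfolding relative_length_def
    proof (rule chain_length_mono[where f = "\<lambda>J. {q \<in> Q. phi q \<in> J}"], goal_cases)
      case (1 J)
      then show ?case using preimage pre PQ by auto
    next
      case (2 J J')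
      then have J: "submodule J R M" "P' \<subseteq> J" "submodule J' R M" "J' \<subseteq> P' <+>\<^bsub>M\<^esub> phi ` Q" "P' \<subseteq> J'" by auto
      obtain x where x: "x \<in> J'" "x \<notin> J" using 2 by blast
      then have "x \<in> P' <+>\<^bsub>M\<^esub> phi ` Q" using J by blast
      then obtain p q where pq: "p \<in> P'" "q \<in> Q" "x = p \<oplus>\<^bsub>M\<^esub> phi q" by (auto simp: mem_set_add)
      have c: "p \<in> carrier M" "phi q \<in> carrier M" using pq submoduleD(1)[OF P'] submoduleD(1)[OF Q] phi(1) by auto
      have "phi q \<notin> J" using x pq J submoduleD(3)[OF J(1)] by blast
      moreover have "phi q \<in> J'"
      proof (rule submodule_cancel[OF J(3) c(2)])
        show "p \<in> J'" using pq J by blast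
        show "phi q \<oplus>\<^bsub>M\<^esub> p \<in> J'" using x pq c M.a_comm by simp
      qed
      ultimately show ?case using 2(3) pq by blast
    qed
  qed
qed

text \<open>The ring elements that carry \<open>M\<close> into the span on the right form an ideal.\<close>

lemma seq_submodule_eq:
  assumes "set xs \<subseteq> carrier R"
  shows "seq_submodule R M xs = submodule_span R M {x \<odot>\<^bsub>M\<^esub> m | x m. x \<in> set xs \<and> m \<in> carrier M}"
    (is "_ = submodule_span R M ?F")
proof
  have F: "?F \<subseteq> carrier M" using assms by auto
  let ?N = "submodule_span R M ?F"
  note N = submodule_span_props[OF F]
  let ?C = "{a \<in> carrier R. \<forall>m\<in>carrier M. a \<odot>\<^bsub>M\<^esub> m \<in> ?N}"
  have C: "ideal ?C R"
    unfolding R.ideal_iff using submoduleD[OF N(1)]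
    by (auto simp: smult_l_distr smult_assoc1)
  have "genideal R (set xs) \<subseteq> ?C"
    by (rule R.genideal_minimal[OF C]) (use assms N(2) in auto)
  then show "seq_submodule R M xs \<subseteq> ?N"
    unfolding seq_submodule_def by (intro submodule_span_least[OF N(1)]) auto
  show "?N \<subseteq> seq_submodule R M xs"
    unfolding seq_submodule_def
    by (rule submodule_span_mono) (use R.genideal_self[OF assms] in blast)
qed

lemma seq_submodule_submodule:
  assumes "set xs \<subseteq> carrier R"
  shows "submodule (seq_submodule R M xs) R M"
  unfolding seq_submodule_eq[OF assms] by (rule submodule_span_props) (use assms in auto)

lemma seq_submodule_Nil: "seq_submodule R M [] = {\<zero>\<^bsub>M\<^esub>}"
proof -
  have "seq_submodule R M [] \<subseteq> {\<zero>\<^bsub>M\<^esub>}"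
    unfolding seq_submodule_eq[of "[]", simplified] by (rule submodule_span_least[OF submodule_zero]) auto
  then show ?thesis using submoduleD(2)[OF seq_submodule_submodule[of "[]"]] by auto
qed

lemma submodule_multiples:
  assumes "x \<in> carrier R"
  shows "submodule ((\<lambda>m. x \<odot>\<^bsub>M\<^esub> m) ` carrier M) R M"
proof -
  have "\<zero>\<^bsub>M\<^esub> \<in> (\<lambda>m. x \<odot>\<^bsub>M\<^esub> m) ` carrier M"
    using assms by (intro image_eqI[of _ _ "\<zero>\<^bsub>M\<^esub>"]) auto
  moreover have "a \<odot>\<^bsub>M\<^esub> (x \<odot>\<^bsub>M\<^esub> m) = x \<odot>\<^bsub>M\<^esub> (a \<odot>\<^bsub>M\<^esub> m)" if "a \<in> carrier R" "m \<in> carrier M" for a m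
    using assms that by (simp add: smult_assoc1[symmetric] R.m_comm)
  ultimately show ?thesis
    unfolding submodule_iff using assms by (auto simp: smult_r_distr[symmetric])
qed

text \<open>With this description, \<open>M/(x\<^sub>1,\<dots>,x\<^sub>t)M\<close> is handled by adding one multiple \<open>x\<^sub>i M\<close> at a time inside \<open>M\<close>, without iterated
  quotients.\<close>

lemma seq_submodule_snoc:
  assumes "set xs \<subseteq> carrier R" "x \<in> carrier R"
  shows "seq_submodule R M (xs @ [x]) = seq_submodule R M xs <+>\<^bsub>M\<^esub> (\<lambda>m. x \<odot>\<^bsub>M\<^esub> m) ` carrier M"
    (is "_ = ?N <+>\<^bsub>M\<^esub> ?X")
proof
  have s: "set (xs @ [x]) \<subseteq> carrier R" using assms by auto
  note N = seq_submodule_submodule[OF assms(1)] and X = submodule_multiples[OF assms(2)]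
    and L = seq_submodule_submodule[OF s]
  note up = set_add_upper[OF N X]
  have F: "{y \<odot>\<^bsub>M\<^esub> m | y m. y \<in> set xs \<and> m \<in> carrier M} \<subseteq> carrier M"
    "{y \<odot>\<^bsub>M\<^esub> m | y m. y \<in> set (xs @ [x]) \<and> m \<in> carrier M} \<subseteq> carrier M" using assms by auto
  have "{y \<odot>\<^bsub>M\<^esub> m | y m. y \<in> set xs \<and> m \<in> carrier M} \<subseteq> ?N"
    unfolding seq_submodule_eq[OF assms(1)] by (rule submodule_span_props(2)[OF F(1)])
  then have "{y \<odot>\<^bsub>M\<^esub> m | y m. y \<in> set (xs @ [x]) \<and> m \<in> carrier M} \<subseteq> ?N <+>\<^bsub>M\<^esub> ?X"
    using up by auto
  then show "seq_submodule R M (xs @ [x]) \<subseteq> ?N <+>\<^bsub>M\<^esub> ?X"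
    unfolding seq_submodule_eq[OF s] by (intro submodule_span_least submodule_set_add[OF N X])
  show "?N <+>\<^bsub>M\<^esub> ?X \<subseteq> seq_submodule R M (xs @ [x])"
  proof (rule set_add_least[OF L])
    show "?N \<subseteq> seq_submodule R M (xs @ [x])"
      unfolding seq_submodule_eq[OF assms(1)] seq_submodule_eq[OF s] by (rule submodule_span_mono) auto
    show "?X \<subseteq> seq_submodule R M (xs @ [x])"
      unfolding seq_submodule_eq[OF s] using submodule_span_props(2)[OF F(2)] by auto
  qed
qed

lemma coset_eq_iff:
  assumes N: "submodule N R M" and x: "x \<in> carrier M"
  shows "N +>\<^bsub>M\<^esub> x = N \<longleftrightarrow> x \<in> N"
proof -
  interpret abelian_subgroup N M
    by (rule abelian_subgroupI3)
      (use N M.abelian_group_axioms in \<open>auto simp: additive_subgroup_def submodule_def\<close>)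
  show ?thesis using a_rcos_const[of x] a_rcos_self[OF x] by auto
qed

lemma quot_module_add:
  assumes N: "submodule N R M" and x: "x \<in> carrier M" "y \<in> carrier M"
  shows "(N +>\<^bsub>M\<^esub> x) <+>\<^bsub>M\<^esub> (N +>\<^bsub>M\<^esub> y) = N +>\<^bsub>M\<^esub> (x \<oplus>\<^bsub>M\<^esub> y)"
proof -
  interpret abelian_subgroup N M
    by (rule abelian_subgroupI3)
      (use N M.abelian_group_axioms in \<open>auto simp: additive_subgroup_def submodule_def\<close>)
  show ?thesis by (rule a_rcos_sum[OF x])
qed

lemma quot_module_smult:
  assumes N: "submodule N R M" and x: "x \<in> carrier M" and a: "a \<in> carrier R"
  shows "a \<odot>\<^bsub>quot_module M N\<^esub> (N +>\<^bsub>M\<^esub> x) = N +>\<^bsub>M\<^esub> (a \<odot>\<^bsub>M\<^esub> x)"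
proof -
  note D = submoduleD[OF N]
  interpret abelian_subgroup N M
    by (rule abelian_subgroupI3)
      (use N M.abelian_group_axioms in \<open>auto simp: additive_subgroup_def submodule_def\<close>)
  have const: "N +>\<^bsub>M\<^esub> (a \<odot>\<^bsub>M\<^esub> z) = N +>\<^bsub>M\<^esub> (a \<odot>\<^bsub>M\<^esub> x)" if z: "z \<in> N +>\<^bsub>M\<^esub> x" for z
  proof -
    obtain y where y: "y \<in> N" "z = y \<oplus>\<^bsub>M\<^esub> x" using z by (auto simp: a_r_coset_def')
    have "a \<odot>\<^bsub>M\<^esub> z = a \<odot>\<^bsub>M\<^esub> y \<oplus>\<^bsub>M\<^esub> a \<odot>\<^bsub>M\<^esub> x" using y x a D(1) by (simp add: smult_r_distr)
    moreover have "a \<odot>\<^bsub>M\<^esub> y \<in> N" using D(4) a y by blast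
    ultimately have "a \<odot>\<^bsub>M\<^esub> z \<in> N +>\<^bsub>M\<^esub> (a \<odot>\<^bsub>M\<^esub> x)" by (auto simp: a_r_coset_def')
    then show ?thesis using a_repr_independence'[of "a \<odot>\<^bsub>M\<^esub> z" "a \<odot>\<^bsub>M\<^esub> x"] x a by simp
  qed
  have "a \<odot>\<^bsub>quot_module M N\<^esub> (N +>\<^bsub>M\<^esub> x) = (\<Union>z\<in>N +>\<^bsub>M\<^esub> x. N +>\<^bsub>M\<^esub> (a \<odot>\<^bsub>M\<^esub> z))"
    by (simp add: quot_module_def)
  also have "\<dots> = (\<Union>z\<in>N +>\<^bsub>M\<^esub> x. N +>\<^bsub>M\<^esub> (a \<odot>\<^bsub>M\<^esub> x))"
    by (rule SUP_cong[OF refl const])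
  also have "\<dots> = N +>\<^bsub>M\<^esub> (a \<odot>\<^bsub>M\<^esub> x)"
    by (rule UN_constant_eq[OF a_rcos_self[OF x]]) simp
  finally show ?thesis .
qed

end

lemma quot_module_simps [simp]:
  "carrier (quot_module M N) = a_rcosets\<^bsub>M\<^esub> N"
  "zero (quot_module M N) = N"
  "add (quot_module M N) = set_add M"
  by (simp_all add: quot_module_def)

context graded_module_over_artinian
begin

definition graded_submodule :: "'m set \<Rightarrow> bool" where
  "graded_submodule N \<longleftrightarrow> submodule N S M \<and> (\<forall>m\<in>N. \<forall>n. component M Mg m n \<in> N)"

definition quot_length :: "'m set \<Rightarrow> ('d \<Rightarrow> nat) \<Rightarrow> enat" where
  "quot_length N n = len (N \<inter> Mg n) (Mg n)"

lemma submodule_W: "submodule N S M \<Longrightarrow> submodule N A W"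
  unfolding W_submodule_iff Mod.submodule_iff by auto

lemma submodule_piece: "submodule N S M \<Longrightarrow> submodule (N \<inter> Mg n) A W"
  using W.submodule_Int[OF submodule_W piece_submodule] by simp

lemma quot_length_finite:
  assumes N: "submodule N S M"
  shows "quot_length N n \<noteq> \<infinity>"
proof -
  have z: "submodule {\<zero>\<^bsub>M\<^esub>} A W" using W.submodule_zero by simp
  have "len {\<zero>\<^bsub>M\<^esub>} (Mg n) = len {\<zero>\<^bsub>M\<^esub>} (N \<inter> Mg n) + len (N \<inter> Mg n) (Mg n)"
    by (rule W.relative_length_add[OF z submodule_piece[OF N] piece_submodule])
      (use Mod.submoduleD(2)[OF N] Mgr.piece_zero in auto)
  then show ?thesis using hilbert_function_expandable(1)[of n] unfolding quot_length_def by (metis plus_enat_simps(3))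
qed

lemma module_length_piece: "module_length A (graded_piece S M Mg n) = quot_length {\<zero>\<^bsub>M\<^esub>} n"
proof -
  have "module_length A (graded_piece S M Mg n) =
      len {x \<in> Mg n. x = \<zero>\<^bsub>graded_piece S M Mg n\<^esub>} (Mg n)"
    by (rule W.module_length_image[OF piece_submodule, of "\<lambda>x. x"]) auto
  moreover have "{x \<in> Mg n. x = \<zero>\<^bsub>graded_piece S M Mg n\<^esub>} = {\<zero>\<^bsub>M\<^esub>} \<inter> Mg n" by auto
  ultimately show ?thesis by (simp only: quot_length_def)
qed

lemma module_length_quot_piece:
  assumes N: "submodule N S M"
  shows "module_length A (graded_piece S (quot_module M N) (quot_grading M Mg N) n) = quot_length N n"
proof -
  let ?V = "graded_piece S (quot_module M N) (quot_grading M Mg N) n"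
  have "module_length A ?V = len {x \<in> Mg n. N +>\<^bsub>M\<^esub> x = \<zero>\<^bsub>?V\<^esub>} (Mg n)"
  proof (rule W.module_length_image[OF piece_submodule])
    show "(\<lambda>x. N +>\<^bsub>M\<^esub> x) ` Mg n = carrier ?V" by (simp add: quot_grading_def)
    show "N +>\<^bsub>M\<^esub> \<zero>\<^bsub>W\<^esub> = \<zero>\<^bsub>?V\<^esub>"
      using Mod.coset_eq_iff[OF N] Mod.submoduleD(2)[OF N] by simp
  next
    fix x y assume "x \<in> Mg n" "y \<in> Mg n"
    then show "N +>\<^bsub>M\<^esub> (x \<oplus>\<^bsub>W\<^esub> y) = (N +>\<^bsub>M\<^esub> x) \<oplus>\<^bsub>?V\<^esub> (N +>\<^bsub>M\<^esub> y)"
      using Mod.quot_module_add[OF N] Mgr.piece_carrier by simp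
  next
    fix a x assume "a \<in> carrier A" "x \<in> Mg n"
    then show "N +>\<^bsub>M\<^esub> (a \<odot>\<^bsub>W\<^esub> x) = a \<odot>\<^bsub>?V\<^esub> (N +>\<^bsub>M\<^esub> x)"
      using Mod.quot_module_smult[OF N] Mgr.piece_carrier by simp
  qed
  moreover have "{x \<in> Mg n. N +>\<^bsub>M\<^esub> x = \<zero>\<^bsub>?V\<^esub>} = N \<inter> Mg n"
    using Mod.coset_eq_iff[OF N] Mgr.piece_carrier by auto
  ultimately show ?thesis by (simp only: quot_length_def)
qed

text \<open>Multiplication by \<open>x\<close> gives an exact sequence
  \<open>0 \<rightarrow> (M/N)\<^sub>n\<^sub>-\<^sub>e \<rightarrow> (M/N)\<^sub>n \<rightarrow> (M/(N + xM))\<^sub>n \<rightarrow> 0\<close> once the kernel of \<open>x\<close> vanishes in degree \<open>n - e\<close>.\<close>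

lemma quot_length_filter_regular:
  assumes N: "graded_submodule N" and x: "x \<in> Sg (unit_vec i)"
    and reg: "filter_regular Sg (quot_module M N) (quot_grading M Mg N) x"
  shows "for_large (\<lambda>n. quot_length N n =
    quot_length N (n - unit_vec i) + quot_length (N <+>\<^bsub>M\<^esub> (\<lambda>m. x \<odot>\<^bsub>M\<^esub> m) ` carrier M) n)"
proof -
  have Ns: "submodule N S M" and Nc: "\<And>m n. m \<in> N \<Longrightarrow> component M Mg m n \<in> N"
    using N by (auto simp: graded_submodule_def)
  note ND = Mod.submoduleD[OF Ns]
  have xc: "x \<in> carrier S" using x Sgr.piece_carrier by blast
  let ?X = "(\<lambda>m. x \<odot>\<^bsub>M\<^esub> m) ` carrier M"
  let ?N' = "N <+>\<^bsub>M\<^esub> ?X"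
  have N': "submodule ?N' S M"
    by (rule Mod.submodule_set_add[OF Ns Mod.submodule_multiples[OF xc]])
  note up = Mod.set_add_upper[OF Ns Mod.submodule_multiples[OF xc]]
  have "for_large (\<lambda>n. {Y \<in> carrier (quot_module M N). x \<odot>\<^bsub>quot_module M N\<^esub> Y = N} \<inter> quot_grading M Mg N n = {N})"
    using reg by (simp add: filter_regular_def)
  then have "for_large (\<lambda>n. \<forall>m\<in>Mg n. x \<odot>\<^bsub>M\<^esub> m \<in> N \<longrightarrow> m \<in> N)"
  proof (rule for_large_mono)
    fix n
    assume ker: "{Y \<in> carrier (quot_module M N). x \<odot>\<^bsub>quot_module M N\<^esub> Y = N} \<inter> quot_grading M Mg N n = {N}"
    show "\<forall>m\<in>Mg n. x \<odot>\<^bsub>M\<^esub> m \<in> N \<longrightarrow> m \<in> N"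
    proof (intro ballI impI)
      fix m assume m: "m \<in> Mg n" "x \<odot>\<^bsub>M\<^esub> m \<in> N"
      have mc: "m \<in> carrier M" using m Mgr.piece_carrier by blast
      have "N \<subseteq> carrier M" using ND(1) by blast
      then have "N +>\<^bsub>M\<^esub> m \<in> a_rcosets\<^bsub>M\<^esub> N" using Mod.a_rcosetsI mc by blast
      moreover have "x \<odot>\<^bsub>quot_module M N\<^esub> (N +>\<^bsub>M\<^esub> m) = N"
        using Mod.quot_module_smult[OF Ns mc xc] Mod.coset_eq_iff[OF Ns] m mc xc by simp
      moreover have "N +>\<^bsub>M\<^esub> m \<in> quot_grading M Mg N n" using m by (simp add: quot_grading_def)
      ultimately have "N +>\<^bsub>M\<^esub> m = N" using ker by auto
      then show "m \<in> N" using Mod.coset_eq_iff[OF Ns mc] by simp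
    qed
  qed
  then have large: "for_large (\<lambda>n. (\<forall>m\<in>Mg (n - unit_vec i). x \<odot>\<^bsub>M\<^esub> m \<in> N \<longrightarrow> m \<in> N) \<and> (\<forall>j. unit_vec i j \<le> n j))"
    by (intro for_large_conj for_large_diff for_large_ge)
  show ?thesis
  proof (rule for_large_mono[OF large])
    fix n
    assume n: "(\<forall>m\<in>Mg (n - unit_vec i). x \<odot>\<^bsub>M\<^esub> m \<in> N \<longrightarrow> m \<in> N) \<and> (\<forall>j. unit_vec i j \<le> n j)"
    let ?k = "n - unit_vec i"
    have k: "unit_vec i + ?k = n" using n by (auto simp: fun_eq_iff)
    have le: "unit_vec i \<le> n" using n by (simp add: le_fun_def)
    have xm: "x \<odot>\<^bsub>M\<^esub> m \<in> Mg n" if "m \<in> Mg ?k" for m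
      using Mod.Mg_smult[OF x that] k by simp
    have "len (N \<inter> Mg ?k) (Mg ?k) = len (N \<inter> Mg n) ((N \<inter> Mg n) <+>\<^bsub>W\<^esub> (\<lambda>m. x \<odot>\<^bsub>M\<^esub> m) ` Mg ?k)"
    proof (rule W.relative_length_image[OF submodule_piece[OF Ns] piece_submodule submodule_piece[OF Ns]])
      fix m assume m: "m \<in> Mg ?k"
      then show "x \<odot>\<^bsub>M\<^esub> m \<in> N \<inter> Mg n \<longleftrightarrow> m \<in> N \<inter> Mg ?k"
        using n xm[OF m] ND(4)[OF xc] by blast
    qed (use xc in \<open>auto simp: Mod.smult_r_distr smult_W_linear\<close>)
    also have "(N \<inter> Mg n) <+>\<^bsub>W\<^esub> (\<lambda>m. x \<odot>\<^bsub>M\<^esub> m) ` Mg ?k = ?N' \<inter> Mg n"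
    proof
      show "(N \<inter> Mg n) <+>\<^bsub>W\<^esub> (\<lambda>m. x \<odot>\<^bsub>M\<^esub> m) ` Mg ?k \<subseteq> ?N' \<inter> Mg n"
        using up xm Mgr.piece_carrier by (intro W.set_add_least submodule_piece N') auto
      show "?N' \<inter> Mg n \<subseteq> (N \<inter> Mg n) <+>\<^bsub>W\<^esub> (\<lambda>m. x \<odot>\<^bsub>M\<^esub> m) ` Mg ?k"
      proof
        fix y assume y: "y \<in> ?N' \<inter> Mg n"
        then obtain p m where pm: "p \<in> N" "m \<in> carrier M" "y = p \<oplus>\<^bsub>M\<^esub> x \<odot>\<^bsub>M\<^esub> m"
          unfolding Int_iff Mod.mem_set_add by blast
        have pc: "p \<in> carrier M" using ND(1) pm by blast
        have "y = component M Mg y n" using Mgr.component_homogeneous[of y n] y by simp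
        also have "\<dots> = component M Mg p n \<oplus>\<^bsub>M\<^esub> x \<odot>\<^bsub>M\<^esub> component M Mg m ?k"
          using pm pc xc le by (simp add: Mgr.component_add component_smult[OF x] del: minus_apply)
        finally have "y = component M Mg p n \<oplus>\<^bsub>M\<^esub> x \<odot>\<^bsub>M\<^esub> component M Mg m ?k" .
        moreover have "component M Mg p n \<in> N \<inter> Mg n" using Nc pm Mgr.component_props(1)[OF pc] by blast
        moreover have "component M Mg m ?k \<in> Mg ?k" using Mgr.component_props(1)[OF pm(2)] by blast
        ultimately show "y \<in> (N \<inter> Mg n) <+>\<^bsub>W\<^esub> (\<lambda>m. x \<odot>\<^bsub>M\<^esub> m) ` Mg ?k"
          unfolding W.mem_set_add restrict_scalars_simps by blast
      qed
    qed
    finally have 1: "quot_length N ?k = len (N \<inter> Mg n) (?N' \<inter> Mg n)" by (simp only: quot_length_def)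
    have "len (N \<inter> Mg n) (Mg n) = len (N \<inter> Mg n) (?N' \<inter> Mg n) + len (?N' \<inter> Mg n) (Mg n)"
      by (rule W.relative_length_add[OF submodule_piece[OF Ns] submodule_piece[OF N'] piece_submodule])
        (use up in auto)
    then show "quot_length N n = quot_length N ?k + quot_length ?N' n"
      unfolding 1 by (simp only: quot_length_def)
  qed
qed

lemma graded_submodule_add_multiples:
  assumes N: "graded_submodule N" and x: "x \<in> Sg e"
  shows "graded_submodule (N <+>\<^bsub>M\<^esub> (\<lambda>m. x \<odot>\<^bsub>M\<^esub> m) ` carrier M)"
  unfolding graded_submodule_def
proof (intro conjI ballI allI)
  have Ns: "submodule N S M" using N by (simp add: graded_submodule_def)
  have xc: "x \<in> carrier S" using x Sgr.piece_carrier by blast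
  note X = Mod.submodule_multiples[OF xc]
  show N': "submodule (N <+>\<^bsub>M\<^esub> (\<lambda>m. x \<odot>\<^bsub>M\<^esub> m) ` carrier M) S M" by (rule Mod.submodule_set_add[OF Ns X])
  fix y n assume "y \<in> N <+>\<^bsub>M\<^esub> (\<lambda>m. x \<odot>\<^bsub>M\<^esub> m) ` carrier M"
  then obtain p m where pm: "p \<in> N" "m \<in> carrier M" "y = p \<oplus>\<^bsub>M\<^esub> x \<odot>\<^bsub>M\<^esub> m"
    unfolding Mod.mem_set_add by blast
  have pc: "p \<in> carrier M" using Mod.submoduleD(1)[OF Ns] pm by blast
  have y: "component M Mg y n = component M Mg p n \<oplus>\<^bsub>M\<^esub> component M Mg (x \<odot>\<^bsub>M\<^esub> m) n"
    using pm pc xc by (simp add: Mgr.component_add)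
  have "component M Mg p n \<in> N" using N pm by (simp add: graded_submodule_def)
  moreover have "component M Mg (x \<odot>\<^bsub>M\<^esub> m) n \<in> (\<lambda>m. x \<odot>\<^bsub>M\<^esub> m) ` carrier M"
  proof (cases "e \<le> n")
    case True
    then have "component M Mg (x \<odot>\<^bsub>M\<^esub> m) n = x \<odot>\<^bsub>M\<^esub> component M Mg m (n - e)"
      using component_smult[OF x pm(2), of n] by (simp only: if_True)
    moreover have "component M Mg m (n - e) \<in> carrier M"
      using Mgr.component_props(1)[OF pm(2)] Mgr.piece_carrier by blast
    ultimately show ?thesis by blast
  next
    case False
    then show ?thesis using component_smult[OF x pm(2), of n] Mod.submoduleD(2)[OF X] by (simp only: if_False)
  qed
  ultimately show "component M Mg y n \<in> N <+>\<^bsub>M\<^esub> (\<lambda>m. x \<odot>\<^bsub>M\<^esub> m) ` carrier M"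
    unfolding y Mod.mem_set_add by blast
qed

lemma filter_regular_seq_expansion:
  assumes e: "has_expansion e (\<lambda>n. int (the_enat (quot_length {\<zero>\<^bsub>M\<^esub>} n)))"
    and "filter_regular_seq S Sg M Mg xs" and "list_all2 (\<lambda>x j. x \<in> Sg (unit_vec j)) xs js"
  shows "graded_submodule (seq_submodule S M xs) \<and>
    has_expansion (\<lambda>k. e (k + count_list js)) (\<lambda>n. int (the_enat (quot_length (seq_submodule S M xs) n)))"
  using assms(2,3)
proof (induction xs arbitrary: js rule: rev_induct)
  case Nil
  have "k + count_list js = k" for k :: "'d \<Rightarrow> nat" using Nil by (auto simp: fun_eq_iff)
  moreover have "graded_submodule {\<zero>\<^bsub>M\<^esub>}"
    unfolding graded_submodule_def using Mod.submodule_zero by (simp add: Mgr.component_zero)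
  ultimately show ?case using e by (simp add: Mod.seq_submodule_Nil)
next
  case (snoc x xs)
  obtain js' i where js: "js = js' @ [i]" "list_all2 (\<lambda>x j. x \<in> Sg (unit_vec j)) xs js'" "x \<in> Sg (unit_vec i)"
    using snoc.prems(2) by (auto simp: list_all2_append1 list_all2_Cons1)
  let ?N = "seq_submodule S M xs"
  have reg: "filter_regular_seq S Sg M Mg xs" "filter_regular Sg (quot_module M ?N) (quot_grading M Mg ?N) x"
  proof -
    have *: "filter_regular Sg (quot_module M (seq_submodule S M (take i (xs @ [x]))))
        (quot_grading M Mg (seq_submodule S M (take i (xs @ [x])))) ((xs @ [x]) ! i)" if "i < Suc (length xs)" for i
      using snoc.prems(1) that unfolding filter_regular_seq_def Let_def by simp
    show "filter_regular_seq S Sg M Mg xs"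
      unfolding filter_regular_seq_def Let_def
    proof (intro allI impI)
      fix i assume "i < length xs"
      then show "filter_regular Sg (quot_module M (seq_submodule S M (take i xs)))
        (quot_grading M Mg (seq_submodule S M (take i xs))) (xs ! i)"
        using *[of i] by (simp add: nth_append)
    qed
    show "filter_regular Sg (quot_module M ?N) (quot_grading M Mg ?N) x" using *[of "length xs"] by simp
  qed
  have IH: "graded_submodule ?N"
    "has_expansion (\<lambda>k. e (k + count_list js')) (\<lambda>n. int (the_enat (quot_length ?N n)))"
    using snoc.IH[OF reg(1) js(2)] by blast+
  have xs: "set xs \<subseteq> carrier S"
  proof
    fix y assume "y \<in> set xs"
    then obtain l where "l < length xs" "y = xs ! l" by (auto simp: in_set_conv_nth)
    then have "y \<in> Sg (unit_vec (js' ! l))" using list_all2_nthD[OF js(2)] by simp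
    then show "y \<in> carrier S" by (rule Sgr.piece_carrier)
  qed
  have N': "seq_submodule S M (xs @ [x]) = ?N <+>\<^bsub>M\<^esub> (\<lambda>m. x \<odot>\<^bsub>M\<^esub> m) ` carrier M"
    by (rule Mod.seq_submodule_snoc[OF xs Sgr.piece_carrier[OF js(3)]])
  have gr: "graded_submodule (seq_submodule S M (xs @ [x]))"
    unfolding N' by (rule graded_submodule_add_multiples[OF IH(1) js(3)])
  have diff: "has_expansion (\<lambda>k. e (k + unit_vec i + count_list js'))
    (\<lambda>n. int (the_enat (quot_length ?N n)) - int (the_enat (quot_length ?N (n - unit_vec i))))"
    by (rule has_expansion_diff[OF IH(2)])
  have "has_expansion (\<lambda>k. e (k + unit_vec i + count_list js'))
      (\<lambda>n. int (the_enat (quot_length (seq_submodule S M (xs @ [x])) n)))"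
  proof (rule has_expansion_cong[OF diff], rule for_large_mono[OF quot_length_filter_regular[OF IH(1) js(3) reg(2)]])
    fix n
    assume n: "quot_length ?N n = quot_length ?N (n - unit_vec i) +
      quot_length (?N <+>\<^bsub>M\<^esub> (\<lambda>m. x \<odot>\<^bsub>M\<^esub> m) ` carrier M) n"
    have fin: "quot_length ?N (n - unit_vec i) \<noteq> \<infinity>" "quot_length (seq_submodule S M (xs @ [x])) n \<noteq> \<infinity>"
      using quot_length_finite IH(1) gr unfolding graded_submodule_def by blast+
    obtain a where a: "quot_length ?N (n - unit_vec i) = enat a" using fin(1) by auto
    obtain b where b: "quot_length (seq_submodule S M (xs @ [x])) n = enat b" using fin(2) by auto
    show "int (the_enat (quot_length ?N n)) - int (the_enat (quot_length ?N (n - unit_vec i))) =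
        int (the_enat (quot_length (seq_submodule S M (xs @ [x])) n))"
      using n a b unfolding N'[symmetric] by simp
  qed
  moreover have "k + unit_vec i + count_list js' = k + count_list js" for k :: "'d \<Rightarrow> nat"
    by (auto simp: fun_eq_iff js unit_vec_def)
  ultimately show ?case using gr by (simp only: simp_thms)
qed

end

text \<open>Lengths that are finite in every degree turn the defining condition into an identity of integer functions, where the
  expansion is unique.\<close>

lemma hilbert_coeff_eqI:
  assumes "\<And>n. module_length A (graded_piece S V Vg n) = L n" "\<And>n. L n \<noteq> \<infinity>"
    and e: "has_expansion e (\<lambda>n. int (the_enat (L n)))"
  shows "hilbert_coeff A S V Vg = e"
proof -
  have "(\<exists>l. L n = enat l \<and> int l = c) \<longleftrightarrow> int (the_enat (L n)) = c" for n c
    using assms(2)[of n] by auto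
  then have "is_hilbert_expansion A S V Vg e' \<longleftrightarrow> has_expansion e' (\<lambda>n. int (the_enat (L n)))" for e'
    unfolding is_hilbert_expansion_def has_expansion_def expansion_def binom_basis_def assms(1) by simp
  then show ?thesis
    unfolding hilbert_coeff_def using e has_expansion_unique by blast
qed

text \<open>For a filter-regular sequence of type \<open>h\<close>, the Hilbert polynomial of the quotient is
  the \<open>h\<close>-th iterated difference, which shifts the coefficients by \<open>h\<close>.\<close>

theorem hilbert_coeff_filter_regular_quotient:
  fixes Sg :: "('d::finite \<Rightarrow> nat) \<Rightarrow> 's set"
  assumes "artinian_local_ring A \<mm>"
    and "fg_standard_multigraded_algebra A S Sg"
    and "fg_multigraded_module S Sg M Mg"
    and "filter_regular_seq S Sg M Mg xs" and "seq_of_type Sg xs h"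
  shows "hilbert_coeff A S (quot_module M (seq_submodule S M xs)) (quot_grading M Mg (seq_submodule S M xs)) =
    (\<lambda>k. hilbert_coeff A S M Mg (k + h))"
proof -
  interpret graded_module_over_artinian A \<mm> S Sg M Mg
    by (rule graded_module_over_artinian.intro) (use assms in auto)
  have z: "submodule {\<zero>\<^bsub>M\<^esub>} S M" by (rule Mod.submodule_zero)
  have "quot_length {\<zero>\<^bsub>M\<^esub>} n = len {\<zero>\<^bsub>M\<^esub>} (Mg n)" for n
    unfolding quot_length_def using Mgr.piece_zero[of n] by (simp add: insert_absorb Int_absorb2)
  then obtain e where e: "has_expansion e (\<lambda>n. int (the_enat (quot_length {\<zero>\<^bsub>M\<^esub>} n)))"
    using hilbert_function_expandable(2) unfolding expandable_def by auto
  have M: "hilbert_coeff A S M Mg = e"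
    by (rule hilbert_coeff_eqI[OF module_length_piece quot_length_finite[OF z] e])
  obtain js where js: "list_all2 (\<lambda>x j. x \<in> Sg (unit_vec j)) xs js" "count_list js = h"
    using assms(5) unfolding seq_of_type_def by auto
  have Q: "graded_submodule (seq_submodule S M xs)"
    "has_expansion (\<lambda>k. e (k + h)) (\<lambda>n. int (the_enat (quot_length (seq_submodule S M xs) n)))"
    using filter_regular_seq_expansion[OF e assms(4) js(1)] js(2) by auto
  have s: "submodule (seq_submodule S M xs) S M" using Q(1) by (simp add: graded_submodule_def)
  show ?thesis
    unfolding M by (rule hilbert_coeff_eqI[OF module_length_quot_piece[OF s] quot_length_finite[OF s] Q(2)])
qed

theorem corollary2p11:
  fixes A :: "('a, 'p) ring_scheme" and \<mm> :: "'a set"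
    and S :: "('a, 's, 'q) module_scheme" and Sg :: "('d::finite \<Rightarrow> nat) \<Rightarrow> 's set"
    and M :: "('s, 'm, 'r) module_scheme" and Mg :: "('d \<Rightarrow> nat) \<Rightarrow> 'm set"
    and h k :: "'d \<Rightarrow> nat" and xs ys :: "'s list"
  assumes "artinian_local_ring A \<mm>"
    and "infinite (carrier (A Quot \<mm>))"
    and "fg_standard_multigraded_algebra A S Sg"
    and "fg_multigraded_module S Sg M Mg"
    and "mixed_mult_defined A S M Mg k"
    and "filter_regular_seq S Sg M Mg ys" and "seq_of_type Sg ys h" and "h \<le> k"
    and "filter_regular_seq S Sg M Mg xs" and "seq_of_type Sg xs k"
  shows "let yM = seq_submodule S M ys; xM = seq_submodule S M xs in
    mixed_mult_defined A S (quot_module M yM) (quot_grading M Mg yM) (k - h) \<and>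
    mixed_mult_defined A S (quot_module M xM) (quot_grading M Mg xM) 0 \<and>
    hilbert_coeff A S M Mg k =
      hilbert_coeff A S (quot_module M yM) (quot_grading M Mg yM) (k - h) \<and>
    hilbert_coeff A S (quot_module M yM) (quot_grading M Mg yM) (k - h) =
      hilbert_coeff A S (quot_module M xM) (quot_grading M Mg xM) 0"
proof -
  have above: "hilbert_coeff A S M Mg l = 0" if "k < l" for l
    using assms(5) that by (simp add: mixed_mult_defined_def)
  have kh: "k - h + h = k" using \<open>h \<le> k\<close> by (auto simp: fun_eq_iff le_fun_def)
  have shift: "k < l + h" if "k - h < l" for l
  proof -
    have "k - h + h < l + h" using that by (auto simp: less_fun_def le_fun_def le_diff_conv)
    then show ?thesis by (simp only: kh)
  qed
  have shift0: "k < l + k" if "0 < l" for l :: "'d \<Rightarrow> nat"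
    using that by (auto simp: less_fun_def le_fun_def)
  note y = hilbert_coeff_filter_regular_quotient[OF assms(1,3,4,6,7)]
    and x = hilbert_coeff_filter_regular_quotient[OF assms(1,3,4,9,10)]
  show ?thesis
    unfolding Let_def mixed_mult_defined_def x y using above shift shift0 kh by simp
qed

end
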